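(* Let $\mathbb{F}$ be an arbitrary field, let $G$ be any group and let $n$ be a positive integer. Let $\mathcal{U}_1$ and $\mathcal{U}_2$ denote the same Lie algebra $\mathrm{UT}_n^{(-)}(\mathbb{F})$ endowed with two $G$-gradings, and let $\mathcal{Z}_1=\mathfrak{z}(\mathcal{U}_1)$ and $\mathcal{Z}_2=\mathfrak{z}(\mathcal{U}_2)$ be their centres. Then the following assertions are equivalent: (1) $\mathcal{U}_1$ and $\mathcal{U}_2$ are practically $G$-graded isomorphic; (2) $\mathcal{U}_1/\mathcal{Z}_1$ and $\mathcal{U}_2/\mathcal{Z}_2$ are $G$-graded isomorphic; (3) $\mathcal{U}_1/\mathcal{Z}_1$ and $\mathcal{U}_2/\mathcal{Z}_2$ satisfy the same $G$-graded polynomial identities.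
   Context: $\mathrm{UT}_n^{(-)}(\mathbb{F})$ is the Lie algebra of upper triangular $n\times n$ matrices over $\mathbb{F}$ with bracket $[a,b]=ab-ba$; its centre is $\mathbb{F}\mathrm{I}$, where $\mathrm{I}$ is the identity matrix. $G$ is written multiplicatively. A $G$-grading on an algebra $\mathcal{A}$ is a vector space decomposition $\mathcal{A}=\bigoplus_{g\in G}\mathcal{A}_g$ with $\mathcal{A}_g\mathcal{A}_h\subseteq\mathcal{A}_{gh}$ for all $g,h\in G$. The centre of a $G$-graded Lie algebra $\mathcal U_i$ above is a graded ideal, and the quotient $\mathcal{U}_i/\mathcal{Z}_i$ carries the induced grading. A $G$-graded isomorphism is an algebra isomorphism $f:\mathcal{A}\to\mathcal{B}$ with $f(\mathcal{A}_g)\subseteq\mathcal{B}_g$ for all $g\in G$. Two $G$-graded algebras $\mathcal{L}_1,\mathcal{L}_2$ are practically $G$-graded isomorphic if there is an isomorphism of ungraded algebras $\psi:\mathcal{L}_1\to\mathcal{L}_2$ that induces a $G$-graded isomorphism $\mathcal{L}_1/\mathfrak{z}(\mathcal{L}_1)\to\mathcal{L}_2/\mathfrak{z}(\mathcal{L}_2)$. A $G$-graded polynomial is an element of the free Lie algebra over $\mathbb{F}$ on variables $x_i^{(g)}$ ($i\ge1$, $g\in G$), where $x_i^{(g)}$ is assigned degree $g$; it is a $G$-graded polynomial identity of a $G$-graded Lie algebra $\mathcal{L}$ if it vanishes under every substitution of each variable $x_i^{(g)}$ by an element of $\mathcal{L}_g$. *)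

theory Defs
  imports "Jordan_Normal_Form.VS_Connect" "HOL-Algebra.QuotRing"
begin

section \<open>Lie algebras\<close>

text \<open>Lie algebras over the field \<^typ>\<open>'f::field\<close> are \<^typ>\<open>('f, 'v) module\<close> records whose
  \<^const>\<open>monoid.mult\<close> is the Lie bracket. The component \<^const>\<open>monoid.one\<close> has no meaning for them.\<close>

locale lie_algebra = vectorspace K L
  for K :: "('f, 'k) ring_scheme" and L :: "('f, 'v) module" (structure) +
  assumes br_closed: "\<lbrakk>x \<in> carrier L; y \<in> carrier L\<rbrakk> \<Longrightarrow> x \<otimes> y \<in> carrier L"
    and br_add_left: "\<lbrakk>x \<in> carrier L; y \<in> carrier L; z \<in> carrier L\<rbrakk>
      \<Longrightarrow> (x \<oplus> y) \<otimes> z = x \<otimes> z \<oplus> y \<otimes> z"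
    and br_add_right: "\<lbrakk>x \<in> carrier L; y \<in> carrier L; z \<in> carrier L\<rbrakk>
      \<Longrightarrow> x \<otimes> (y \<oplus> z) = x \<otimes> y \<oplus> x \<otimes> z"
    and br_smult_left: "\<lbrakk>a \<in> carrier K; x \<in> carrier L; y \<in> carrier L\<rbrakk>
      \<Longrightarrow> (a \<odot> x) \<otimes> y = a \<odot> (x \<otimes> y)"
    and br_smult_right: "\<lbrakk>a \<in> carrier K; x \<in> carrier L; y \<in> carrier L\<rbrakk>
      \<Longrightarrow> x \<otimes> (a \<odot> y) = a \<odot> (x \<otimes> y)"
    and br_self: "x \<in> carrier L \<Longrightarrow> x \<otimes> x = \<zero>"
    and jacobi: "\<lbrakk>x \<in> carrier L; y \<in> carrier L; z \<in> carrier L\<rbrakk>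
      \<Longrightarrow> x \<otimes> (y \<otimes> z) \<oplus> y \<otimes> (z \<otimes> x) \<oplus> z \<otimes> (x \<otimes> y) = \<zero>"

definition alg_hom :: "('f::field, 'v) module \<Rightarrow> ('f, 'w) module \<Rightarrow> ('v \<Rightarrow> 'w) set" where
  "alg_hom L M = {f \<in> LinearCombinations.module_hom class_ring L M.
     \<forall>x\<in>carrier L. \<forall>y\<in>carrier L. f (x \<otimes>\<^bsub>L\<^esub> y) = f x \<otimes>\<^bsub>M\<^esub> f y}"

definition alg_iso :: "('f::field, 'v) module \<Rightarrow> ('f, 'w) module \<Rightarrow> ('v \<Rightarrow> 'w) set" where
  "alg_iso L M = {f \<in> alg_hom L M. bij_betw f (carrier L) (carrier M)}"

definition lie_center :: "('f, 'v) module \<Rightarrow> 'v set" where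
  "lie_center L = {z \<in> carrier L. \<forall>x\<in>carrier L. z \<otimes>\<^bsub>L\<^esub> x = \<zero>\<^bsub>L\<^esub>}"

text \<open>The ring structure agrees with \<^const>\<open>FactRing\<close>. In the scalar multiplication the union
  over the coset is needed since \<open>0 \<odot> (I +> x)\<close> has to be \<open>I\<close>, not \<open>{\<zero>}\<close>.\<close>

definition quot_alg :: "('f, 'v) module \<Rightarrow> 'v set \<Rightarrow> ('f, 'v set) module" where
  "quot_alg L I = \<lparr>carrier = a_rcosets\<^bsub>L\<^esub> I, mult = rcoset_mult L I,
     one = I +>\<^bsub>L\<^esub> \<one>\<^bsub>L\<^esub>, zero = I, add = set_add L,
     smult = (\<lambda>a X. \<Union>x\<in>X. I +>\<^bsub>L\<^esub> (a \<odot>\<^bsub>L\<^esub> x))\<rparr>"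

definition UT_lie :: "'f itself \<Rightarrow> nat \<Rightarrow> ('f::field, 'f mat) module" where
  "UT_lie ty n = (module_mat ty n n)
     \<lparr>carrier := {A \<in> carrier_mat n n. upper_triangular A}, mult := (\<lambda>A B. A * B - B * A)\<rparr>"


section \<open>Group gradings\<close>

text \<open>A grading is given by its family \<open>A\<close> of homogeneous components; the values of \<open>A\<close> outside
  \<open>carrier G\<close> are irrelevant. The second conjunct says that \<open>L\<close> is the internal direct sum of
  the components: every element is a finite sum of homogeneous elements in a unique way.\<close>

definition grading :: "('g, 'm) monoid_scheme \<Rightarrow> ('f::field, 'v) module \<Rightarrow> ('g \<Rightarrow> 'v set) \<Rightarrow> bool"
where
  "grading G L A \<longleftrightarrow>
     (\<forall>g\<in>carrier G. VectorSpace.subspace class_ring (A g) L) \<and>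
     (\<forall>x\<in>carrier L. \<exists>!c. c \<in> (\<Pi>\<^sub>E g\<in>carrier G. A g) \<and>
        finite {g \<in> carrier G. c g \<noteq> \<zero>\<^bsub>L\<^esub>} \<and>
        x = (\<Oplus>\<^bsub>L\<^esub> g \<in> {g \<in> carrier G. c g \<noteq> \<zero>\<^bsub>L\<^esub>}. c g)) \<and>
     (\<forall>g\<in>carrier G. \<forall>h\<in>carrier G. \<forall>x\<in>A g. \<forall>y\<in>A h. x \<otimes>\<^bsub>L\<^esub> y \<in> A (g \<otimes>\<^bsub>G\<^esub> h))"

definition quot_grading :: "('f, 'v) module \<Rightarrow> 'v set \<Rightarrow> ('g \<Rightarrow> 'v set) \<Rightarrow> 'g \<Rightarrow> 'v set set" where
  "quot_grading L I A g = (\<lambda>x. I +>\<^bsub>L\<^esub> x) ` A g"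

definition graded_iso :: "('g, 'm) monoid_scheme \<Rightarrow> ('f::field, 'v) module \<Rightarrow> ('g \<Rightarrow> 'v set) \<Rightarrow>
    ('f, 'w) module \<Rightarrow> ('g \<Rightarrow> 'w set) \<Rightarrow> ('v \<Rightarrow> 'w) set" where
  "graded_iso G L A M B = {f \<in> alg_iso L M. \<forall>g\<in>carrier G. f ` A g \<subseteq> B g}"

definition graded_isomorphic :: "('g, 'm) monoid_scheme \<Rightarrow> ('f::field, 'v) module \<Rightarrow>
    ('g \<Rightarrow> 'v set) \<Rightarrow> ('f, 'w) module \<Rightarrow> ('g \<Rightarrow> 'w set) \<Rightarrow> bool" where
  "graded_isomorphic G L A M B \<longleftrightarrow> graded_iso G L A M B \<noteq> {}"

definition practically_graded_isomorphic :: "('g, 'm) monoid_scheme \<Rightarrow> ('f::field, 'v) module \<Rightarrow>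
    ('g \<Rightarrow> 'v set) \<Rightarrow> ('f, 'w) module \<Rightarrow> ('g \<Rightarrow> 'w set) \<Rightarrow> bool" where
  "practically_graded_isomorphic G L A M B \<longleftrightarrow>
     (\<exists>\<psi>\<in>alg_iso L M.
      \<exists>\<phi>\<in>graded_iso G (quot_alg L (lie_center L)) (quot_grading L (lie_center L) A)
                       (quot_alg M (lie_center M)) (quot_grading M (lie_center M) B).
        \<forall>x\<in>carrier L. \<phi> (lie_center L +>\<^bsub>L\<^esub> x) = lie_center M +>\<^bsub>M\<^esub> \<psi> x)"


section \<open>The free Lie algebra and graded polynomial identities\<close>

datatype ('f, lie_vars: 'x) lie_term =
    LVar 'x
  | LZero
  | LAdd "('f, 'x) lie_term" "('f, 'x) lie_term"
  | LSmult 'f "('f, 'x) lie_term"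
  | LBr "('f, 'x) lie_term" "('f, 'x) lie_term"

inductive lie_eq :: "('f::field, 'x) lie_term \<Rightarrow> ('f, 'x) lie_term \<Rightarrow> bool" where
  refl: "lie_eq s s"
| sym: "lie_eq s t \<Longrightarrow> lie_eq t s"
| trans: "lie_eq s t \<Longrightarrow> lie_eq t u \<Longrightarrow> lie_eq s u"
| cong_add: "lie_eq s s' \<Longrightarrow> lie_eq t t' \<Longrightarrow> lie_eq (LAdd s t) (LAdd s' t')"
| cong_smult: "lie_eq s s' \<Longrightarrow> lie_eq (LSmult a s) (LSmult a s')"
| cong_br: "lie_eq s s' \<Longrightarrow> lie_eq t t' \<Longrightarrow> lie_eq (LBr s t) (LBr s' t')"
| add_assoc: "lie_eq (LAdd (LAdd s t) u) (LAdd s (LAdd t u))"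
| add_comm: "lie_eq (LAdd s t) (LAdd t s)"
| add_zero: "lie_eq (LAdd LZero s) s"
| add_inv: "lie_eq (LAdd (LSmult (- 1) s) s) LZero"
| smult_add: "lie_eq (LSmult a (LAdd s t)) (LAdd (LSmult a s) (LSmult a t))"
| add_smult: "lie_eq (LSmult (a + b) s) (LAdd (LSmult a s) (LSmult b s))"
| mult_smult: "lie_eq (LSmult (a * b) s) (LSmult a (LSmult b s))"
| one_smult: "lie_eq (LSmult 1 s) s"
| br_add_left: "lie_eq (LBr (LAdd s t) u) (LAdd (LBr s u) (LBr t u))"
| br_add_right: "lie_eq (LBr s (LAdd t u)) (LAdd (LBr s t) (LBr s u))"
| br_smult_left: "lie_eq (LBr (LSmult a s) t) (LSmult a (LBr s t))"
| br_smult_right: "lie_eq (LBr s (LSmult a t)) (LSmult a (LBr s t))"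
| br_self: "lie_eq (LBr s s) LZero"
| jacobi: "lie_eq (LAdd (LAdd (LBr s (LBr t u)) (LBr t (LBr u s))) (LBr u (LBr s t))) LZero"

definition lie_terms :: "'x set \<Rightarrow> ('f::field, 'x) lie_term set" where
  "lie_terms X = {t. lie_vars t \<subseteq> X}"

definition lie_rel :: "'x set \<Rightarrow> (('f::field, 'x) lie_term \<times> ('f, 'x) lie_term) set" where
  "lie_rel X = {(s, t). s \<in> lie_terms X \<and> t \<in> lie_terms X \<and> lie_eq s t}"

definition lie_class :: "'x set \<Rightarrow> ('f::field, 'x) lie_term \<Rightarrow> ('f, 'x) lie_term set" where
  "lie_class X t = lie_rel X `` {t}"

definition free_lie :: "'x set \<Rightarrow> ('f::field, ('f, 'x) lie_term set) module" where
  "free_lie X = \<lparr>carrier = lie_terms X // lie_rel X,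
     mult = (\<lambda>P Q. \<Union>s\<in>P. \<Union>t\<in>Q. lie_class X (LBr s t)),
     one = lie_class X LZero, zero = lie_class X LZero,
     add = (\<lambda>P Q. \<Union>s\<in>P. \<Union>t\<in>Q. lie_class X (LAdd s t)),
     smult = (\<lambda>a P. \<Union>s\<in>P. lie_class X (LSmult a s))\<rparr>"

definition free_lie_var :: "'x set \<Rightarrow> 'x \<Rightarrow> ('f::field, 'x) lie_term set" where
  "free_lie_var X x = lie_class X (LVar x)"

text \<open>The pair \<open>(i, g)\<close> stands for the variable \<open>x\<^sub>i\<close> of degree \<open>g\<close>.\<close>

definition graded_vars :: "('g, 'm) monoid_scheme \<Rightarrow> (nat \<times> 'g) set" where
  "graded_vars G = {1..} \<times> carrier G"

text \<open>Substitutions of elements of \<open>L\<close> for the variables are the homomorphisms from the free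
  Lie algebra to \<open>L\<close>: every such substitution extends to exactly one homomorphism, see
  \<open>free_lie_universal\<close> and \<open>free_lie_hom_unique\<close>.\<close>

definition graded_identities :: "('g, 'm) monoid_scheme \<Rightarrow> ('f::field, 'v) module \<Rightarrow>
    ('g \<Rightarrow> 'v set) \<Rightarrow> ('f, nat \<times> 'g) lie_term set set" where
  "graded_identities G L A = {f \<in> carrier (free_lie (graded_vars G)).
     \<forall>\<phi>\<in>alg_hom (free_lie (graded_vars G)) L.
       (\<forall>(i, g)\<in>graded_vars G. \<phi> (free_lie_var (graded_vars G) (i, g)) \<in> A g)
         \<longrightarrow> \<phi> f = \<zero>\<^bsub>L\<^esub>}"


section \<open>Basic facts\<close>

subsection \<open>The free Lie algebra\<close>

lemma equiv_lie_rel: "equiv (lie_terms X) (lie_rel X)"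
  by (rule equivI)
    (auto simp: lie_rel_def refl_on_def sym_def trans_def
      intro: lie_eq.refl lie_eq.sym lie_eq.trans)

lemma lie_terms_simps [simp]:
  "LVar x \<in> lie_terms X \<longleftrightarrow> x \<in> X"
  "LZero \<in> lie_terms X"
  "LAdd s t \<in> lie_terms X \<longleftrightarrow> s \<in> lie_terms X \<and> t \<in> lie_terms X"
  "LSmult a s \<in> lie_terms X \<longleftrightarrow> s \<in> lie_terms X"
  "LBr s t \<in> lie_terms X \<longleftrightarrow> s \<in> lie_terms X \<and> t \<in> lie_terms X"
  by (auto simp: lie_terms_def)

lemma lie_relD: "(s, t) \<in> lie_rel X \<Longrightarrow> s \<in> lie_terms X \<and> t \<in> lie_terms X \<and> lie_eq s t"
  by (simp add: lie_rel_def)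

lemma lie_class_eq_iff:
  assumes "s \<in> lie_terms X" "t \<in> lie_terms X"
  shows "lie_class X s = lie_class X t \<longleftrightarrow> lie_eq s t"
  using assms unfolding lie_class_def
  by (subst eq_equiv_class_iff[OF equiv_lie_rel]) (auto simp: lie_rel_def)

lemma free_lie_carrierI: "t \<in> lie_terms X \<Longrightarrow> lie_class X t \<in> carrier (free_lie X)"
  by (simp add: free_lie_def lie_class_def quotientI)

lemma free_lie_carrierE:
  assumes "P \<in> carrier (free_lie X)"
  obtains t where "t \<in> lie_terms X" "P = lie_class X t"
  using assms by (auto simp: free_lie_def lie_class_def elim: quotientE)

lemma free_lie_class_ops:
  assumes "s \<in> lie_terms X" "t \<in> lie_terms X"
  shows "lie_class X s \<oplus>\<^bsub>free_lie X\<^esub> lie_class X t = lie_class X (LAdd s t)"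
    and "lie_class X s \<otimes>\<^bsub>free_lie X\<^esub> lie_class X t = lie_class X (LBr s t)"
    and "a \<odot>\<^bsub>free_lie X\<^esub> lie_class X s = lie_class X (LSmult a s)"
proof -
  have 1: "congruent2 (lie_rel X) (lie_rel X) (\<lambda>s t. lie_class X (LAdd s t))"
    and 2: "congruent2 (lie_rel X) (lie_rel X) (\<lambda>s t. lie_class X (LBr s t))"
    and 3: "congruent (lie_rel X) (\<lambda>s. lie_class X (LSmult a s))"
    by (auto simp: congruent2_def congruent_def lie_class_eq_iff dest!: lie_relD del: subset_antisym
        intro: lie_eq.cong_add lie_eq.cong_br lie_eq.cong_smult)
  show "lie_class X s \<oplus>\<^bsub>free_lie X\<^esub> lie_class X t = lie_class X (LAdd s t)"
    using UN_equiv_class2[OF equiv_lie_rel equiv_lie_rel 1] assms by (simp add: free_lie_def flip: lie_class_def)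
  show "lie_class X s \<otimes>\<^bsub>free_lie X\<^esub> lie_class X t = lie_class X (LBr s t)"
    using UN_equiv_class2[OF equiv_lie_rel equiv_lie_rel 2] assms by (simp add: free_lie_def flip: lie_class_def)
  show "a \<odot>\<^bsub>free_lie X\<^esub> lie_class X s = lie_class X (LSmult a s)"
    using UN_equiv_class[OF equiv_lie_rel 3] assms by (simp add: free_lie_def flip: lie_class_def)
qed

lemma free_lie_zero: "\<zero>\<^bsub>free_lie X\<^esub> = lie_class X LZero"
  by (simp add: free_lie_def)

lemma vectorspace_class_ringI:
  assumes "abelian_group (M :: ('f::field, 'v) module)"
    and "\<And>a x. x \<in> carrier M \<Longrightarrow> a \<odot>\<^bsub>M\<^esub> x \<in> carrier M"
    and "\<And>a b x. x \<in> carrier M \<Longrightarrow> (a + b) \<odot>\<^bsub>M\<^esub> x = a \<odot>\<^bsub>M\<^esub> x \<oplus>\<^bsub>M\<^esub> b \<odot>\<^bsub>M\<^esub> x"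
    and "\<And>a x y. \<lbrakk>x \<in> carrier M; y \<in> carrier M\<rbrakk>
      \<Longrightarrow> a \<odot>\<^bsub>M\<^esub> (x \<oplus>\<^bsub>M\<^esub> y) = a \<odot>\<^bsub>M\<^esub> x \<oplus>\<^bsub>M\<^esub> a \<odot>\<^bsub>M\<^esub> y"
    and "\<And>a b x. x \<in> carrier M \<Longrightarrow> (a * b) \<odot>\<^bsub>M\<^esub> x = a \<odot>\<^bsub>M\<^esub> (b \<odot>\<^bsub>M\<^esub> x)"
    and "\<And>x. x \<in> carrier M \<Longrightarrow> 1 \<odot>\<^bsub>M\<^esub> x = x"
  shows "vectorspace class_ring M"
proof -
  have f: "Ring.field (class_ring :: 'f ring)" by (rule class_field.field_axioms)
  then have "Module.module class_ring M"
    using assms by (intro moduleI) (auto simp: fieldE(1))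
  with f show ?thesis by (simp add: vectorspace_def)
qed

lemma lie_algebra_free_lie:
  fixes X :: "'x set"
  shows "lie_algebra class_ring (free_lie X :: ('f::field, ('f, 'x) lie_term set) module)"
proof -
  let ?F = "free_lie X :: ('f, ('f, 'x) lie_term set) module"
  have ag: "abelian_group ?F"
  proof (rule abelian_groupI)
    show "\<exists>y\<in>carrier ?F. y \<oplus>\<^bsub>?F\<^esub> x = \<zero>\<^bsub>?F\<^esub>" if "x \<in> carrier ?F" for x
    proof -
      from that obtain t where t: "t \<in> lie_terms X" "x = lie_class X t"
        by (rule free_lie_carrierE)
      then show ?thesis
        by (intro bexI[of _ "lie_class X (LSmult (- 1) t)"])
          (auto simp: free_lie_class_ops free_lie_zero lie_class_eq_iff
            intro!: free_lie_carrierI lie_eq.add_inv)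
    qed
  qed (auto elim!: free_lie_carrierE simp: free_lie_class_ops free_lie_zero lie_class_eq_iff
      intro!: free_lie_carrierI del: subset_antisym
      intro: lie_eq.add_assoc lie_eq.add_comm lie_eq.add_zero)
  have "vectorspace class_ring ?F"
    by (rule vectorspace_class_ringI[OF ag])
      (auto elim!: free_lie_carrierE simp: free_lie_class_ops lie_class_eq_iff
        intro!: free_lie_carrierI del: subset_antisym
        intro: lie_eq.smult_add lie_eq.add_smult lie_eq.mult_smult lie_eq.one_smult)
  moreover have "lie_algebra_axioms class_ring ?F"
    by unfold_locales
      (auto elim!: free_lie_carrierE simp: free_lie_class_ops free_lie_zero lie_class_eq_iff
        intro!: free_lie_carrierI del: subset_antisym
        intro: lie_eq.br_add_left lie_eq.br_add_right lie_eq.br_smult_left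
          lie_eq.br_smult_right lie_eq.br_self lie_eq.jacobi)
  ultimately show ?thesis by (rule lie_algebra.intro)
qed

fun lie_eval :: "('f, 'v) module \<Rightarrow> ('x \<Rightarrow> 'v) \<Rightarrow> ('f, 'x) lie_term \<Rightarrow> 'v" where
  "lie_eval L \<sigma> (LVar x) = \<sigma> x"
| "lie_eval L \<sigma> LZero = \<zero>\<^bsub>L\<^esub>"
| "lie_eval L \<sigma> (LAdd s t) = lie_eval L \<sigma> s \<oplus>\<^bsub>L\<^esub> lie_eval L \<sigma> t"
| "lie_eval L \<sigma> (LSmult a s) = a \<odot>\<^bsub>L\<^esub> lie_eval L \<sigma> s"
| "lie_eval L \<sigma> (LBr s t) = lie_eval L \<sigma> s \<otimes>\<^bsub>L\<^esub> lie_eval L \<sigma> t"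

lemma lie_eval_closed:
  assumes "lie_algebra class_ring (L :: ('f::field, 'v) module)" and "\<And>x. \<sigma> x \<in> carrier L"
  shows "lie_eval L \<sigma> t \<in> carrier L"
proof -
  interpret lie_algebra class_ring L by fact
  show ?thesis by (induction t) (use assms(2) smult_closed br_closed in auto)
qed

lemma lie_eval_cong:
  assumes "lie_algebra class_ring (L :: ('f::field, 'v) module)" and "\<And>x. \<sigma> x \<in> carrier L"
    and "lie_eq s t"
  shows "lie_eval L \<sigma> s = lie_eval L \<sigma> t"
proof -
  interpret lie_algebra class_ring L by fact
  note [simp] = lie_eval_closed[OF assms(1,2)]
  have sm: "a \<odot>\<^bsub>L\<^esub> lie_eval L \<sigma> u \<in> carrier L" for a u
    using smult_closed by simp
  from assms(3) show ?thesis
  proof induction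
    case (add_inv s)
    have "((- 1) \<odot>\<^bsub>L\<^esub> lie_eval L \<sigma> s) \<oplus>\<^bsub>L\<^esub> (1 \<odot>\<^bsub>L\<^esub> lie_eval L \<sigma> s)
        = (- 1 + 1) \<odot>\<^bsub>L\<^esub> lie_eval L \<sigma> s"
      using smult_l_distr[of "- 1" 1 "lie_eval L \<sigma> s"] by simp
    then show ?case using smult_one[of "lie_eval L \<sigma> s"] smult_l_null[of "lie_eval L \<sigma> s"] by simp
  next
    case (add_smult a b s)
    then show ?case using smult_l_distr[of a b "lie_eval L \<sigma> s"] by simp
  next
    case (mult_smult a b s)
    then show ?case using smult_assoc1[of a b "lie_eval L \<sigma> s"] by simp
  next
    case (one_smult s)
    then show ?case using smult_one[of "lie_eval L \<sigma> s"] by simp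
  qed (simp_all add: M.add.m_ac smult_r_distr br_add_left br_add_right br_smult_left
      br_smult_right br_self jacobi)
qed

text \<open>\<^term>\<open>free_lie X\<close> is free on \<open>X\<close>.\<close>

lemma free_lie_universal:
  assumes L: "lie_algebra class_ring (L :: ('f::field, 'v) module)" and \<sigma>: "\<sigma> \<in> X \<rightarrow> carrier L"
  shows "\<exists>\<phi>\<in>alg_hom (free_lie X) L. \<forall>x\<in>X. \<phi> (free_lie_var X x) = \<sigma> x"
proof -
  interpret lie_algebra class_ring L by fact
  define \<tau> where "\<tau> x = (if x \<in> X then \<sigma> x else \<zero>\<^bsub>L\<^esub>)" for x
  have \<tau>: "\<tau> x \<in> carrier L" for x using \<sigma> by (auto simp: \<tau>_def)
  define \<phi> where "\<phi> P = lie_eval L \<tau> (SOME t. t \<in> P)" for P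
  have \<phi>: "\<phi> (lie_class X t) = lie_eval L \<tau> t" if "t \<in> lie_terms X" for t
  proof -
    have "t \<in> lie_class X t" using that by (simp add: lie_class_def lie_rel_def lie_eq.refl)
    then have "(SOME s. s \<in> lie_class X t) \<in> lie_class X t" by (rule someI)
    then have "lie_eq t (SOME s. s \<in> lie_class X t)"
      unfolding lie_class_def using lie_relD by blast
    then show ?thesis unfolding \<phi>_def by (simp add: lie_eval_cong[OF L \<tau>])
  qed
  have "\<phi> \<in> alg_hom (free_lie X) L"
    unfolding alg_hom_def LinearCombinations.module_hom_def
    by (auto elim!: free_lie_carrierE simp: free_lie_class_ops \<phi> lie_eval_closed[OF L \<tau>])
  moreover have "\<phi> (free_lie_var X x) = \<sigma> x" if "x \<in> X" for x
    using that by (simp add: free_lie_var_def \<phi> \<tau>_def)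
  ultimately show ?thesis by blast
qed

lemma free_lie_hom_unique:
  fixes X :: "'x set"
  assumes L: "lie_algebra class_ring (L :: ('f::field, 'v) module)"
    and \<phi>: "\<phi> \<in> alg_hom (free_lie X) L" and \<psi>: "\<psi> \<in> alg_hom (free_lie X) L"
    and eq: "\<And>x. x \<in> X \<Longrightarrow> \<phi> (free_lie_var X x) = \<psi> (free_lie_var X x)"
    and f: "f \<in> carrier (free_lie X)"
  shows "\<phi> f = \<psi> f"
proof -
  interpret lie_algebra class_ring L by fact
  have ev: "\<chi> (lie_class X t) = lie_eval L (\<lambda>x. \<chi> (free_lie_var X x)) t"
    if \<chi>: "\<chi> \<in> alg_hom (free_lie X) L" and t: "t \<in> lie_terms X" for \<chi> t
  proof -
    have cl: "\<chi> (lie_class X s) \<in> carrier L" if "s \<in> lie_terms X" for s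
      using \<chi> free_lie_carrierI[OF that] by (auto simp: alg_hom_def LinearCombinations.module_hom_def)
    have add: "\<chi> (lie_class X (LAdd s t)) = \<chi> (lie_class X s) \<oplus>\<^bsub>L\<^esub> \<chi> (lie_class X t)"
      and br: "\<chi> (lie_class X (LBr s t)) = \<chi> (lie_class X s) \<otimes>\<^bsub>L\<^esub> \<chi> (lie_class X t)"
      and sm: "\<chi> (lie_class X (LSmult a s)) = a \<odot>\<^bsub>L\<^esub> \<chi> (lie_class X s)"
      if "s \<in> lie_terms X" "t \<in> lie_terms X" for s t a
      using \<chi> that free_lie_carrierI[of s X] free_lie_carrierI[of t X]
      by (simp_all add: alg_hom_def LinearCombinations.module_hom_def flip: free_lie_class_ops)
    have "\<chi> (lie_class X LZero) = \<chi> (lie_class X (LSmult 0 LZero))"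
    proof -
      interpret F: lie_algebra class_ring "free_lie X :: ('f, ('f, 'x) lie_term set) module"
        by (rule lie_algebra_free_lie)
      let ?Z = "LZero :: ('f, 'x) lie_term"
      show ?thesis
        using F.smult_l_null[of "lie_class X ?Z"] free_lie_carrierI[of ?Z X]
          free_lie_class_ops(3)[of ?Z X ?Z 0]
        by (simp add: free_lie_zero)
    qed
    also have "\<dots> = \<zero>\<^bsub>L\<^esub>"
      using sm[of LZero LZero 0] cl[of LZero] smult_l_null[of "\<chi> (lie_class X LZero)"] by simp
    finally have zero: "\<chi> (lie_class X LZero) = \<zero>\<^bsub>L\<^esub>" .
    from t show ?thesis
      by (induction t) (simp_all add: add br sm zero free_lie_var_def)
  qed
  from f obtain t where t: "t \<in> lie_terms X" "f = lie_class X t" by (rule free_lie_carrierE)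
  have "lie_eval L (\<lambda>x. \<phi> (free_lie_var X x)) t = lie_eval L (\<lambda>x. \<psi> (free_lie_var X x)) t"
    using t(1) by (induction t) (simp_all add: eq)
  with t show ?thesis by (simp add: ev \<phi> \<psi>)
qed


subsection \<open>The quotient by the centre\<close>

context lie_algebra
begin

lemma br_zero: "x \<in> carrier L \<Longrightarrow> \<zero>\<^bsub>L\<^esub> \<otimes>\<^bsub>L\<^esub> x = \<zero>\<^bsub>L\<^esub>" "x \<in> carrier L \<Longrightarrow> x \<otimes>\<^bsub>L\<^esub> \<zero>\<^bsub>L\<^esub> = \<zero>\<^bsub>L\<^esub>"
  using br_smult_left[of "\<zero>\<^bsub>K\<^esub>" x x] br_smult_right[of "\<zero>\<^bsub>K\<^esub>" x x] by (auto simp: br_closed)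

lemma br_antisym:
  assumes "x \<in> carrier L" "y \<in> carrier L"
  shows "x \<otimes>\<^bsub>L\<^esub> y \<oplus>\<^bsub>L\<^esub> y \<otimes>\<^bsub>L\<^esub> x = \<zero>\<^bsub>L\<^esub>"
proof -
  have "x \<otimes>\<^bsub>L\<^esub> y \<oplus>\<^bsub>L\<^esub> y \<otimes>\<^bsub>L\<^esub> x = (x \<oplus>\<^bsub>L\<^esub> y) \<otimes>\<^bsub>L\<^esub> (x \<oplus>\<^bsub>L\<^esub> y)"
    unfolding br_add_left[OF assms M.add.m_closed[OF assms]] using assms
    by (simp add: br_add_right br_self[of x] br_self[of y] br_closed)
  also have "\<dots> = \<zero>\<^bsub>L\<^esub>" using assms by (simp add: br_self)
  finally show ?thesis .
qed

lemma center_closed: "z \<in> lie_center L \<Longrightarrow> z \<in> carrier L"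
  and center_left: "z \<in> lie_center L \<Longrightarrow> x \<in> carrier L \<Longrightarrow> z \<otimes>\<^bsub>L\<^esub> x = \<zero>\<^bsub>L\<^esub>"
  by (auto simp: lie_center_def)

lemma center_right:
  assumes "z \<in> lie_center L" "x \<in> carrier L" shows "x \<otimes>\<^bsub>L\<^esub> z = \<zero>\<^bsub>L\<^esub>"
  using br_antisym[of z x] assms by (simp add: center_closed center_left br_closed)

lemma center_smult: "a \<in> carrier K \<Longrightarrow> z \<in> lie_center L \<Longrightarrow> a \<odot>\<^bsub>L\<^esub> z \<in> lie_center L"
  by (simp add: lie_center_def br_smult_left)

lemma center_subgroup: "additive_subgroup (lie_center L) L"
proof (rule additive_subgroup.intro, rule add.subgroupI)
  fix z assume z: "z \<in> lie_center L"
  have "\<ominus>\<^bsub>L\<^esub> z = (\<ominus>\<^bsub>K\<^esub> \<one>\<^bsub>K\<^esub>) \<odot>\<^bsub>L\<^esub> z"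
    using smult_l_minus[of "\<one>\<^bsub>K\<^esub>" z] center_closed[OF z] by simp
  then show "\<ominus>\<^bsub>L\<^esub> z \<in> lie_center L" using center_smult[of "\<ominus>\<^bsub>K\<^esub> \<one>\<^bsub>K\<^esub>" z] z by simp
qed (auto simp: lie_center_def br_zero br_add_left)

lemma center_abelian_subgroup: "abelian_subgroup (lie_center L) L"
  by (rule abelian_subgroupI3[OF center_subgroup]) (rule M.abelian_group_axioms)

lemma coset_eq_iff:
  assumes "x \<in> carrier L" "y \<in> carrier L"
  shows "lie_center L +>\<^bsub>L\<^esub> x = lie_center L +>\<^bsub>L\<^esub> y \<longleftrightarrow> (\<exists>z\<in>lie_center L. x = z \<oplus>\<^bsub>L\<^esub> y)"
proof -
  interpret I: abelian_subgroup "lie_center L" L by (rule center_abelian_subgroup)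
  show ?thesis
  proof
    assume "lie_center L +>\<^bsub>L\<^esub> x = lie_center L +>\<^bsub>L\<^esub> y"
    then have "x \<in> lie_center L +>\<^bsub>L\<^esub> y" using I.a_rcos_self[OF assms(1)] by simp
    then show "\<exists>z\<in>lie_center L. x = z \<oplus>\<^bsub>L\<^esub> y" by (simp add: a_r_coset_def')
  next
    assume "\<exists>z\<in>lie_center L. x = z \<oplus>\<^bsub>L\<^esub> y"
    then have "x \<in> lie_center L +>\<^bsub>L\<^esub> y" by (simp add: a_r_coset_def')
    then show "lie_center L +>\<^bsub>L\<^esub> x = lie_center L +>\<^bsub>L\<^esub> y"
      using I.a_repr_independence'[OF _ assms(2)] by simp
  qed
qed

lemma coset_memE:
  assumes "x' \<in> lie_center L +>\<^bsub>L\<^esub> x"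
  obtains z where "z \<in> lie_center L" "x' = z \<oplus>\<^bsub>L\<^esub> x"
  using assms by (auto simp: a_r_coset_def')

lemma coset_self: "x \<in> carrier L \<Longrightarrow> x \<in> lie_center L +>\<^bsub>L\<^esub> x"
  using abelian_subgroup.a_rcos_self[OF center_abelian_subgroup] .

lemma quot_ops:
  assumes x: "x \<in> carrier L" and y: "y \<in> carrier L"
  shows "(lie_center L +>\<^bsub>L\<^esub> x) \<oplus>\<^bsub>quot_alg L (lie_center L)\<^esub> (lie_center L +>\<^bsub>L\<^esub> y)
      = lie_center L +>\<^bsub>L\<^esub> (x \<oplus>\<^bsub>L\<^esub> y)"
    and "(lie_center L +>\<^bsub>L\<^esub> x) \<otimes>\<^bsub>quot_alg L (lie_center L)\<^esub> (lie_center L +>\<^bsub>L\<^esub> y)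
      = lie_center L +>\<^bsub>L\<^esub> (x \<otimes>\<^bsub>L\<^esub> y)"
    and "a \<in> carrier K \<Longrightarrow> a \<odot>\<^bsub>quot_alg L (lie_center L)\<^esub> (lie_center L +>\<^bsub>L\<^esub> x)
      = lie_center L +>\<^bsub>L\<^esub> (a \<odot>\<^bsub>L\<^esub> x)"
proof -
  interpret I: abelian_subgroup "lie_center L" L by (rule center_abelian_subgroup)
  show "(lie_center L +>\<^bsub>L\<^esub> x) \<oplus>\<^bsub>quot_alg L (lie_center L)\<^esub> (lie_center L +>\<^bsub>L\<^esub> y)
      = lie_center L +>\<^bsub>L\<^esub> (x \<oplus>\<^bsub>L\<^esub> y)"
    using I.a_rcos_sum[OF x y] by (simp add: quot_alg_def)
  have "lie_center L +>\<^bsub>L\<^esub> (x' \<otimes>\<^bsub>L\<^esub> y') = lie_center L +>\<^bsub>L\<^esub> (x \<otimes>\<^bsub>L\<^esub> y)"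
    if xy: "x' \<in> lie_center L +>\<^bsub>L\<^esub> x" "y' \<in> lie_center L +>\<^bsub>L\<^esub> y" for x' y'
  proof -
    obtain z w where "z \<in> lie_center L" "x' = z \<oplus>\<^bsub>L\<^esub> x" "w \<in> lie_center L" "y' = w \<oplus>\<^bsub>L\<^esub> y"
      using xy by (auto elim!: coset_memE)
    then have "x' \<otimes>\<^bsub>L\<^esub> y' = x \<otimes>\<^bsub>L\<^esub> y"
      using x y by (simp add: br_add_left br_add_right center_left center_right center_closed br_closed)
    then show ?thesis by simp
  qed
  then show "(lie_center L +>\<^bsub>L\<^esub> x) \<otimes>\<^bsub>quot_alg L (lie_center L)\<^esub> (lie_center L +>\<^bsub>L\<^esub> y)
      = lie_center L +>\<^bsub>L\<^esub> (x \<otimes>\<^bsub>L\<^esub> y)"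
    using coset_self[OF x] coset_self[OF y]
    unfolding quot_alg_def rcoset_mult_def module.simps ring.simps monoid.simps by blast
  assume a: "a \<in> carrier K"
  have "lie_center L +>\<^bsub>L\<^esub> (a \<odot>\<^bsub>L\<^esub> x') = lie_center L +>\<^bsub>L\<^esub> (a \<odot>\<^bsub>L\<^esub> x)"
    if "x' \<in> lie_center L +>\<^bsub>L\<^esub> x" for x'
  proof -
    obtain z where z: "z \<in> lie_center L" "x' = z \<oplus>\<^bsub>L\<^esub> x" using \<open>x' \<in> _\<close> by (rule coset_memE)
    have "a \<odot>\<^bsub>L\<^esub> x' = a \<odot>\<^bsub>L\<^esub> z \<oplus>\<^bsub>L\<^esub> a \<odot>\<^bsub>L\<^esub> x"
      using smult_r_distr[OF a center_closed[OF z(1)] x] z(2) by simp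
    then show ?thesis
      using coset_eq_iff[of "a \<odot>\<^bsub>L\<^esub> x'" "a \<odot>\<^bsub>L\<^esub> x"] center_smult[OF a z(1)]
        smult_closed[OF a x] smult_closed[OF a center_closed[OF z(1)]] M.add.m_closed
      by metis
  qed
  then show "a \<odot>\<^bsub>quot_alg L (lie_center L)\<^esub> (lie_center L +>\<^bsub>L\<^esub> x)
      = lie_center L +>\<^bsub>L\<^esub> (a \<odot>\<^bsub>L\<^esub> x)"
    using coset_self[OF x] unfolding quot_alg_def module.simps by blast
qed

end

lemma lie_algebra_quot_center:
  assumes "lie_algebra class_ring (L :: ('f::field, 'v) module)"
  shows "lie_algebra class_ring (quot_alg L (lie_center L))"
proof -
  interpret lie_algebra class_ring L by fact
  interpret I: abelian_subgroup "lie_center L" L by (rule center_abelian_subgroup)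
  let ?Q = "quot_alg L (lie_center L)" and ?c = "\<lambda>x. lie_center L +>\<^bsub>L\<^esub> x"
  have car: "carrier ?Q = ?c ` carrier L"
    by (auto simp: quot_alg_def A_RCOSETS_def' )
  have z: "\<zero>\<^bsub>?Q\<^esub> = ?c \<zero>\<^bsub>L\<^esub>"
    by (simp add: quot_alg_def M.a_coset_add_zero I.a_subset)
  have sm: "a \<odot>\<^bsub>L\<^esub> x \<in> carrier L" if "x \<in> carrier L" for a x
    using smult_closed[OF _ that, of a] by simp
  have vs: "(a + b) \<odot>\<^bsub>L\<^esub> x = a \<odot>\<^bsub>L\<^esub> x \<oplus>\<^bsub>L\<^esub> b \<odot>\<^bsub>L\<^esub> x"
    "(a * b) \<odot>\<^bsub>L\<^esub> x = a \<odot>\<^bsub>L\<^esub> (b \<odot>\<^bsub>L\<^esub> x)" "1 \<odot>\<^bsub>L\<^esub> x = x"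
    if "x \<in> carrier L" for a b x
    using smult_l_distr[of a b x] smult_assoc1[of a b x] smult_one[of x] that by simp_all
  have vs2: "a \<odot>\<^bsub>L\<^esub> (x \<oplus>\<^bsub>L\<^esub> y) = a \<odot>\<^bsub>L\<^esub> x \<oplus>\<^bsub>L\<^esub> a \<odot>\<^bsub>L\<^esub> y"
    if "x \<in> carrier L" "y \<in> carrier L" for a x y
    using smult_r_distr[of a x y] that by simp
  have bs: "(a \<odot>\<^bsub>L\<^esub> x) \<otimes>\<^bsub>L\<^esub> y = a \<odot>\<^bsub>L\<^esub> (x \<otimes>\<^bsub>L\<^esub> y)"
    "x \<otimes>\<^bsub>L\<^esub> (a \<odot>\<^bsub>L\<^esub> y) = a \<odot>\<^bsub>L\<^esub> (x \<otimes>\<^bsub>L\<^esub> y)"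
    if "x \<in> carrier L" "y \<in> carrier L" for a x y
    using br_smult_left[of a x y] br_smult_right[of a x y] that by simp_all
  have ops3: "a \<odot>\<^bsub>?Q\<^esub> ?c x = ?c (a \<odot>\<^bsub>L\<^esub> x)" if "x \<in> carrier L" for a x
    using quot_ops(3)[OF that that, of a] by simp
  have "vectorspace class_ring ?Q"
  proof (rule vectorspace_class_ringI)
    show "abelian_group ?Q"
    proof (rule abelian_groupI)
      show "\<exists>y\<in>carrier ?Q. y \<oplus>\<^bsub>?Q\<^esub> X = \<zero>\<^bsub>?Q\<^esub>" if "X \<in> carrier ?Q" for X
      proof -
        from that obtain y where "y \<in> carrier L" "X = ?c y" unfolding car by blast
        then show ?thesis
          by (intro bexI[of _ "?c (\<ominus>\<^bsub>L\<^esub> y)"]) (simp_all add: car quot_ops(1) z M.l_neg)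
      qed
      show "X \<oplus>\<^bsub>?Q\<^esub> Y = Y \<oplus>\<^bsub>?Q\<^esub> X" if "X \<in> carrier ?Q" "Y \<in> carrier ?Q" for X Y
      proof -
        from that obtain x y where "x \<in> carrier L" "X = ?c x" "y \<in> carrier L" "Y = ?c y"
          unfolding car by blast
        then show ?thesis using M.a_comm[of x y] by (simp add: quot_ops(1))
      qed
    qed (auto simp: car quot_ops(1) z M.a_assoc)
  qed (auto simp: car quot_ops(1) ops3 sm vs vs2)
  moreover have "lie_algebra_axioms class_ring ?Q"
    by unfold_locales
      (auto simp: car quot_ops(1,2) ops3 sm z br_closed br_add_left br_add_right bs br_self jacobi)
  ultimately show ?thesis by (rule lie_algebra.intro)
qed


subsection \<open>Upper triangular matrices\<close>

lemma UT_lie_simps [simp]: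
  "carrier (UT_lie ty n) = {A \<in> carrier_mat n n. upper_triangular A}"
  "A \<otimes>\<^bsub>UT_lie ty n\<^esub> B = A * B - B * A"
  "A \<oplus>\<^bsub>UT_lie ty n\<^esub> B = A + B"
  "\<zero>\<^bsub>UT_lie ty n\<^esub> = 0\<^sub>m n n"
  "a \<odot>\<^bsub>UT_lie ty n\<^esub> A = a \<cdot>\<^sub>m A"
  by (simp_all add: UT_lie_def module_mat_simps)

lemma upper_triangular_mult:
  assumes "A \<in> carrier_mat n n" "B \<in> carrier_mat n n"
    and "upper_triangular A" "upper_triangular (B :: 'f::field mat)"
  shows "upper_triangular (A * B)"
proof (rule upper_triangularI)
  fix i j assume ij: "j < i" "i < dim_row (A * B)"
  have "A $$ (i, k) * B $$ (k, j) = 0" if "k < n" for k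
  proof (cases "k < i")
    case True
    with assms ij show ?thesis by auto
  next
    case False
    with assms ij that have "B $$ (k, j) = 0" by (intro upper_triangularD) auto
    then show ?thesis by simp
  qed
  then show "(A * B) $$ (i, j) = 0"
    using assms ij by (auto simp: scalar_prod_def intro!: sum.neutral)
qed

lemma lie_algebra_UT_lie: "lie_algebra class_ring (UT_lie TYPE('f::field) n)"
proof -
  let ?U = "UT_lie TYPE('f) n"
  have "abelian_group ?U"
  proof (rule abelian_groupI)
    show "\<exists>y\<in>carrier ?U. y \<oplus>\<^bsub>?U\<^esub> x = \<zero>\<^bsub>?U\<^esub>" if "x \<in> carrier ?U" for x
      using that by (intro bexI[of _ "- x"]) (auto simp: upper_triangular_def)
  qed (auto simp: upper_triangular_def)
  then have "vectorspace class_ring ?U"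
    by (rule vectorspace_class_ringI)
      (auto simp: upper_triangular_def add_smult_distrib_right_mat add_smult_distrib_left_mat)
  moreover have "lie_algebra_axioms class_ring ?U"
  proof (unfold_locales, goal_cases)
    case (1 x y)
    then show ?case using upper_triangular_mult[of x n y] upper_triangular_mult[of y n x]
      by (auto simp: upper_triangular_def)
  next
    case (7 x y z)
    then have c: "x \<in> carrier_mat n n" "y \<in> carrier_mat n n" "z \<in> carrier_mat n n" by auto
    have "a * (b * c - c * b) - (b * c - c * b) * a
        = a * b * c - a * c * b - b * c * a + c * b * a"
      if "a \<in> carrier_mat n n" "b \<in> carrier_mat n n" "c \<in> carrier_mat n n" for a b c :: "'f mat"
    proof -
      note [simp] = that mult_carrier_mat[of _ n n _ n]
        that[THEN carrier_matD(1)] that[THEN carrier_matD(2)]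
      have "a * (b * c - c * b) = a * b * c - a * c * b"
        by (subst mult_minus_distrib_mat[of _ n n _ n]) (auto simp: assoc_mult_mat[of _ n n _ n _ n])
      moreover have "(b * c - c * b) * a = b * c * a - c * b * a"
        by (subst minus_mult_distrib_mat[of _ n n _ _ n]) auto
      ultimately show ?thesis by (intro eq_matI) auto
    qed
    note * = this[OF c(1,2,3)] this[OF c(2,3,1)] this[OF c(3,1,2)]
    note [simp] = c[THEN carrier_matD(1)] c[THEN carrier_matD(2)]
    show ?case by (simp only: UT_lie_simps *) (intro eq_matI; simp)
  qed (auto simp: add_mult_distrib_mat[of _ n n _ _ n] mult_add_distrib_mat[of _ n n _ n]
      mult_smult_assoc_mat[of _ n n _ n] mult_smult_distrib[of _ n n _ n] intro!: eq_matI
      simp: algebra_simps)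
  ultimately show ?thesis by (rule lie_algebra.intro)
qed

end

theory Submission
  imports Defs "HOL-Library.Function_Algebras"
begin

text \<open>
  Every element of degree \<open>g \<noteq> \<one>\<close> acts on the quotients of consecutive superdiagonal ideals with trace zero,
  which forces its diagonal to be symmetric under \<open>i \<mapsto> n - 1 - i\<close>; moreover, the product of the actions of
  two homogeneous elements is the action of a homogeneous element. Hence there is \<open>t\<close> with \<open>t\<^sup>2 = \<one>\<close> such that
  only degrees \<open>\<one>\<close> and \<open>t\<close> carry non-scalar diagonals, and conjugation by unipotent matrices makes the diagonal
  matrices themselves graded modulo the centre, so that the grading is given by \<open>t\<close> and by the degrees of
  the simple root vectors (for \<open>t \<noteq> \<one>\<close>, of combinations of a root vector and its mirror image).

  The identities that are bracket monomials determine this data: a multilinear bracket monomial in the labels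
  of the simple roots is nonzero iff each of its brackets joins adjacent intervals, and the set of binary
  trees that match a word in this sense determines the word up to reversal. Reversal is realised by
  the flip automorphism, the remaining freedom by torus automorphisms.
  All of these are automorphisms of \<open>UT\<^sub>n\<close> itself, so that they give a practical isomorphism.
\<close>

section \<open>Upper triangular matrices as functions\<close>

text \<open>An upper triangular \<open>n \<times> n\<close> matrix is represented by the function that gives its entries, which is
  zero outside the index range; thus sums of matrices are ordinary sums over a type.\<close>

type_synonym 'f tm = "nat \<Rightarrow> nat \<Rightarrow> 'f"

text \<open>Two obstacles shape the proof. The quotient hides the centre: a homogeneous element may
  be changed by any scalar matrix. So homogeneity is used only modulo \<open>ZZ n\<close>
  (\<open>hz\<close>), and only monomials with at least one bracket are compared; their values lie
  in \<open>NN n 1\<close>, which meets the centre in zero, so they vanish in the quotient iff they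
  vanish in the algebra. For \<open>t \<noteq> \<one>\<close> the simple root vectors need not be
  homogeneous. Merging the degrees g and t g (\<open>CC\<close>) makes all of them homogeneous
  again, and it is the word of these cosets that the trees determine. The lost factor t is harmless
  for a root and its mirror image, since their combinations occupy both degrees of the coset. A root
  in the middle has a single degree, which is recovered from a monomial that reaches the corner
  entry. Splitting a diagonal into a symmetric and an antisymmetric part needs 2 to be invertible,
  so characteristic 2 has to be ruled out beforehand for \<open>t \<noteq> \<one>\<close>. As
  \<open>G\<close> may be nonabelian, degrees of products are always taken in a fixed order.\<close>

definition NN :: "nat \<Rightarrow> nat \<Rightarrow> 'f::field tm set" where
  "NN n k = {x. \<forall>i j. x i j \<noteq> 0 \<longrightarrow> i + k \<le> j \<and> j < n}"

abbreviation UU :: "nat \<Rightarrow> 'f::field tm set" where "UU n \<equiv> NN n 0"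

text \<open>The convolution of the incidence algebra of the ordered set of natural numbers. On
  \<open>UU n\<close> it is the matrix product; as only finitely many indices lie between i and j,
  associativity holds for arbitrary functions.\<close>

definition mm :: "'f::field tm \<Rightarrow> 'f tm \<Rightarrow> 'f tm" where
  "mm x y = (\<lambda>i j. \<Sum>k\<in>{i..j}. x i k * y k j)"

definition br :: "'f::field tm \<Rightarrow> 'f tm \<Rightarrow> 'f tm" where
  "br x y = mm x y - mm y x"

definition sc :: "'f::field \<Rightarrow> 'f tm \<Rightarrow> 'f tm" where
  "sc a x = (\<lambda>i j. a * x i j)"

definition ee :: "nat \<Rightarrow> nat \<Rightarrow> 'f::field tm" where
  "ee i j = (\<lambda>a b. if a = i \<and> b = j then 1 else 0)"

definition diag :: "nat \<Rightarrow> (nat \<Rightarrow> 'f::field) \<Rightarrow> 'f tm" where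
  "diag n f = (\<lambda>i j. if i = j \<and> i < n then f i else 0)"

definition ZZ :: "nat \<Rightarrow> 'f::field tm set" where
  "ZZ n = {diag n (\<lambda>_. c) |c. True}"

lemma sum_fun_apply2: "(sum f S :: 'f::field tm) i j = (\<Sum>s\<in>S. f s i j)"
  by (induction S rule: infinite_finite_induct) auto

lemma sc_apply [simp]: "sc a x i j = a * x i j" by (simp add: sc_def)
lemma diag_apply [simp]: "diag n f i j = (if i = j \<and> i < n then f i else 0)" by (simp add: diag_def)

lemma tm_eqI: "(\<And>i j. x i j = y i j) \<Longrightarrow> x = (y :: 'f tm)" by (simp add: fun_eq_iff)

text \<open>Undo eta-expansions of sums of matrices, which some proof methods introduce.\<close>

lemma tm_eta [simp]:
  "(\<lambda>a b. 0) = (0 :: 'f::field tm)"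
  "(\<lambda>a b. x a b + y a b) = x + (y :: 'f tm)"
  "(\<lambda>a b. x a b - y a b) = x - (y :: 'f tm)"
  "(\<lambda>a b. - x a b) = - (x :: 'f tm)"
  by (simp_all add: fun_eq_iff)

lemma NN_iff: "x \<in> NN n k \<longleftrightarrow> (\<forall>i j. x i j \<noteq> 0 \<longrightarrow> i + k \<le> j \<and> j < n)" by (simp add: NN_def)
lemma NN_zero_entry: "x \<in> NN n k \<Longrightarrow> \<not> (i + k \<le> j \<and> j < n) \<Longrightarrow> x i j = 0" by (auto simp: NN_def)
lemma NN_0 [simp]: "0 \<in> NN n k" by (simp add: NN_def)
lemma NN_add [simp]: "x \<in> NN n k \<Longrightarrow> y \<in> NN n k \<Longrightarrow> x + y \<in> NN n k"
  unfolding NN_def by (auto simp del: not_less) (metis add.right_neutral)+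
lemma NN_sc [simp]: "x \<in> NN n k \<Longrightarrow> sc a x \<in> NN n k"
  unfolding NN_def by auto
lemma NN_uminus [simp]: "x \<in> NN n k \<Longrightarrow> - x \<in> NN n k"
  unfolding NN_def by auto
lemma NN_diff [simp]: "x \<in> NN n k \<Longrightarrow> y \<in> NN n k \<Longrightarrow> x - y \<in> NN n k"
  using NN_add[of x n k "- y"] by simp
lemma NN_sum: "(\<And>s. s \<in> S \<Longrightarrow> f s \<in> NN n k) \<Longrightarrow> sum f S \<in> NN n k"
  by (induction S rule: infinite_finite_induct) auto
lemma NN_mono: "l \<le> k \<Longrightarrow> x \<in> NN n k \<Longrightarrow> x \<in> NN n l"
  by (simp add: NN_def) (meson add_left_mono le_trans)
lemma NN_UU: "x \<in> NN n k \<Longrightarrow> x \<in> UU n" by (rule NN_mono[of 0]) auto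
lemma NN_top: "x \<in> NN n k \<Longrightarrow> n \<le> k \<Longrightarrow> x = 0"
  by (intro tm_eqI) (auto simp: NN_def, meson add_leE leD le_trans)
lemma ee_NN [simp]: "i + k \<le> j \<Longrightarrow> j < n \<Longrightarrow> ee i j \<in> NN n k" by (simp add: NN_def ee_def)
lemma diag_UU [simp]: "diag n f \<in> UU n" by (simp add: NN_def)

lemma NN_SucI: "x \<in> NN n k \<Longrightarrow> (\<And>i. i + k < n \<Longrightarrow> x i (i + k) = 0) \<Longrightarrow> x \<in> NN n (Suc k)"
  unfolding NN_def by (auto simp del: not_less) (metis Suc_leI le_neq_implies_less)
lemma NN_SucD: "x \<in> NN n (Suc k) \<Longrightarrow> x i (i + k) = 0"
  by (rule NN_zero_entry) auto

lemma NN_expand: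
  assumes "x \<in> NN n k"
  shows "x = (\<Sum>(i, j)\<in>{(i, j). i + k \<le> j \<and> j < n}. sc (x i j) (ee i j))"
proof (rule tm_eqI)
  fix a b
  have fin: "finite {(i, j). i + k \<le> j \<and> j < n}"
    by (rule finite_subset[of _ "{..<n} \<times> {..<n}"]) auto
  have "(\<Sum>(i, j)\<in>{(i, j). i + k \<le> j \<and> j < n}. sc (x i j) (ee i j)) a b
     = (\<Sum>p\<in>{(i, j). i + k \<le> j \<and> j < n}. if p = (a, b) then x a b else 0)"
    unfolding sum_fun_apply2 by (rule sum.cong) (auto simp: ee_def split: if_splits)
  also have "\<dots> = x a b" using assms fin by (auto simp: NN_def)
  finally show "x a b = (\<Sum>(i, j)\<in>{(i, j). i + k \<le> j \<and> j < n}. sc (x i j) (ee i j)) a b" by simp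
qed

lemma mm_add: "mm (x + y) z = mm x z + mm y z" "mm z (x + y) = mm z x + mm z y"
  by (auto simp: mm_def fun_eq_iff algebra_simps sum.distrib)
lemma mm_diff: "mm (x - y) z = mm x z - mm y z" "mm z (x - y) = mm z x - mm z y"
  by (auto simp: mm_def fun_eq_iff algebra_simps sum_subtractf)
lemma mm_sc: "mm (sc a x) z = sc a (mm x z)" "mm z (sc a x) = sc a (mm z x)"
  by (auto simp: mm_def fun_eq_iff sum_distrib_left mult_ac intro!: sum.cong)
lemma mm_0 [simp]: "mm 0 x = 0" "mm x 0 = 0"
  by (auto simp: mm_def fun_eq_iff)

lemma mm_assoc: "mm (mm x y) z = mm x (mm y z)"
proof (intro tm_eqI)
  fix i j
  have "mm (mm x y) z i j = (\<Sum>k\<in>{i..j}. \<Sum>l\<in>{i..j}. if l \<le> k then x i l * y l k * z k j else 0)"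
    unfolding mm_def
  proof (intro sum.cong HOL.refl)
    fix k assume "k \<in> {i..j}"
    then have "{l \<in> {i..j}. l \<le> k} = {i..k}" by auto
    then show "(\<Sum>k'\<in>{i..k}. x i k' * y k' k) * z k j = (\<Sum>l\<in>{i..j}. if l \<le> k then x i l * y l k * z k j else 0)"
      by (simp add: sum_distrib_right sum.inter_filter[symmetric])
  qed
  also have "\<dots> = (\<Sum>l\<in>{i..j}. \<Sum>k\<in>{i..j}. if l \<le> k then x i l * y l k * z k j else 0)"
    by (rule sum.swap)
  also have "\<dots> = mm x (mm y z) i j"
    unfolding mm_def
  proof (intro sum.cong HOL.refl)
    fix l assume "l \<in> {i..j}"
    then have "{k \<in> {i..j}. l \<le> k} = {l..j}" by auto
    then show "(\<Sum>k\<in>{i..j}. if l \<le> k then x i l * y l k * z k j else 0) = x i l * (\<Sum>k\<in>{l..j}. y l k * z k j)"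
      by (simp add: sum_distrib_left sum.inter_filter[symmetric] mult.assoc)
  qed
  finally show "mm (mm x y) z i j = mm x (mm y z) i j" .
qed

lemma mm_NN:
  assumes "x \<in> NN n k" "y \<in> NN n l" shows "mm x y \<in> NN n (k + l)"
  unfolding NN_iff
proof (intro allI impI)
  fix i j assume "mm x y i j \<noteq> 0"
  then obtain m where "x i m * y m j \<noteq> 0" unfolding mm_def by (meson sum.neutral)
  then have "x i m \<noteq> 0" "y m j \<noteq> 0" by auto
  then have "i + k \<le> m" "m + l \<le> j" "j < n" using assms by (auto simp: NN_iff)
  then show "i + (k + l) \<le> j \<and> j < n" by auto
qed

lemma mm_entry:
  assumes "x \<in> NN n k" "y \<in> NN n l"
  shows "mm x y i (i + k + l) = x i (i + k) * y (i + k) (i + k + l)"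
proof -
  have "mm x y i (i + k + l) = (\<Sum>m\<in>{i + k}. x i m * y m (i + k + l))"
    unfolding mm_def
  proof (rule sum.mono_neutral_right)
    show "\<forall>m\<in>{i..i + k + l} - {i + k}. x i m * y m (i + k + l) = 0"
    proof
      fix m assume m: "m \<in> {i..i + k + l} - {i + k}"
      then have "\<not> i + k \<le> m \<or> \<not> m + l \<le> i + k + l" by auto
      then have "x i m = 0 \<or> y m (i + k + l) = 0" using NN_zero_entry[OF assms(1), of i m] NN_zero_entry[OF assms(2), of m "i + k + l"] by blast
      then show "x i m * y m (i + k + l) = 0" by auto
    qed
  qed auto
  then show ?thesis by simp
qed

lemma br_add: "br (x + y) z = br x z + br y z" "br z (x + y) = br z x + br z y"
  by (simp_all add: br_def mm_add)
lemma br_diff: "br (x - y) z = br x z - br y z" "br z (x - y) = br z x - br z y"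
  by (simp_all add: br_def mm_diff)
lemma sc_add: "sc a (x + y) = sc a x + sc a y" by (simp add: fun_eq_iff algebra_simps)
lemma sc_diff: "sc a (x - y) = sc a x - sc a y" by (simp add: fun_eq_iff algebra_simps)
lemma sc_sc [simp]: "sc a (sc b x) = sc (a * b) x" by (simp add: fun_eq_iff)
lemma sc_1 [simp]: "sc 1 x = x" by (simp add: fun_eq_iff)
lemma sc_0 [simp]: "sc 0 x = 0" "sc a 0 = 0" by (simp_all add: fun_eq_iff)
lemma sc_uminus: "sc (- 1) x = - x" by (simp add: fun_eq_iff)
lemma br_sc: "br (sc a x) z = sc a (br x z)" "br z (sc a x) = sc a (br z x)"
  by (simp_all add: br_def mm_sc sc_diff)
lemma br_0 [simp]: "br 0 x = 0" "br x 0 = 0" by (simp_all add: br_def)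
lemma br_uminus: "br (- x) z = - br x z" "br z (- x) = - br z x"
  using br_sc[where a = "- 1" and x = x and z = z] by (simp_all add: sc_uminus)
lemma br_sum: "br (sum f S) z = (\<Sum>s\<in>S. br (f s) z)" "br z (sum f S) = (\<Sum>s\<in>S. br z (f s))"
  by (induction S rule: infinite_finite_induct) (auto simp: br_add)
lemma sc_sum: "sc a (sum f S) = (\<Sum>s\<in>S. sc a (f s))"
  by (intro tm_eqI) (simp add: sum_fun_apply2 sum_distrib_left)
lemma br_commute: "br y x = - br x y" by (simp add: br_def)

lemma br_NN: "x \<in> NN n k \<Longrightarrow> y \<in> NN n l \<Longrightarrow> br x y \<in> NN n (k + l)"
  unfolding br_def using mm_NN[of x n k y l] mm_NN[of y n l x k] by (simp add: add.commute)

lemma br_entry: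
  assumes "x \<in> NN n k" "y \<in> NN n l"
  shows "br x y i (i + k + l) = x i (i + k) * y (i + k) (i + k + l) - y i (i + l) * x (i + l) (i + k + l)"
  using mm_entry[OF assms, of i] mm_entry[OF assms(2,1), of i] by (simp add: br_def add_ac)

lemma br_UU_NN [simp]: "x \<in> UU n \<Longrightarrow> y \<in> NN n l \<Longrightarrow> br x y \<in> NN n l"
  using br_NN[of x n 0 y l] by simp

lemma br_entry_UU:
  assumes "x \<in> UU n" "y \<in> NN n k"
  shows "br x y i (i + k) = (x i i - x (i + k) (i + k)) * y i (i + k)"
  using br_entry[OF assms, of i] by (simp add: algebra_simps)

lemma br_UU_UU: "x \<in> UU n \<Longrightarrow> y \<in> UU n \<Longrightarrow> br x y \<in> NN n 1"
  using NN_SucI[of "br x y" n 0] br_entry_UU[of x n y 0] by simp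

lemma diag_mm:
  assumes "x \<in> UU n"
  shows "mm (diag n f) x = (\<lambda>i j. f i * x i j)" "mm x (diag n f) = (\<lambda>i j. x i j * f j)"
proof -
  show "mm (diag n f) x = (\<lambda>i j. f i * x i j)"
  proof (intro tm_eqI)
    fix i j
    have "mm (diag n f) x i j = (\<Sum>k\<in>{i..j}. if k = i then f i * x i j else 0)"
      unfolding mm_def by (rule sum.cong) (use NN_zero_entry[OF assms, of i j] in auto)
    then show "mm (diag n f) x i j = f i * x i j" using NN_zero_entry[OF assms, of i j] by (auto simp: not_le)
  qed
  show "mm x (diag n f) = (\<lambda>i j. x i j * f j)"
  proof (intro tm_eqI)
    fix i j
    have "mm x (diag n f) i j = (\<Sum>k\<in>{i..j}. if k = j then x i j * f j else 0)"
      unfolding mm_def by (rule sum.cong) (use assms in \<open>auto simp: NN_iff\<close>)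
    then show "mm x (diag n f) i j = x i j * f j" using assms by (auto simp: NN_iff)
  qed
qed

lemma diag_br: "x \<in> UU n \<Longrightarrow> br (diag n f) x = (\<lambda>i j. (f i - f j) * x i j)"
  unfolding br_def diag_mm by (intro tm_eqI) (simp add: algebra_simps del: tm_eta)

lemma ZZ_iff: "x \<in> ZZ n \<longleftrightarrow> (\<exists>c. x = diag n (\<lambda>_. c))" by (auto simp: ZZ_def)
lemma ZZ_UU: "z \<in> ZZ n \<Longrightarrow> z \<in> UU n" by (auto simp: ZZ_iff)
lemma ZZ_br [simp]:
  assumes "z \<in> ZZ n" "x \<in> UU n" shows "br z x = 0" "br x z = 0"
proof -
  obtain c where "z = diag n (\<lambda>_. c)" using assms(1) by (auto simp: ZZ_iff)
  then show "br z x = 0" using diag_br[OF assms(2)] by simp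
  then show "br x z = 0" using br_commute[of x z] by simp
qed
lemma ZZ_add: "z \<in> ZZ n \<Longrightarrow> w \<in> ZZ n \<Longrightarrow> z + w \<in> ZZ n"
proof -
  assume "z \<in> ZZ n" "w \<in> ZZ n"
  then obtain a b where "z = diag n (\<lambda>_. a)" "w = diag n (\<lambda>_. b)" by (auto simp: ZZ_iff)
  then have "z + w = diag n (\<lambda>_. a + b)" by (auto simp: fun_eq_iff)
  then show ?thesis by (auto simp: ZZ_iff)
qed
lemma ZZ_sc: "z \<in> ZZ n \<Longrightarrow> sc a z \<in> ZZ n"
proof -
  assume "z \<in> ZZ n"
  then obtain b where "z = diag n (\<lambda>_. b)" by (auto simp: ZZ_iff)
  then have "sc a z = diag n (\<lambda>_. a * b)" by (auto simp: fun_eq_iff)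
  then show ?thesis by (auto simp: ZZ_iff)
qed
lemma ZZ_0 [simp]: "0 \<in> ZZ n" by (auto simp: ZZ_iff fun_eq_iff intro!: exI[of _ 0])
lemma ZZ_uminus: "z \<in> ZZ n \<Longrightarrow> - z \<in> ZZ n" using ZZ_sc[of z n "- 1"] by (simp add: sc_uminus)
lemma ZZ_diff: "z \<in> ZZ n \<Longrightarrow> w \<in> ZZ n \<Longrightarrow> z - w \<in> ZZ n" using ZZ_add[of z n "- w"] by (simp add: ZZ_uminus)

lemma ee_nonzero [simp]: "ee i j \<noteq> (0 :: 'f::field tm)"
proof
  assume "ee i j = (0 :: 'f tm)"
  then have "ee i j i j = (0 :: 'f tm) i j" by (rule arg_cong)
  then show False by (simp add: ee_def)
qed

lemma ee_mm: "mm (ee i j) (ee k l) = (if j = k \<and> i \<le> j \<and> j \<le> l then ee i l else 0)"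
proof (intro tm_eqI)
  fix a b
  have "mm (ee i j) (ee k l) a b = (\<Sum>m\<in>{a..b}. if m = j then (if a = i \<and> j = k \<and> b = l then 1 else 0) else 0)"
    unfolding mm_def by (rule sum.cong) (auto simp: ee_def)
  then show "mm (ee i j) (ee k l) a b = (if j = k \<and> i \<le> j \<and> j \<le> l then ee i l else 0) a b"
    by (auto simp: ee_def)
qed

lemma ee_br:
  "i \<le> j \<Longrightarrow> k \<le> l \<Longrightarrow> br (ee i j) (ee k l) = (if j = k then ee i l else 0) - (if l = i then ee k j else 0)"
  by (auto simp: br_def ee_mm)

section \<open>Gradings\<close>

text \<open>The direct sum is split into spanning (\<open>A_ex\<close>) and independence
  (\<open>A_indep\<close>) of finite families; both transfer easily along automorphisms.\<close>

locale tri_grading = group G for G :: "('g, 'm) monoid_scheme" (structure) +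
  fixes n :: nat and A :: "'g \<Rightarrow> 'f::field tm set"
  assumes A_UU: "g \<in> carrier G \<Longrightarrow> x \<in> A g \<Longrightarrow> x \<in> UU n"
    and A_0 [simp]: "g \<in> carrier G \<Longrightarrow> 0 \<in> A g"
    and A_add: "g \<in> carrier G \<Longrightarrow> x \<in> A g \<Longrightarrow> y \<in> A g \<Longrightarrow> x + y \<in> A g"
    and A_sc: "g \<in> carrier G \<Longrightarrow> x \<in> A g \<Longrightarrow> sc a x \<in> A g"
    and A_br: "g \<in> carrier G \<Longrightarrow> h \<in> carrier G \<Longrightarrow> x \<in> A g \<Longrightarrow> y \<in> A h \<Longrightarrow> br x y \<in> A (g \<otimes> h)"
    and A_ex: "x \<in> UU n \<Longrightarrow> \<exists>S c. finite S \<and> S \<subseteq> carrier G \<and> (\<forall>g\<in>S. c g \<in> A g) \<and> x = (\<Sum>g\<in>S. c g)"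
    and A_indep: "finite S \<Longrightarrow> S \<subseteq> carrier G \<Longrightarrow> (\<And>g. g \<in> S \<Longrightarrow> c g \<in> A g) \<Longrightarrow> (\<Sum>g\<in>S. c g) = 0
      \<Longrightarrow> g \<in> S \<Longrightarrow> c g = 0"
begin

lemma A_uminus: "g \<in> carrier G \<Longrightarrow> x \<in> A g \<Longrightarrow> - x \<in> A g"
  using A_sc[of g x "- 1"] by (simp add: sc_uminus)
lemma A_diff: "g \<in> carrier G \<Longrightarrow> x \<in> A g \<Longrightarrow> y \<in> A g \<Longrightarrow> x - y \<in> A g"
  using A_add[of g x "- y"] by (simp add: A_uminus)

text \<open>The value 0 outside \<open>carrier G\<close> makes the family of components unique as a
  function on the whole type.\<close>

definition decomp :: "'f tm \<Rightarrow> ('g \<Rightarrow> 'f tm) \<Rightarrow> bool" where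
  "decomp x c \<longleftrightarrow> (\<forall>g\<in>carrier G. c g \<in> A g) \<and> (\<forall>g. g \<notin> carrier G \<longrightarrow> c g = 0) \<and>
     finite {g. c g \<noteq> 0} \<and> x = (\<Sum>g\<in>{g. c g \<noteq> 0}. c g)"

lemma decomp_sum:
  assumes "decomp x c" "finite S" "{g. c g \<noteq> 0} \<subseteq> S"
  shows "x = (\<Sum>g\<in>S. c g)"
proof -
  have "(\<Sum>g\<in>{g. c g \<noteq> 0}. c g) = (\<Sum>g\<in>S. c g)"
    using assms by (intro sum.mono_neutral_left) auto
  then show ?thesis using assms(1) by (simp add: decomp_def)
qed

lemma decompI:
  assumes "\<And>g. g \<in> carrier G \<Longrightarrow> c g \<in> A g" "\<And>g. g \<notin> carrier G \<Longrightarrow> c g = 0"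
    "finite S" "{g. c g \<noteq> 0} \<subseteq> S" "x = (\<Sum>g\<in>S. c g)"
  shows "decomp x c"
proof -
  have "(\<Sum>g\<in>{g. c g \<noteq> 0}. c g) = (\<Sum>g\<in>S. c g)"
    using assms by (intro sum.mono_neutral_left) auto
  then show ?thesis using assms finite_subset[OF assms(4,3)] by (simp add: decomp_def)
qed

lemma decomp_ex: assumes "x \<in> UU n" shows "\<exists>c. decomp x c"
proof -
  from A_ex[OF assms] obtain S c where S: "finite S" "S \<subseteq> carrier G" "\<forall>g\<in>S. c g \<in> A g" "x = (\<Sum>g\<in>S. c g)"
    by blast
  have "decomp x (\<lambda>g. if g \<in> S then c g else 0)"
    by (rule decompI[where S = S]) (use S in auto)
  then show ?thesis by blast
qed

lemma decomp_add: 
  assumes "decomp x c" "decomp y d" shows "decomp (x + y) (\<lambda>g. c g + d g)"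
proof (rule decompI[where S = "{g. c g \<noteq> 0} \<union> {g. d g \<noteq> 0}"])
  have "x = (\<Sum>g\<in>{g. c g \<noteq> 0} \<union> {g. d g \<noteq> 0}. c g)" "y = (\<Sum>g\<in>{g. c g \<noteq> 0} \<union> {g. d g \<noteq> 0}. d g)"
    using assms by (auto intro!: decomp_sum simp: decomp_def)
  then show "x + y = (\<Sum>g\<in>{g. c g \<noteq> 0} \<union> {g. d g \<noteq> 0}. c g + d g)"
    by (simp add: sum.distrib)
qed (use assms in \<open>auto simp: decomp_def A_add\<close>)

lemma decomp_sc: 
  assumes "decomp x c" shows "decomp (sc a x) (\<lambda>g. sc a (c g))"
proof (rule decompI[where S = "{g. c g \<noteq> 0}"])
  show "sc a x = (\<Sum>g\<in>{g. c g \<noteq> 0}. sc a (c g))"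
    using assms by (simp add: decomp_def sc_sum)
qed (use assms in \<open>auto simp: decomp_def A_sc\<close>)

lemma decomp_uniq:
  assumes "decomp x c" "decomp x d" shows "c = d"
proof
  fix g
  have e: "decomp (x + sc (- 1) x) (\<lambda>g. c g + sc (- 1) (d g))"
    using assms decomp_add decomp_sc by blast
  show "c g = d g"
  proof (cases "c g + sc (- 1) (d g) = 0")
    case False
    have "c g + sc (- 1) (d g) = 0"
      by (rule A_indep[where c = "\<lambda>g. c g + sc (- 1) (d g)" and S = "{g. c g + sc (- 1) (d g) \<noteq> 0}"])
        (use e False in \<open>auto simp: decomp_def sc_uminus\<close>)
    with False show ?thesis by simp
  qed (simp add: sc_uminus)
qed

definition pr :: "'g \<Rightarrow> 'f tm \<Rightarrow> 'f tm" where
  "pr g x = (THE c. decomp x c) g"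

lemma decomp_pr: "x \<in> UU n \<Longrightarrow> decomp x (\<lambda>g. pr g x)"
  unfolding pr_def using decomp_ex decomp_uniq by (metis the_equality)

lemma pr_eqI: "decomp x c \<Longrightarrow> pr g x = c g"
  unfolding pr_def using decomp_uniq by (metis the_equality)

lemma pr_A: "x \<in> UU n \<Longrightarrow> g \<in> carrier G \<Longrightarrow> pr g x \<in> A g"
  using decomp_pr by (auto simp: decomp_def)
lemma pr_UU: "x \<in> UU n \<Longrightarrow> pr g x \<in> UU n"
  using decomp_pr[of x] A_UU by (cases "g \<in> carrier G") (auto simp: decomp_def)
lemma pr_out: "x \<in> UU n \<Longrightarrow> g \<notin> carrier G \<Longrightarrow> pr g x = 0"
  using decomp_pr by (auto simp: decomp_def)

lemma pr_add: "x \<in> UU n \<Longrightarrow> y \<in> UU n \<Longrightarrow> pr g (x + y) = pr g x + pr g y"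
  by (rule pr_eqI) (intro decomp_add decomp_pr)
lemma pr_sc: "x \<in> UU n \<Longrightarrow> pr g (sc a x) = sc a (pr g x)"
  by (rule pr_eqI) (intro decomp_sc decomp_pr)
lemma pr_0 [simp]: "pr g 0 = 0"
  using pr_sc[of 0 g 0] by simp
lemma pr_uminus: "x \<in> UU n \<Longrightarrow> pr g (- x) = - pr g x"
  using pr_sc[of x g "- 1"] by (simp add: sc_uminus)
lemma pr_diff: "x \<in> UU n \<Longrightarrow> y \<in> UU n \<Longrightarrow> pr g (x - y) = pr g x - pr g y"
  using pr_add[of x "- y"] by (simp add: pr_uminus)
lemma pr_sum: "(\<And>s. s \<in> S \<Longrightarrow> f s \<in> UU n) \<Longrightarrow> pr g (sum f S) = (\<Sum>s\<in>S. pr g (f s))"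
  by (induction S rule: infinite_finite_induct) (auto simp: pr_add NN_sum)

lemma pr_hom: 
  assumes "x \<in> A g" "g \<in> carrier G" shows "pr h x = (if h = g then x else 0)"
proof -
  have "decomp x (\<lambda>h. if h = g then x else 0)"
    by (rule decompI[where S = "{g}"]) (use assms in \<open>auto split: if_splits\<close>)
  then show ?thesis by (rule pr_eqI)
qed

text \<open>Finitely many matrix units span the algebra, so this finite set contains every degree
  that occurs, and all decompositions become sums over one index set.\<close>

definition supp :: "'g set" where
  "supp = (\<Union>i\<in>{..<n}. \<Union>j\<in>{..<n}. {g. i \<le> j \<and> pr g (ee i j) \<noteq> 0})"

lemma finite_supp: "finite supp"
  unfolding supp_def
proof (intro finite_UN_I)
  fix i j assume ij: "i \<in> {..<n}" "j \<in> {..<n}"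
  show "finite {g. i \<le> j \<and> pr g (ee i j) \<noteq> 0}"
  proof (cases "i \<le> j")
    case True
    with ij decomp_pr[of "ee i j"] show ?thesis by (auto simp: decomp_def)
  qed simp
qed auto

lemma supp_carrier: "supp \<subseteq> carrier G"
  unfolding supp_def by (auto intro: ccontr simp: pr_out)

lemma pr_not_supp:
  assumes "x \<in> UU n" "g \<notin> supp" shows "pr g x = 0"
proof -
  have 0: "pr g (ee i j) = 0" if "i \<le> j" "j < n" for i j
    using that assms(2) unfolding supp_def by force
  have "pr g x = (\<Sum>p\<in>{(i, j). i + 0 \<le> j \<and> j < n}. pr g (case p of (i, j) \<Rightarrow> sc (x i j) (ee i j)))"
    by (subst NN_expand[OF assms(1)], rule pr_sum) auto
  also have "\<dots> = 0" by (rule sum.neutral) (auto simp: pr_sc 0)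
  finally show ?thesis .
qed

lemma sum_pr: "x \<in> UU n \<Longrightarrow> x = (\<Sum>g\<in>supp. pr g x)"
  by (rule decomp_sum[OF decomp_pr finite_supp]) (auto intro: ccontr simp: pr_not_supp)

lemma pr_br:
  assumes "x \<in> UU n" "y \<in> UU n"
  shows "pr g (br x y) = (\<Sum>h\<in>supp. \<Sum>k\<in>supp. if h \<otimes> k = g then br (pr h x) (pr k y) else 0)"
proof -
  have "br x y = br (\<Sum>h\<in>supp. pr h x) (\<Sum>k\<in>supp. pr k y)"
    using sum_pr[OF assms(1)] sum_pr[OF assms(2)] by simp
  also have "\<dots> = (\<Sum>h\<in>supp. \<Sum>k\<in>supp. br (pr h x) (pr k y))" 
    unfolding br_sum(1) unfolding br_sum(2) ..
  finally have "pr g (br x y) = (\<Sum>h\<in>supp. \<Sum>k\<in>supp. pr g (br (pr h x) (pr k y)))"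
    using assms by (simp add: pr_sum NN_sum pr_UU)
  also have "\<dots> = (\<Sum>h\<in>supp. \<Sum>k\<in>supp. if h \<otimes> k = g then br (pr h x) (pr k y) else 0)"
  proof (intro sum.cong HOL.refl)
    fix h k assume hk: "h \<in> supp" "k \<in> supp"
    then have "h \<in> carrier G" "k \<in> carrier G" using supp_carrier by auto
    then have "br (pr h x) (pr k y) \<in> A (h \<otimes> k)" "h \<otimes> k \<in> carrier G" using assms by (auto intro!: A_br pr_A)
    from pr_hom[OF this]
    show "pr g (br (pr h x) (pr k y)) = (if h \<otimes> k = g then br (pr h x) (pr k y) else 0)" by auto
  qed
  finally show ?thesis .
qed

lemma pr_br_NN:
  assumes "x \<in> UU n" "y \<in> UU n"
    and "\<And>h k. br (pr h x) (pr k y) \<in> NN n l"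
  shows "pr g (br x y) \<in> NN n l"
  unfolding pr_br[OF assms(1,2)] using assms(3) by (auto intro!: NN_sum)

text \<open>Left translation by h is injective, so no other component of y reaches degree h k.
  Without commutativity the mirrored version is a separate lemma.\<close>

lemma pr_br_hom_left:
  assumes "x \<in> A h" "h \<in> carrier G" "y \<in> UU n" "k \<in> carrier G"
  shows "pr (h \<otimes> k) (br x y) = br x (pr k y)"
proof -
  have "pr (h \<otimes> k) (br x y) = (\<Sum>l\<in>supp. pr (h \<otimes> k) (br x (pr l y)))"
    using assms A_UU by (subst sum_pr[of y]) (auto simp: br_sum pr_sum pr_UU)
  also have "\<dots> = (\<Sum>l\<in>supp. if l = k then br x (pr k y) else 0)"
  proof (rule sum.cong)
    fix l assume "l \<in> supp"
    then have l: "l \<in> carrier G" using supp_carrier by auto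
    then have "br x (pr l y) \<in> A (h \<otimes> l)" using assms by (auto intro!: A_br pr_A)
    from pr_hom[OF this] show "pr (h \<otimes> k) (br x (pr l y)) = (if l = k then br x (pr k y) else 0)"
      using l assms by auto
  qed simp
  also have "\<dots> = br x (pr k y)" using pr_not_supp[OF assms(3), of k] by (auto simp: finite_supp)
  finally show ?thesis .
qed

lemma pr_br_hom_right:
  assumes "x \<in> A h" "h \<in> carrier G" "y \<in> UU n" "k \<in> carrier G"
  shows "pr (k \<otimes> h) (br y x) = br (pr k y) x"
proof -
  have "pr (k \<otimes> h) (br y x) = (\<Sum>l\<in>supp. pr (k \<otimes> h) (br (pr l y) x))"
    using assms A_UU by (subst sum_pr[of y]) (auto simp: br_sum pr_sum pr_UU)
  also have "\<dots> = (\<Sum>l\<in>supp. if l = k then br (pr k y) x else 0)"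
  proof (rule sum.cong)
    fix l assume "l \<in> supp"
    then have l: "l \<in> carrier G" using supp_carrier by auto
    then have "br (pr l y) x \<in> A (l \<otimes> h)" using assms by (auto intro!: A_br pr_A)
    from pr_hom[OF this] show "pr (k \<otimes> h) (br (pr l y) x) = (if l = k then br (pr k y) x else 0)"
      using l assms by auto
  qed simp
  also have "\<dots> = br (pr k y) x" using pr_not_supp[OF assms(3), of k] by (auto simp: finite_supp)
  finally show ?thesis .
qed

lemma pr_NN_basis:
  assumes "\<And>i j g. i + k \<le> j \<Longrightarrow> j < n \<Longrightarrow> pr g (ee i j) \<in> NN n k"
  and "x \<in> NN n k" shows "pr g x \<in> NN n k"
proof -
  have "pr g x = (\<Sum>p\<in>{(i, j). i + k \<le> j \<and> j < n}. pr g (case p of (i, j) \<Rightarrow> sc (x i j) (ee i j)))"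
    by (subst NN_expand[OF assms(2)], rule pr_sum) auto
  also have "\<dots> \<in> NN n k" by (rule NN_sum) (auto simp: pr_sc assms(1))
  finally show ?thesis .
qed

text \<open>\<open>NN n 1\<close> is spanned by brackets, and for positive k the next ideal is
  spanned by brackets of \<open>NN n 1\<close> with \<open>NN n k\<close>. Components of a bracket
  are sums of brackets of components, so the filtration is graded by induction.\<close>

lemma pr_NN: "x \<in> NN n k \<Longrightarrow> pr g x \<in> NN n k"
proof (induction k arbitrary: x g)
  case 0
  then show ?case by (rule pr_UU)
next
  case (Suc k)
  show ?case
  proof (rule pr_NN_basis[OF _ Suc.prems])
    fix i j g assume ij: "i + Suc k \<le> j" "j < n"
    show "pr g (ee i j) \<in> NN n (Suc k)"
    proof (cases "k = 0")
      case True
      have "br (ee i i) (ee i j) = (ee i j :: 'f tm)" using ij by (simp add: ee_br)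
      moreover have "pr g (br (ee i i) (ee i j)) \<in> NN n (Suc k)"
        using ij True by (intro pr_br_NN) (auto simp flip: One_nat_def intro!: br_UU_UU pr_UU)
      ultimately show ?thesis by simp
    next
      case False
      have "pr h (ee a b) \<in> NN n 1" if "a + 1 \<le> b" "b < n" for a b h
      proof -
        have "br (ee a a) (ee a b) = (ee a b :: 'f tm)" using that by (simp add: ee_br)
        moreover have "pr h (br (ee a a) (ee a b)) \<in> NN n 1"
          using that by (intro pr_br_NN) (auto simp flip: One_nat_def intro!: br_UU_UU pr_UU)
        ultimately show ?thesis by simp
      qed
      then have "pr h (ee i (i + 1)) \<in> NN n 1" for h using ij by simp
      moreover have "pr h (ee (i + 1) j) \<in> NN n k" for h using ij by (intro Suc.IH) auto
      ultimately have "br (pr h (ee i (i + 1))) (pr h' (ee (i + 1) j)) \<in> NN n (Suc k)" for h h'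
        using br_NN by fastforce
      then have "pr g (br (ee i (i + 1)) (ee (i + 1) j)) \<in> NN n (Suc k)"
        using ij by (intro pr_br_NN) auto
      moreover have "br (ee i (i + 1)) (ee (i + 1) j) = (ee i j :: 'f tm)" using ij by (simp add: ee_br)
      ultimately show ?thesis by simp
    qed
  qed
qed

subsection \<open>The diagonal parts of homogeneous elements\<close>

definition dd :: "nat \<Rightarrow> 'f tm \<Rightarrow> nat \<Rightarrow> 'f" where "dd k x i = x i i - x (i + k) (i + k)"

text \<open>On \<open>N\<^sub>k / N\<^sub>k\<^sub>+\<^sub>1\<close> the element \<open>x\<close> acts as the diagonal matrix with entries \<open>dd k x\<close>, and this operator
  shifts degrees by \<open>g \<noteq> \<one>\<close>; so its trace vanishes.\<close>

lemma trace_zero: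
  assumes x: "x \<in> A g" and g: "g \<in> carrier G" "g \<noteq> \<one>"
  shows "(\<Sum>i<n - k. dd k x i) = 0"
proof -
  \<comment> \<open>The matrix of the projection to degree h on N_k / N_(k+1), in the basis of the
    classes of \<open>ee j (j + k)\<close>. \<open>PP\<close> says that these matrices are
    orthogonal idempotents, \<open>XP\<close> that the action of x carries degree h to degree g
    h.\<close>
  define P where "P h i j = pr h (ee j (j + k)) i (i + k)" for h i j
  have xU: "x \<in> UU n" using A_UU x g by blast
  have e: "(ee j (j + k) :: 'f tm) \<in> NN n k" if "j < n - k" for j using that by auto
  have act: "pr h w i (i + k) = (\<Sum>j<n - k. P h i j * w j (j + k))" if w: "w \<in> NN n k" for h i w
  proof -
    have "w - (\<Sum>j<n - k. sc (w j (j + k)) (ee j (j + k))) \<in> NN n (Suc k)"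
    proof (rule NN_SucI)
      show "w - (\<Sum>j<n - k. sc (w j (j + k)) (ee j (j + k))) \<in> NN n k"
        using w by (auto intro!: NN_diff NN_sum)
      fix i assume "i + k < n"
      have "(\<Sum>j<n - k. sc (w j (j + k)) (ee j (j + k)) i (i + k)) = (\<Sum>j<n - k. if j = i then w i (i + k) else 0)"
        by (rule sum.cong) (auto simp: ee_def)
      then show "(w - (\<Sum>j<n - k. sc (w j (j + k)) (ee j (j + k)))) i (i + k) = 0"
        using \<open>i + k < n\<close> by (simp add: sum_fun_apply2 less_diff_conv)
    qed
    from NN_SucD[OF pr_NN[OF this]] have "pr h w i (i + k) = pr h (\<Sum>j<n - k. sc (w j (j + k)) (ee j (j + k))) i (i + k)"
      using w by (subst (asm) pr_diff) (auto intro!: NN_sum intro: NN_UU)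
    also have "\<dots> = (\<Sum>j<n - k. P h i j * w j (j + k))"
      by (subst pr_sum) (auto simp: pr_sc sum_fun_apply2 P_def mult.commute intro!: sum.cong)
    finally show ?thesis .
  qed
  have PP: "(\<Sum>j<n - k. P h i j * P h' j l) = (if h = h' then P h i l else 0)"
    if "l < n - k" "h \<in> carrier G" "h' \<in> carrier G" for h h' i l
  proof -
    have "(\<Sum>j<n - k. P h i j * P h' j l) = pr h (pr h' (ee l (l + k))) i (i + k)"
      unfolding act[OF pr_NN[OF e[OF that(1)]]] by (simp add: P_def)
    moreover have "pr h' (ee l (l + k)) \<in> A h'" using that by (auto intro!: pr_A)
    ultimately show ?thesis using pr_hom[of _ h' h] that by (simp add: P_def)
  qed
  have XP: "dd k x i * P h i j = P (g \<otimes> h) i j * dd k x j" if "j < n - k" "h \<in> carrier G" for h i j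
  proof -
    have "pr (g \<otimes> h) (br x (ee j (j + k))) i (i + k) = br x (pr h (ee j (j + k))) i (i + k)"
      using pr_br_hom_left[OF x g(1) _ that(2), of "ee j (j + k)"] that by simp
    also have "\<dots> = dd k x i * P h i j"
      using br_entry_UU[OF xU pr_NN[OF e[OF that(1)]]] by (simp add: dd_def P_def)
    finally have 1: "dd k x i * P h i j = pr (g \<otimes> h) (br x (ee j (j + k))) i (i + k)" by simp
    have "br x (ee j (j + k)) l (l + k) = (if l = j then dd k x j else 0)" for l
      using br_entry_UU[OF xU e[OF that(1)], of l] by (auto simp: ee_def dd_def)
    then have "(\<Sum>l<n - k. P (g \<otimes> h) i l * br x (ee j (j + k)) l (l + k)) = P (g \<otimes> h) i j * dd k x j"
      using that by (simp add: if_distrib[of "(*) _"] cong: if_cong)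
    then show ?thesis unfolding 1 using xU e[OF that(1)] by (subst act) auto
  qed
  have sumP: "(\<Sum>h\<in>supp. P h i i) = 1" if "i < n - k" for i
  proof -
    have "(\<Sum>h\<in>supp. pr h (ee i (i + k))) i (i + k) = (ee i (i + k) :: 'f tm) i (i + k)"
      using sum_pr[of "ee i (i + k)"] that by simp
    then show ?thesis by (simp add: P_def sum_fun_apply2 ee_def)
  qed
  \<comment> \<open>With D the diagonal matrix of the action, D is the sum of the D P_h. The trace
    of D P_h = D P_h P_h equals that of P_h D P_h = P_h P_(g h) D, which is zero because h and g h
    differ.\<close>
  have "(\<Sum>i<n - k. dd k x i) = (\<Sum>i<n - k. \<Sum>h\<in>supp. dd k x i * P h i i)"
    by (intro sum.cong HOL.refl) (simp add: sum_distrib_left[symmetric] sumP)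
  also have "\<dots> = (\<Sum>i<n - k. \<Sum>h\<in>supp. \<Sum>j<n - k. dd k x i * P h i j * P h j i)"
  proof (intro sum.cong HOL.refl)
    fix i h assume "i \<in> {..<n - k}" "h \<in> supp"
    then have "P h i i = (\<Sum>j<n - k. P h i j * P h j i)" using PP[where i = i and h = h and h' = h and l = i] supp_carrier by auto
    then show "dd k x i * P h i i = (\<Sum>j<n - k. dd k x i * P h i j * P h j i)"
      by (simp only: sum_distrib_left mult.assoc)
  qed
  also have "\<dots> = (\<Sum>h\<in>supp. \<Sum>i<n - k. \<Sum>j<n - k. dd k x i * P h i j * P h j i)"
    by (rule sum.swap)
  also have "\<dots> = (\<Sum>h\<in>supp. \<Sum>j<n - k. \<Sum>i<n - k. dd k x i * P h i j * P h j i)"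
    by (intro sum.cong HOL.refl sum.swap)
  also have "\<dots> = 0"
  proof (rule sum.neutral, rule ballI, rule sum.neutral, rule ballI)
    fix h j assume h: "h \<in> supp" and j: "j \<in> {..<n - k}"
    then have hc: "h \<in> carrier G" using supp_carrier by auto
    have ne: "h \<noteq> g \<otimes> h" using g hc by auto
    have "(\<Sum>i<n - k. dd k x i * P h i j * P h j i) = dd k x j * (\<Sum>i<n - k. P h j i * P (g \<otimes> h) i j)"
      unfolding sum_distrib_left using XP[OF _ hc, of j] j by (intro sum.cong HOL.refl) (simp add: mult_ac)
    also have "\<dots> = 0" using PP[where i = j and h = h and h' = "g \<otimes> h" and l = j] j hc g ne by simp
    finally show "(\<Sum>i<n - k. dd k x i * P h i j * P h j i) = 0" .
  qed
  finally show ?thesis .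
qed

end

text \<open>If p differs at i and j, then q agrees there; any further index differs in p from one of
  the two, so q has the same value at that index as well.\<close>

lemma two_equivalences:
  fixes p :: "nat \<Rightarrow> 'a" and q :: "nat \<Rightarrow> 'b"
  assumes "\<And>i j. i < n \<Longrightarrow> j < n \<Longrightarrow> p i = p j \<or> q i = q j"
  shows "(\<forall>i<n. \<forall>j<n. p i = p j) \<or> (\<forall>i<n. \<forall>j<n. q i = q j)"
  using assms by metis

text \<open>Mirror terms add up to twice a value, and a middle term is zero by hypothesis. The
  induction removes both ends at once.\<close>

lemma palindromic_sum_char2:
  fixes f :: "nat \<Rightarrow> 'f::field"
  assumes "(2::'f) = 0" and "\<And>j. j < m \<Longrightarrow> f (m - 1 - j) = f j" and "\<And>j. j + j + 1 = m \<Longrightarrow> f j = 0"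
  shows "(\<Sum>j<m. f j) = 0"
  using assms(2,3)
proof (induction m arbitrary: f rule: induct_nat_012)
  case (ge2 m)
  have "(\<Sum>j<m. f (Suc j)) = 0"
  proof (rule ge2.IH(1))
    show "f (Suc (m - 1 - j)) = f (Suc j)" if "j < m" for j
      using ge2.prems(1)[of "Suc j"] that by (simp add: Suc_diff_Suc)
    show "f (Suc j) = 0" if "j + j + 1 = m" for j
      using ge2.prems(2)[of "Suc j"] that by simp
  qed
  then have "(\<Sum>j<Suc (Suc m). f j) = f 0 + f (Suc m)"
    by (subst sum.lessThan_Suc, subst sum.lessThan_Suc_shift) (simp only: add_0_right)
  also have "f (Suc m) = f 0" using ge2.prems(1)[of 0] by simp
  also have "f 0 + f 0 = 2 * f 0" by (simp only: mult_2)
  also have "\<dots> = 0" using assms(1) by (simp only: mult_zero_left)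
  finally show ?case .
qed auto

text \<open>The solution s of the difference equation s i - s (i + k) = q i with initial values 0.
  Its diagonal matrix acts on N_k / N_(k+1) with the prescribed eigenvalues q. The guard on k = 0
  ensures termination.\<close>

fun skip_sum :: "nat \<Rightarrow> (nat \<Rightarrow> 'f::field) \<Rightarrow> nat \<Rightarrow> 'f" where
  "skip_sum k q j = (if k = 0 \<or> j < k then 0 else skip_sum k q (j - k) - q (j - k))"

declare skip_sum.simps [simp del]

lemma skip_sum_diff: "k > 0 \<Longrightarrow> skip_sum k q i - skip_sum k q (i + k) = q i"
  by (subst (2) skip_sum.simps) simp

context tri_grading
begin

definition dconst :: "'f tm \<Rightarrow> bool" where "dconst x \<longleftrightarrow> (\<forall>i<n. \<forall>j<n. x i i = x j j)"

text \<open>The vanishing trace on N_k / N_(k+1) telescopes: the first n - k diagonal entries have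
  the same sum as the last n - k. Comparing two consecutive lengths isolates one mirror
  pair.\<close>

lemma diag_sym:
  assumes x: "x \<in> A g" and g: "g \<in> carrier G" "g \<noteq> \<one>" and i: "i < n"
  shows "x (n - 1 - i) (n - 1 - i) = x i i"
proof -
  have S: "(\<Sum>i<l. x i i) = (\<Sum>i<l. x (n - 1 - i) (n - 1 - i))" if l: "l \<le> n" for l
  proof -
    have "(\<Sum>i<l. x i i) = (\<Sum>i<l. x (i + (n - l)) (i + (n - l)))"
      using trace_zero[OF assms(1-3), of "n - l"] l by (simp add: dd_def sum_subtractf)
    also have "\<dots> = (\<Sum>i<l. x (l - Suc i + (n - l)) (l - Suc i + (n - l)))"
      by (rule sum.nat_diff_reindex[symmetric])
    also have "\<dots> = (\<Sum>i<l. x (n - 1 - i) (n - 1 - i))"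
      by (rule sum.cong) (use l in \<open>auto simp: algebra_simps\<close>)
    finally show ?thesis .
  qed
  show ?thesis using S[of i] S[of "Suc i"] i by simp
qed

lemma dd_sum: "dd k (sum f S) i = (\<Sum>s\<in>S. dd k (f s) i)"
  by (simp add: dd_def sum_fun_apply2 sum_subtractf)

text \<open>A product of diagonal operators is diagonal, hence the action of some diagonal matrix z.
  On homogeneous vectors this operator multiplies degrees by g h, so the component of z of degree g
  h already acts in the same way.\<close>

lemma dd_product:
  assumes x: "x \<in> A g" "g \<in> carrier G" and y: "y \<in> A h" "h \<in> carrier G" and k: "k > 0"
  shows "\<exists>z\<in>A (g \<otimes> h). \<forall>i<n - k. dd k z i = dd k x i * dd k y i"
proof -
  define z where "z = diag n (skip_sum k (\<lambda>i. dd k x i * dd k y i))"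
  have zU: "z \<in> UU n" by (simp add: z_def)
  have xU: "x \<in> UU n" and yU: "y \<in> UU n" using A_UU x y by blast+
  have dz: "dd k z i = dd k x i * dd k y i" if "i < n - k" for i
    using skip_sum_diff[OF k] that by (simp add: dd_def z_def less_diff_conv)
  have gh: "g \<otimes> h \<in> carrier G" using x y by simp
  have "dd k (pr (g \<otimes> h) z) i = dd k x i * dd k y i" if i: "i < n - k" for i
  proof -
    have eN: "(ee i (i + k) :: 'f tm) \<in> NN n k" using i by auto
    have "(1::'f) = (\<Sum>c\<in>supp. pr c (ee i (i + k))) i (i + k)"
      unfolding sum_pr[OF NN_UU[OF eN], symmetric] by (simp add: ee_def)
    then have "(\<Sum>c\<in>supp. pr c (ee i (i + k)) i (i + k)) = (1::'f)"
      by (simp only: sum_fun_apply2)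
    \<comment> \<open>A homogeneous component of the root vector that still has a nonzero entry at
      (i, i + k): acting on it reads off the i-th eigenvalue.\<close>
    then obtain c where c: "c \<in> supp" "pr c (ee i (i + k)) i (i + k) \<noteq> (0::'f)"
      by (metis (no_types, lifting) sum.neutral zero_neq_one)
    define w where "w = (pr c (ee i (i + k)) :: 'f tm)"
    have cG: "c \<in> carrier G" using c supp_carrier by auto
    have w: "w \<in> A c" "w \<in> NN n k" using cG i eN by (auto simp: w_def intro!: pr_A pr_NN)
    have wU: "w \<in> UU n" using w NN_UU by blast
    have N: "br z w - br x (br y w) \<in> NN n (Suc k)"
    proof (rule NN_SucI)
      show "br z w - br x (br y w) \<in> NN n k" using w xU yU zU by auto
      fix l assume "l + k < n"
      then show "(br z w - br x (br y w)) l (l + k) = 0"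
        using br_entry_UU[OF zU w(2), of l] br_entry_UU[OF yU w(2), of l] dz[of l]
          br_entry_UU[OF xU br_UU_NN[OF yU w(2)], of l]
        by (simp add: dd_def less_diff_conv)
    qed
    have "br x (br y w) \<in> A (g \<otimes> (h \<otimes> c))" using x y w cG by (auto intro!: A_br)
    then have "pr (g \<otimes> h \<otimes> c) (br x (br y w)) = br x (br y w)"
      using pr_hom[of "br x (br y w)" "g \<otimes> (h \<otimes> c)"] x y cG by (simp add: m_assoc)
    moreover have "pr (g \<otimes> h \<otimes> c) (br z w) = br (pr (g \<otimes> h) z) w"
      by (rule pr_br_hom_right) (use w cG zU gh in auto)
    moreover have "br z w \<in> UU n" "br x (br y w) \<in> UU n" using wU xU yU zU by auto
    ultimately have "br (pr (g \<otimes> h) z) w - br x (br y w) \<in> NN n (Suc k)"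
      using pr_NN[OF N, of "g \<otimes> h \<otimes> c"] by (simp add: pr_diff)
    from NN_SucD[OF this, of i] have "(dd k (pr (g \<otimes> h) z) i - dd k x i * dd k y i) * w i (i + k) = 0"
      using br_entry_UU[OF pr_UU[OF zU] w(2), of "g \<otimes> h" i] br_entry_UU[OF yU w(2), of i]
          br_entry_UU[OF xU br_UU_NN[OF yU w(2)], of i]
      by (simp add: dd_def algebra_simps)
    then show ?thesis using c by (simp add: w_def)
  qed
  moreover have "pr (g \<otimes> h) z \<in> A (g \<otimes> h)" using zU gh by (rule pr_A)
  ultimately show ?thesis by blast
qed

lemma dconstI:
  assumes "\<And>i. i < n - 1 \<Longrightarrow> dd 1 x i = 0" shows "dconst x"
proof -
  have "x i i = x 0 0" if "i < n" for i
    using that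
  proof (induction i)
    case (Suc i)
    have "x i i - x (Suc i) (Suc i) = 0" using assms[of i] Suc.prems by (simp add: dd_def)
    with Suc show ?case by (metis Suc_lessD eq_iff_diff_eq_0)
  qed (rule HOL.refl)
  then show ?thesis unfolding dconst_def by metis
qed

lemma dd_antisym:
  assumes x: "x \<in> A g" and g: "g \<in> carrier G" "g \<noteq> \<one>" and i: "i < n - 1"
  shows "dd 1 x (n - 2 - i) = - dd 1 x i"
proof -
  have e: "n - 2 - i + 1 = n - 1 - i" "n - 2 - i = n - 1 - Suc i" using i by auto
  have "dd 1 x (n - 2 - i) = x (n - 1 - Suc i) (n - 1 - Suc i) - x (n - 1 - i) (n - 1 - i)"
    unfolding dd_def e(1) unfolding e(2) ..
  also have "\<dots> = - dd 1 x i"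
    using diag_sym[OF assms(1-3), of i] diag_sym[OF assms(1-3), of "Suc i"] i by (simp add: dd_def)
  finally show ?thesis .
qed

text \<open>In characteristic 2 the form \<open>\<Sum>\<^sub>i dd 1 x i * dd 1 y i\<close> vanishes for homogeneous \<open>x\<close> of degree
  \<open>g \<noteq> \<one>\<close> and all homogeneous \<open>y\<close>: by the trace if \<open>y\<close> does not have degree \<open>g\<inverse>\<close>, and by the symmetry of
  both diagonals otherwise.\<close>

lemma dconst_char2:
  assumes two: "(2::'f) = 0" and x: "x \<in> A g" and g: "g \<in> carrier G" "g \<noteq> \<one>"
  shows "dconst x"
proof (rule dconstI)
  fix i assume i: "i < n - 1"
  \<comment> \<open>Dual to position i: \<open>dd 1 u\<close> is the indicator of i on the first
    superdiagonal, so the form evaluated at x and u gives \<open>dd 1 x i\<close>.\<close>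
  define u where "u = diag n (skip_sum 1 (\<lambda>j. if j = i then 1 else 0 :: 'f))"
  have du: "dd 1 u j = (if j = i then 1 else 0)" if "j < n - 1" for j
    using skip_sum_diff[of 1 "\<lambda>j. if j = i then 1 else 0 :: 'f" j] that
    by (simp add: dd_def u_def less_diff_conv)
  have "u \<in> UU n" by (simp add: u_def)
  from arg_cong[OF sum_pr[OF this], of "dd 1"] have du': "dd 1 u j = (\<Sum>h\<in>supp. dd 1 (pr h u) j)" for j
    by (simp only: dd_sum)
  have "(\<Sum>j<n - 1. dd 1 x j * dd 1 u j) = (\<Sum>j<n - 1. if j = i then dd 1 x i else 0)"
    by (rule sum.cong) (auto simp: du simp del: One_nat_def)
  then have "dd 1 x i = (\<Sum>j<n - 1. dd 1 x j * dd 1 u j)" using i by simp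
  also have "\<dots> = (\<Sum>j<n - 1. \<Sum>h\<in>supp. dd 1 x j * dd 1 (pr h u) j)"
    by (simp only: du' sum_distrib_left)
  also have "\<dots> = (\<Sum>h\<in>supp. \<Sum>j<n - 1. dd 1 x j * dd 1 (pr h u) j)"
    by (rule sum.swap)
  also have "\<dots> = 0"
  proof (rule sum.neutral, rule ballI)
    fix h assume "h \<in> supp"
    then have h: "h \<in> carrier G" using supp_carrier by auto
    have y: "pr h u \<in> A h" using h by (auto simp: u_def intro!: pr_A)
    show "(\<Sum>j<n - 1. dd 1 x j * dd 1 (pr h u) j) = 0"
    proof (cases "g \<otimes> h = \<one>")
      case False
      obtain z where "z \<in> A (g \<otimes> h)" "\<forall>i<n - 1. dd 1 z i = dd 1 x i * dd 1 (pr h u) i"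
        using dd_product[OF x g(1) y h, of 1] by auto
      then show ?thesis using trace_zero[of z "g \<otimes> h" 1] False g h by simp
    next
      case True
      then have h1: "h \<noteq> \<one>" using g by auto
      show ?thesis
      proof (rule palindromic_sum_char2[OF two])
        fix j assume "j < n - 1"
        then show "dd 1 x (n - 1 - 1 - j) * dd 1 (pr h u) (n - 1 - 1 - j) = dd 1 x j * dd 1 (pr h u) j"
          using dd_antisym[OF x g, of j] dd_antisym[OF y h h1, of j] by (simp add: numeral_2_eq_2)
      next
        fix j assume "j + j + 1 = n - 1"
        then have "n - 1 - j = Suc j" "j < n" by auto
        then show "dd 1 x j * dd 1 (pr h u) j = 0" using diag_sym[OF x g, of j] by (simp add: dd_def)
      qed
    qed
  qed
  finally show "dd 1 x i = 0" .
qed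

text \<open>The element z of degree g h from \<open>dd_product\<close> has a symmetric diagonal,
  because g h is not the identity. So its eigenvalue at (i, j) is the negative of the one at the
  mirrored position.\<close>

lemma product_entries:
  assumes x: "x \<in> A g" "g \<in> carrier G" and y: "y \<in> A h" "h \<in> carrier G" and gh: "g \<otimes> h \<noteq> \<one>"
    and ij: "i < j" "j < n"
  shows "(x i i - x j j) * (y i i - y j j) = - (x (n-1-j) (n-1-j) - x (n-1-i) (n-1-i)) * (y (n-1-j) (n-1-j) - y (n-1-i) (n-1-i))"
proof -
  obtain z where z: "z \<in> A (g \<otimes> h)" "\<forall>l<n - (j - i). dd (j - i) z l = dd (j - i) x l * dd (j - i) y l"
    using dd_product[OF x y, of "j - i"] ij by auto
  have ghc: "g \<otimes> h \<in> carrier G" using x y by simp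
  have "n - 1 - j + (j - i) = n - 1 - i" using ij by auto
  moreover have "n - 1 - j < n - (j - i)" "i < n - (j - i)" "i + (j - i) = j" using ij by auto
  ultimately have E: "(x i i - x j j) * (y i i - y j j) = z i i - z j j"
    "(x (n-1-j) (n-1-j) - x (n-1-i) (n-1-i)) * (y (n-1-j) (n-1-j) - y (n-1-i) (n-1-i))
      = z (n-1-j) (n-1-j) - z (n-1-i) (n-1-i)"
    using z(2)[rule_format, of i] z(2)[rule_format, of "n - 1 - j"] unfolding dd_def by metis+
  have "z (n-1-i) (n-1-i) = z i i" "z (n-1-j) (n-1-j) = z j j"
    using diag_sym[OF z(1) ghc gh] ij by auto
  then show ?thesis unfolding mult_minus_left E by (simp only: minus_diff_eq)
qed

text \<open>The case \<open>t = \<one>\<close> stands for gradings in which only the identity degree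
  carries nonscalar diagonals. For \<open>t \<noteq> \<one>\<close> the last clause says that the
  diagonals of degree \<open>\<one>\<close> are antisymmetric up to a constant.\<close>

definition grading_type :: "'g \<Rightarrow> bool" where
  "grading_type t \<longleftrightarrow> t \<in> carrier G \<and> t \<otimes> t = \<one> \<and>
     (\<forall>g\<in>carrier G. g \<noteq> \<one> \<longrightarrow> g \<noteq> t \<longrightarrow> (\<forall>x\<in>A g. dconst x)) \<and>
     (t \<noteq> \<one> \<longrightarrow> (2::'f) \<noteq> 0 \<and> (\<exists>x\<in>A t. \<not> dconst x) \<and>
       (\<forall>x\<in>A t. \<forall>i<n. x (n-1-i) (n-1-i) = x i i) \<and>
       (\<forall>x\<in>A \<one>. \<forall>i<n. \<forall>j<n. x i i + x (n-1-i) (n-1-i) = x j j + x (n-1-j) (n-1-j)))"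

text \<open>A nonscalar diagonal x of degree t tests every other degree. If y has degree g, neither
  g nor t g being the identity, then the symmetry of both diagonals in
  \<open>product_entries\<close> shows that at any two indices x or y agrees, and
  \<open>two_equivalences\<close> makes y scalar.\<close>

theorem grading_type_exists: "\<exists>t. grading_type t"
proof (cases "\<forall>g\<in>carrier G. g \<noteq> \<one> \<longrightarrow> (\<forall>x\<in>A g. dconst x)")
  case True
  then have "grading_type \<one>" by (auto simp: grading_type_def)
  then show ?thesis by blast
next
  case False
  then obtain t x where t: "t \<in> carrier G" "t \<noteq> \<one>" and x: "x \<in> A t" "\<not> dconst x" by blast
  have two: "(2::'f) \<noteq> 0" using dconst_char2[OF _ x(1) t] x(2) by blast
  note xs = diag_sym[OF x(1) t]
  have dc: "dconst y" if y: "y \<in> A g" and g: "g \<in> carrier G" "g \<noteq> \<one>" and tg: "t \<otimes> g \<noteq> \<one>" for y g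
  proof -
    note ys = diag_sym[OF y g]
    have l: "x i i = x j j \<or> y i i = y j j" if "i < j" "j < n" for i j
    proof -
      have "(x i i - x j j) * (y i i - y j j) = - (x j j - x i i) * (y j j - y i i)"
        using product_entries[OF x(1) t(1) y g(1) tg that] xs ys that by simp
      then have "2 * ((x i i - x j j) * (y i i - y j j)) = 0" by (simp add: algebra_simps)
      then show ?thesis using two by simp
    qed
    have "x i i = x j j \<or> y i i = y j j" if "i < n" "j < n" for i j
      using l[of i j] l[of j i] that by (metis nat_neq_iff)
    from two_equivalences[of n "\<lambda>i. x i i" "\<lambda>i. y i i", OF this] x(2)
    show "dconst y" unfolding dconst_def by blast
  qed
  \<comment> \<open>The test applied to x itself: its diagonal is not scalar, so the product of
    degrees must be the identity.\<close>
  have tt: "t \<otimes> t = \<one>" using dc[OF x(1) t] x(2) by blast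
  have c1: "\<forall>g\<in>carrier G. g \<noteq> \<one> \<longrightarrow> g \<noteq> t \<longrightarrow> (\<forall>x\<in>A g. dconst x)"
  proof (intro ballI impI)
    fix g y assume g: "g \<in> carrier G" "g \<noteq> \<one>" "g \<noteq> t" "y \<in> A g"
    have "t \<otimes> g \<noteq> \<one>"
    proof
      assume "t \<otimes> g = \<one>"
      then have "t \<otimes> g = t \<otimes> t" using tt by simp
      with g(1,3) t(1) show False by simp
    qed
    then show "dconst y" using dc[OF g(4,1,2)] by simp
  qed
  \<comment> \<open>In degree \<open>\<one>\<close> only x is known to be symmetric, so the mirrored
    entries of y survive and the conclusion concerns the mirror sums of y.\<close>
  have c2: "y i i + y (n-1-i) (n-1-i) = y j j + y (n-1-j) (n-1-j)"
    if y: "y \<in> A \<one>" and ij: "i < n" "j < n" for y i j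
  proof -
    have t1: "t \<otimes> \<one> \<noteq> \<one>" using t by simp
    have l: "x i i = x j j \<or> y i i + y (n-1-i) (n-1-i) = y j j + y (n-1-j) (n-1-j)" if "i < j" "j < n" for i j
    proof -
      have "(x i i - x j j) * (y i i - y j j) = - (x j j - x i i) * (y (n-1-j) (n-1-j) - y (n-1-i) (n-1-i))"
        using product_entries[OF x(1) t(1) y one_closed t1 that] xs that by simp
      then have "(x i i - x j j) * (y i i + y (n-1-i) (n-1-i) - (y j j + y (n-1-j) (n-1-j))) = 0"
        by (simp add: algebra_simps)
      then show ?thesis by auto
    qed
    have "x i i = x j j \<or> y i i + y (n-1-i) (n-1-i) = y j j + y (n-1-j) (n-1-j)" if "i < n" "j < n" for i j
      using l[of i j] l[of j i] that by (metis nat_neq_iff)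
    from two_equivalences[of n "\<lambda>i. x i i" "\<lambda>i. y i i + y (n-1-i) (n-1-i)", OF this] x(2)
    show ?thesis using ij by (auto simp: dconst_def)
  qed
  have c3: "\<forall>y\<in>A t. \<forall>i<n. y (n-1-i) (n-1-i) = y i i" using diag_sym t by simp
  have "grading_type t" unfolding grading_type_def
    proof (intro conjI impI)
    from x(2,1) show "\<exists>x\<in>A t. \<not> dconst x" ..
    show "\<forall>x\<in>A \<one>. \<forall>i<n. \<forall>j<n. x i i + x (n-1-i) (n-1-i) = x j j + x (n-1-j) (n-1-j)"
      by (intro allI ballI impI c2)
    show "\<forall>x\<in>A t. \<forall>i<n. x (n-1-i) (n-1-i) = x i i" by (rule c3)
    show "\<forall>g\<in>carrier G. g \<noteq> \<one> \<longrightarrow> g \<noteq> t \<longrightarrow> (\<forall>x\<in>A g. dconst x)" by (rule c1)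
    show "t \<in> carrier G" by (rule t(1))
    show "t \<otimes> t = \<one>" by (rule tt)
    show "(2::'f) \<noteq> 0" by (rule two)
  qed
  then show ?thesis by blast
qed

end

section \<open>Automorphisms\<close>

definition aut :: "nat \<Rightarrow> ('f::field tm \<Rightarrow> 'f tm) \<Rightarrow> bool" where
  "aut n \<psi> \<longleftrightarrow> bij_betw \<psi> (UU n) (UU n) \<and>
     (\<forall>x\<in>UU n. \<forall>y\<in>UU n. \<psi> (x + y) = \<psi> x + \<psi> y \<and> \<psi> (br x y) = br (\<psi> x) (\<psi> y)) \<and>
     (\<forall>a. \<forall>x\<in>UU n. \<psi> (sc a x) = sc a (\<psi> x))"

lemma aut_UU: "aut n \<psi> \<Longrightarrow> x \<in> UU n \<Longrightarrow> \<psi> x \<in> UU n"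
  by (auto simp: aut_def bij_betw_def)
lemma aut_add: "aut n \<psi> \<Longrightarrow> x \<in> UU n \<Longrightarrow> y \<in> UU n \<Longrightarrow> \<psi> (x + y) = \<psi> x + \<psi> y"
  by (auto simp: aut_def)
lemma aut_br: "aut n \<psi> \<Longrightarrow> x \<in> UU n \<Longrightarrow> y \<in> UU n \<Longrightarrow> \<psi> (br x y) = br (\<psi> x) (\<psi> y)"
  by (auto simp: aut_def)
lemma aut_sc: "aut n \<psi> \<Longrightarrow> x \<in> UU n \<Longrightarrow> \<psi> (sc a x) = sc a (\<psi> x)"
  by (auto simp: aut_def)
lemma aut_0: assumes "aut n \<psi>" shows "\<psi> 0 = 0"
  using aut_sc[OF assms, of 0 0] by simp
lemma aut_inj: "aut n \<psi> \<Longrightarrow> x \<in> UU n \<Longrightarrow> y \<in> UU n \<Longrightarrow> \<psi> x = \<psi> y \<Longrightarrow> x = y"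
  by (auto simp: aut_def bij_betw_def inj_on_def)
lemma aut_surj: assumes "aut n \<psi>" "y \<in> UU n" shows "\<exists>x\<in>UU n. \<psi> x = y"
proof -
  have "\<psi> ` UU n = UU n" using assms(1) by (simp add: aut_def bij_betw_def)
  with assms(2) have "y \<in> \<psi> ` UU n" by simp
  then show ?thesis by (rule imageE) auto
qed
lemma aut_sum:
  assumes "aut n \<psi>" and "\<And>s. s \<in> S \<Longrightarrow> f s \<in> UU n"
  shows "\<psi> (sum f S) = (\<Sum>s\<in>S. \<psi> (f s))"
  using assms(2)
proof (induction S rule: infinite_finite_induct)
  case (insert s S)
  then have "\<psi> (sum f S) = (\<Sum>s\<in>S. \<psi> (f s))" "f s \<in> UU n" "sum f S \<in> UU n" by (auto intro: NN_sum)
  then show ?case unfolding sum.insert[OF insert(1,2)] using aut_add[OF assms(1), of "f s" "sum f S"]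
    by (simp only: simp_thms)
next
  case (infinite S)
  show ?case unfolding sum.infinite[OF infinite(1)] by (rule aut_0[OF assms(1)])
next
  case empty
  show ?case unfolding sum.empty by (rule aut_0[OF assms(1)])
qed

lemma aut_diff:
  assumes "aut n \<psi>" "x \<in> UU n" "y \<in> UU n" shows "\<psi> (x - y) = \<psi> x - \<psi> y"
proof -
  have "\<psi> (x + sc (- 1) y) = \<psi> x + sc (- 1) (\<psi> y)"
    using aut_add[OF assms(1), of x "sc (- 1) y"] aut_sc[OF assms(1), of y "- 1"] assms(2,3) by simp
  then show ?thesis by (simp add: sc_uminus)
qed

text \<open>Bracketing with the a-th diagonal idempotent exposes the off-diagonal entries of row a;
  bracketing with \<open>ee 0 j\<close> compares the diagonal entries at 0 and j.\<close>

lemma ZZ_center: "z \<in> ZZ n \<longleftrightarrow> z \<in> UU n \<and> (\<forall>x\<in>UU n. br z x = 0)"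
proof
  assume "z \<in> UU n \<and> (\<forall>x\<in>UU n. br z x = 0)"
  then have z: "z \<in> UU n" and c: "\<And>x. x \<in> UU n \<Longrightarrow> br z x = 0" by auto
  have off: "z a b = 0" if "a \<noteq> b" for a b
  proof -
    let ?d = "diag n (\<lambda>i. if i = a then 1 else 0)"
    have "br ?d z = 0" using c[OF diag_UU] br_commute[of ?d z] by simp
    then have "br ?d z a b = 0" by (simp only: zero_fun_apply)
    then show ?thesis unfolding diag_br[OF z] using that by simp
  qed
  have dg: "z j j = z 0 0" if "j < n" for j
  proof -
    have e: "(ee 0 j :: 'a tm) \<in> NN n j" using that by simp
    have "br z (ee 0 j) 0 (0 + j) = 0" unfolding c[OF NN_UU[OF e]] by (simp only: zero_fun_apply)
    then show ?thesis unfolding br_entry_UU[OF z e] by (simp add: ee_def)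
  qed
  have "z a b = diag n (\<lambda>_. z 0 0) a b" for a b
    using off[of a b] dg[of a] NN_zero_entry[OF z, of a b] by (cases "a = b") (auto simp: not_less)
  then have "z = diag n (\<lambda>_. z 0 0)" by (intro tm_eqI)
  then show "z \<in> ZZ n" unfolding ZZ_iff by blast
qed (simp add: ZZ_UU)

lemma aut_ZZ: assumes "aut n \<psi>" "z \<in> ZZ n" shows "\<psi> z \<in> ZZ n"
  unfolding ZZ_center
proof (intro conjI ballI)
  show "\<psi> z \<in> UU n" using assms(2) by (intro aut_UU[OF assms(1)] ZZ_UU)
  fix x :: "'a tm" assume "x \<in> UU n"
  then obtain y where "y \<in> UU n" "\<psi> y = x" using aut_surj[OF assms(1)] by blast
  then show "br (\<psi> z) x = 0" using assms aut_br[OF assms(1), of z y] by (simp add: ZZ_UU aut_0[OF assms(1)])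
qed

lemma aut_comp: assumes "aut n \<phi>" "aut n \<psi>" shows "aut n (\<lambda>x. \<phi> (\<psi> x))"
proof -
  have "bij_betw (\<phi> \<circ> \<psi>) (UU n) (UU n)" using assms by (auto simp: aut_def intro: bij_betw_trans)
  then show ?thesis using aut_UU[OF assms(2)] assms by (simp add: aut_def comp_def)
qed

lemma aut_inv: assumes "aut n \<psi>" shows "aut n (inv_into (UU n) \<psi>)"
proof -
  let ?i = "inv_into (UU n) \<psi>"
  have b: "bij_betw \<psi> (UU n) (UU n)" using assms by (simp add: aut_def)
  have iU: "?i x \<in> UU n" and i: "\<psi> (?i x) = x" if "x \<in> UU n" for x
    using that b by (auto simp: bij_betw_def f_inv_into_f) (metis inv_into_into)
  have l: "?i (\<psi> x) = x" if "x \<in> UU n" for x using that b by (simp add: bij_betw_def)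
  show ?thesis unfolding aut_def
  proof (intro conjI ballI allI)
    show "bij_betw ?i (UU n) (UU n)" using b by (rule bij_betw_inv_into)
    fix x :: "'a tm" assume x: "x \<in> UU n"
    show "?i (sc a x) = sc a (?i x)" for a
      using l[of "sc a (?i x)"] by (simp add: aut_sc[OF assms] i iU x)
    fix y :: "'a tm" assume y: "y \<in> UU n"
    show "?i (x + y) = ?i x + ?i y"
      using l[of "?i x + ?i y"] by (simp add: aut_add[OF assms] i iU x y)
    show "?i (br x y) = br (?i x) (?i y)"
      using l[of "br (?i x) (?i y)"] by (simp add: aut_br[OF assms] i iU x y)
  qed
qed

lemma aut_id: "aut n (\<lambda>x. x)" by (simp add: aut_def bij_betw_def)

lemma (in tri_grading) image_grading:
  assumes a: "aut n \<psi>" shows "tri_grading G n (\<lambda>g. \<psi> ` A g)"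
proof
  fix g assume g: "g \<in> carrier G"
  show "x \<in> \<psi> ` A g \<Longrightarrow> x \<in> UU n" for x :: "'f tm" using g A_UU aut_UU[OF a] by blast
  show "0 \<in> \<psi> ` A g" using g aut_0[OF a] by (metis A_0 image_eqI)
  show "x + y \<in> \<psi> ` A g" if xy: "x \<in> \<psi> ` A g" "y \<in> \<psi> ` A g" for x y
  proof -
    from xy obtain u v where "u \<in> A g" "v \<in> A g" "x = \<psi> u" "y = \<psi> v" by blast
    then show ?thesis using g A_UU[OF g] by (intro image_eqI[of _ _ "u + v"]) (auto simp: A_add aut_add[OF a])
  qed
  show "sc c x \<in> \<psi> ` A g" if xy: "x \<in> \<psi> ` A g" for x c
  proof -
    from xy obtain u where "u \<in> A g" "x = \<psi> u" by blast
    then show ?thesis using g A_UU[OF g] by (intro image_eqI[of _ _ "sc c u"]) (auto simp: A_sc aut_sc[OF a])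
  qed
  fix h assume h: "h \<in> carrier G"
  show "br x y \<in> \<psi> ` A (g \<otimes> h)" if xy: "x \<in> \<psi> ` A g" "y \<in> \<psi> ` A h" for x y
  proof -
    from xy obtain u v where "u \<in> A g" "v \<in> A h" "x = \<psi> u" "y = \<psi> v" by blast
    then show ?thesis using g h A_UU[OF g] A_UU[OF h]
      by (intro image_eqI[of _ _ "br u v"]) (auto simp: A_br aut_br[OF a])
  qed
next
  fix x :: "'f tm" assume "x \<in> UU n"
  then obtain y where y: "y \<in> UU n" "\<psi> y = x" using aut_surj[OF a] by blast
  obtain S c where S: "finite S" "S \<subseteq> carrier G" "\<forall>g\<in>S. c g \<in> A g" "y = (\<Sum>g\<in>S. c g)"
    using A_ex[OF y(1)] by blast
  have "x = (\<Sum>g\<in>S. \<psi> (c g))"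
    unfolding y(2)[symmetric] S(4) using S A_UU by (intro aut_sum[OF a]) auto
  then show "\<exists>S c. finite S \<and> S \<subseteq> carrier G \<and> (\<forall>g\<in>S. c g \<in> \<psi> ` A g) \<and> x = (\<Sum>g\<in>S. c g)"
    using S by (intro exI[of _ S] exI[of _ "\<lambda>g. \<psi> (c g)"]) auto
next
  fix S c g
  assume S: "finite S" "S \<subseteq> carrier G" "\<And>g. g \<in> S \<Longrightarrow> c g \<in> \<psi> ` A g" "(\<Sum>g\<in>S. c g) = 0" "g \<in> S"
  have "\<forall>g\<in>S. \<exists>u. u \<in> A g \<and> c g = \<psi> u" using S(3) by blast
  then obtain u where u: "\<And>g. g \<in> S \<Longrightarrow> u g \<in> A g" "\<And>g. g \<in> S \<Longrightarrow> c g = \<psi> (u g)" by metis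
  have uU: "u g \<in> UU n" if "g \<in> S" for g using that S u A_UU by blast
  have "\<psi> (\<Sum>g\<in>S. u g) = (\<Sum>g\<in>S. \<psi> (u g))" by (rule aut_sum[OF a uU])
  also have "\<dots> = 0" using S(4) u(2) by simp
  finally have "(\<Sum>g\<in>S. u g) = 0"
    using uU by (intro aut_inj[OF a, of "\<Sum>g\<in>S. u g" 0]) (simp_all add: aut_0[OF a] NN_sum)
  from A_indep[OF S(1,2) u(1) this S(5)] show "c g = 0" using u(2)[OF S(5)] aut_0[OF a] by simp
qed

subsection \<open>Conjugation by unipotent matrices\<close>

definition idm :: "nat \<Rightarrow> 'f::field tm" where "idm n = diag n (\<lambda>_. 1)"

lemma idm_UU [simp]: "idm n \<in> UU n" by (simp add: idm_def)
lemma idm_mm [simp]: "x \<in> UU n \<Longrightarrow> mm (idm n) x = x" "x \<in> UU n \<Longrightarrow> mm x (idm n) = x"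
  using diag_mm[of x n "\<lambda>_. 1"] by (simp_all add: idm_def)

lemma mm_UU [simp]: "x \<in> UU n \<Longrightarrow> y \<in> UU n \<Longrightarrow> mm x y \<in> UU n"
  using mm_NN[of x n 0 y 0] by simp

text \<open>(1 + y)(1 - y) = 1 - y y, and y y lies deeper in the filtration, so the induction on n -
  k supplies its inverse.\<close>

lemma unipotent_inverse:
  assumes "y \<in> NN n k" "k > 0"
  shows "\<exists>w\<in>UU n. mm (idm n + y) w = idm n \<and> mm w (idm n + y) = idm n"
  using assms
proof (induction "n - k" arbitrary: k y rule: less_induct)
  case less
  have yU: "y \<in> UU n" using less.prems NN_UU by blast
  show ?case
  proof (cases "n \<le> k")
    case True
    then have "y = 0" using less.prems NN_top by blast
    then show ?thesis by (intro bexI[of _ "idm n"]) auto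
  next
    case False
    let ?m = "idm n - y" and ?p = "idm n + y"
    have "mm y y \<in> NN n (Suc k)" using mm_NN[OF less.prems(1) less.prems(1)] less.prems(2) NN_mono[of "Suc k" "k + k"] by auto
    then have "- mm y y \<in> NN n (Suc k)" by simp
    moreover have "n - Suc k < n - k" using False by simp
    ultimately obtain w where w: "w \<in> UU n" "mm (idm n + - mm y y) w = idm n" "mm w (idm n + - mm y y) = idm n"
      using less.hyps[of "Suc k" "- mm y y"] by auto
    have pm: "mm ?p ?m = idm n + - mm y y" "mm ?m ?p = idm n + - mm y y"
      using yU by (simp_all add: mm_add mm_diff)
    have mU: "?m \<in> UU n" and pU: "?p \<in> UU n" using yU by simp_all
    have r: "mm ?p (mm ?m w) = idm n" using w pm by (simp flip: mm_assoc)
    have l: "mm (mm w ?m) ?p = idm n" using w pm by (simp add: mm_assoc)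
    have "mm w ?m = mm (mm w ?m) (mm ?p (mm ?m w))" using r w mU by simp
    also have "\<dots> = mm (mm (mm w ?m) ?p) (mm ?m w)" by (simp only: mm_assoc)
    also have "\<dots> = mm ?m w" using l w mU by simp
    finally have e: "mm w ?m = mm ?m w" .
    show ?thesis using r l[unfolded e] w(1) mU by (intro bexI[of _ "mm ?m w"]) simp_all
  qed
qed

lemma conjugation_aut:
  assumes P: "P \<in> UU n" and Q: "Q \<in> UU n" and PQ: "mm P Q = idm n" "mm Q P = idm n"
  shows "aut n (\<lambda>x. mm (mm P x) Q)"
  unfolding aut_def
proof (intro conjI ballI allI)
  have c: "mm (mm P (mm (mm Q x) P)) Q = x" "mm (mm Q (mm (mm P x) Q)) P = x" if "x \<in> UU n" for x
  proof -
    have "mm (mm P (mm (mm Q x) P)) Q = mm (mm (mm P Q) x) (mm P Q)" by (simp only: mm_assoc)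
    then show "mm (mm P (mm (mm Q x) P)) Q = x" using PQ that by simp
    have "mm (mm Q (mm (mm P x) Q)) P = mm (mm (mm Q P) x) (mm Q P)" by (simp only: mm_assoc)
    then show "mm (mm Q (mm (mm P x) Q)) P = x" using PQ that by simp
  qed
  show "bij_betw (\<lambda>x. mm (mm P x) Q) (UU n) (UU n)"
    by (rule bij_betw_byWitness[where f' = "\<lambda>x. mm (mm Q x) P"]) (use c P Q in auto)
  fix x :: "'a tm" assume x: "x \<in> UU n"
  show "mm (mm P (sc a x)) Q = sc a (mm (mm P x) Q)" for a by (simp add: mm_sc)
  fix y :: "'a tm" assume y: "y \<in> UU n"
  show "mm (mm P (x + y)) Q = mm (mm P x) Q + mm (mm P y) Q" by (simp add: mm_add)
  have p: "mm (mm (mm P a) Q) (mm (mm P b) Q) = mm (mm P (mm a b)) Q" if "a \<in> UU n" "b \<in> UU n" for a b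
  proof -
    have "mm (mm (mm P a) Q) (mm (mm P b) Q) = mm (mm P (mm a (mm (mm Q P) b))) Q" by (simp only: mm_assoc)
    then show ?thesis using PQ that by simp
  qed
  show "mm (mm P (br x y)) Q = br (mm (mm P x) Q) (mm (mm P y) Q)"
    unfolding br_def p[OF x y] p[OF y x] by (simp add: mm_diff)
qed

text \<open>Conjugation by 1 + y. If X is the conjugate of x, then X (1 + y) = (1 + y) x, so X - x =
  y x - X y; replacing X by x in the last term costs only a product of two elements of
  \<open>NN n k\<close>.\<close>

lemma unipotent_aut:
  assumes y: "y \<in> NN n k" and k: "k > 0"
  shows "\<exists>\<psi>. aut n \<psi> \<and> (\<forall>x\<in>UU n. \<psi> x - x - br y x \<in> NN n (Suc k))"
proof -
  obtain w where w: "w \<in> UU n" "mm (idm n + y) w = idm n" "mm w (idm n + y) = idm n"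
    using unipotent_inverse[OF assms] by blast
  have yU: "y \<in> UU n" using y NN_UU by blast
  let ?\<psi> = "\<lambda>x. mm (mm (idm n + y) x) w"
  have a: "aut n ?\<psi>" by (rule conjugation_aut) (use w yU in auto)
  have "?\<psi> x - x - br y x \<in> NN n (Suc k)" if x: "x \<in> UU n" for x
  proof -
    let ?X = "?\<psi> x"
    have XU: "?X \<in> UU n" using x w yU by simp
    have "mm ?X (idm n + y) = mm (idm n + y) x"
      unfolding mm_assoc w(3) using idm_mm(2)[OF x] by (simp only: mm_assoc[symmetric])
    then have "mm ?X (idm n) + mm ?X y = mm (idm n) x + mm y x"
      unfolding mm_add(2)[symmetric] mm_add(1)[symmetric] .
    then have "?X + mm ?X y = x + mm y x"
      unfolding idm_mm(1)[OF x] idm_mm(2)[OF XU] .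
    then have d: "?X - x = mm y x - mm ?X y" by (simp add: algebra_simps)
    have dk: "?X - x \<in> NN n k"
      unfolding d using mm_NN[OF y x] mm_NN[OF XU y] by simp
    have "?X - x - br y x = - mm (?X - x) y"
      by (subst d) (simp add: br_def mm_diff)
    moreover have "mm (?X - x) y \<in> NN n (Suc k)"
      using mm_NN[OF dk y] k NN_mono[of "Suc k" "k + k"] by auto
    ultimately show ?thesis by simp
  qed
  with a show ?thesis by blast
qed

section \<open>Homogeneous diagonal matrices\<close>

definition dg :: "nat \<Rightarrow> 'f::field tm \<Rightarrow> 'f tm" where "dg n x = diag n (\<lambda>i. x i i)"

lemma dg_UU [simp]: "dg n x \<in> UU n" by (simp add: dg_def)

lemma dg_dg [simp]: "br (dg n x) (dg n y) = 0"
  by (intro tm_eqI) (simp add: dg_def diag_br)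

text \<open>The number k measures how far the diagonal part may still be from a homogeneous element
  modulo the centre. From k = n on the error term is zero.\<close>

definition diag_graded :: "('g, 'm) monoid_scheme \<Rightarrow> nat \<Rightarrow> ('g \<Rightarrow> 'f::field tm set) \<Rightarrow> nat \<Rightarrow> bool" where
  "diag_graded G n A k \<longleftrightarrow> (\<forall>g\<in>carrier G. \<forall>x\<in>A g. \<exists>y\<in>A g. \<exists>z\<in>ZZ n. y + z - dg n x \<in> NN n k)"

context tri_grading
begin

text \<open>An element of degree \<open>\<one>\<close> that acts on \<open>N\<^sub>k / N\<^sub>k\<^sub>+\<^sub>1\<close> as a nonzero scalar. The diagonal matrix with
  entries \<open>- (i div k)\<close> acts as \<open>1\<close>; its antisymmetrisation acts as \<open>2\<close>.\<close>

lemma scalar_action_exists: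
  assumes k: "k > 0" 
  shows "\<exists>x\<in>A \<one>. \<exists>c. c \<noteq> 0 \<and> (\<forall>i<n - k. dd k x i = c)"
proof -
  obtain t where t: "grading_type t" using grading_type_exists by blast
  then have tc: "t \<in> carrier G" by (simp add: grading_type_def)
  define s where "s i = - (of_nat (i div k) :: 'f)" for i
  have s: "s i - s (i + k) = 1" for i using k by (simp add: s_def div_add_self2)
  have D: "dd k u i = (\<Sum>h\<in>supp. dd k (pr h u) i)" if "u \<in> UU n" for u i
    using arg_cong[OF sum_pr[OF that], of "\<lambda>w. dd k w i"] by (simp only: dd_sum)
  have D0: "dd k (pr h u) i = 0" if "u \<in> UU n" "h \<in> supp" "h \<noteq> \<one>" "h \<noteq> t" "i < n - k" for h i u
  proof -
    have "h \<in> carrier G" using that supp_carrier by auto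
    then have "dconst (pr h u)" using that t pr_A[OF that(1)] unfolding grading_type_def by blast
    then have "pr h u i i = pr h u (i + k) (i + k)"
      using that(5) unfolding dconst_def less_diff_conv by (meson le_add1 le_less_trans)
    then show ?thesis by (simp add: dd_def)
  qed
  show ?thesis
  proof (cases "t = \<one>")
    case True
    define u where "u = diag n s"
    have uU: "u \<in> UU n" by (simp add: u_def)
    have "dd k (pr \<one> u) i = 1" if i: "i < n - k" for i
    proof -
      have "dd k u i = 1" using s[of i] i by (simp add: dd_def u_def less_diff_conv)
      moreover have "(\<Sum>h\<in>supp. dd k (pr h u) i) = (\<Sum>h\<in>supp. if h = \<one> then dd k (pr \<one> u) i else 0)"
        using D0[OF uU] True i by (intro sum.cong) auto
      moreover have "pr \<one> u = 0" if "\<one> \<notin> supp" using that by (rule pr_not_supp[OF uU])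
      ultimately show ?thesis using D[OF uU, of i] by (cases "\<one> \<in> supp") (auto simp: finite_supp dd_def)
    qed
    moreover have "pr \<one> u \<in> A \<one>" using uU by (intro pr_A) auto
    ultimately show ?thesis by (intro bexI[of _ "pr \<one> u"] exI[of _ 1]) auto
  next
    case False
    then have two: "(2::'f) \<noteq> 0" and st: "\<And>x i. x \<in> A t \<Longrightarrow> i < n \<Longrightarrow> x (n-1-i) (n-1-i) = x i i"
      and s1: "\<And>x i j. x \<in> A \<one> \<Longrightarrow> i < n \<Longrightarrow> j < n \<Longrightarrow> x i i + x (n-1-i) (n-1-i) = x j j + x (n-1-j) (n-1-j)"
      using t unfolding grading_type_def by blast+
    define u where "u = diag n (\<lambda>i. s i - s (n-1-i))"
    have uU: "u \<in> UU n" by (simp add: u_def)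
    have du: "dd k u i = 2" if i: "i < n - k" for i
    proof -
      have "n - 1 - (i + k) + k = n - 1 - i" using i by auto
      then have "s (n - 1 - (i + k)) - s (n - 1 - i) = 1" using s[of "n - 1 - (i + k)"] by simp
      then show ?thesis using s[of i] i by (simp add: dd_def u_def less_diff_conv algebra_simps)
    qed
    have du2: "dd k u i = dd k (pr \<one> u) i + dd k (pr t u) i" if i: "i < n - k" for i
    proof -
      have "(\<Sum>h\<in>supp. dd k (pr h u) i) = (\<Sum>h\<in>supp. (if h = \<one> then dd k (pr \<one> u) i else 0) + (if h = t then dd k (pr t u) i else 0))"
        using D0[OF uU] False i by (intro sum.cong) auto
      moreover have "dd k (pr h u) i = 0" if "h \<notin> supp" for h
        using pr_not_supp[OF uU that] by (simp add: dd_def)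
      ultimately show ?thesis using D[OF uU, of i] by (auto simp: finite_supp sum.distrib)
    qed
    have x1: "pr \<one> u \<in> A \<one>" and xt: "pr t u \<in> A t" using uU tc by (auto intro!: pr_A)
    have "dd k (pr \<one> u) i = 2" if i: "i < n - k" for i
    proof -
      \<comment> \<open>The mirror of position i on the k-th superdiagonal. There the eigenvalue of
        the degree t part changes sign and that of the degree \<open>\<one>\<close> part does not,
        while their sum is 2 at both positions; so the degree t part acts as zero.\<close>
      let ?j = "n - 1 - (i + k)"
      have j: "?j < n - k" "?j + k = n - 1 - i" using i k by auto
      have "dd k (pr t u) ?j = - dd k (pr t u) i"
        unfolding dd_def j(2) using st[OF xt, of i] st[OF xt, of "i + k"] i by simp
      moreover have "dd k (pr \<one> u) ?j = dd k (pr \<one> u) i"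
        unfolding dd_def j(2) using s1[OF x1, of i "i + k"] i by (simp add: algebra_simps)
      ultimately have e: "2 = dd k (pr \<one> u) i + dd k (pr t u) i" "2 = dd k (pr \<one> u) i - dd k (pr t u) i"
        using du du2 i j(1) by (metis, metis add_uminus_conv_diff)
      have "2 * dd k (pr t u) i = (dd k (pr \<one> u) i + dd k (pr t u) i) - (dd k (pr \<one> u) i - dd k (pr t u) i)"
        by simp
      also have "\<dots> = 0" unfolding e[symmetric] by simp
      finally have "dd k (pr t u) i = 0" using two by simp
      then show ?thesis using e(1) by simp
    qed
    then show ?thesis using x1 two by (intro bexI[of _ "pr \<one> u"] exI[of _ 2]) auto
  qed
qed

text \<open>An element of degree \<open>\<one>\<close> whose diagonal acts on N_k / N_(k+1) as a
  nonzero scalar c allows division by c there: conjugation corrects this one element, and bracketing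
  with it then corrects all others without changing their degrees.\<close>

lemma diag_graded_step:
  assumes dgr: "diag_graded G n A k" and k: "k > 0"
  shows "\<exists>\<psi>. aut n \<psi> \<and> diag_graded G n (\<lambda>g. \<psi> ` A g) (Suc k)"
proof -
  obtain x c where x: "x \<in> A \<one>" and c: "c \<noteq> 0" "\<And>i. i < n - k \<Longrightarrow> dd k x i = c"
    using scalar_action_exists[OF k] by blast
  let ?d = "dg n x"
  have act: "sc (1 / c) (br ?d v) - v \<in> NN n (Suc k)" if v: "v \<in> NN n k" for v
  proof (rule NN_SucI)
    show "sc (1 / c) (br ?d v) - v \<in> NN n k" using v by simp
    fix i assume "i + k < n"
    then show "(sc (1 / c) (br ?d v) - v) i (i + k) = 0"
      using br_entry_UU[OF dg_UU v, of x i] c(2)[of i] c(1) by (simp add: dg_def dd_def less_diff_conv)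
  qed
  obtain y z where y: "y \<in> A \<one>" and z: "z \<in> ZZ n" and N: "y + z - ?d \<in> NN n k"
    using dgr x unfolding diag_graded_def by blast
  define \<nu> where "\<nu> = y + z - ?d"
  \<comment> \<open>Conjugation by 1 + \<mu> changes the diagonal d by the bracket of \<mu> and d,
    which is -\<nu> modulo N_(k+1) because d acts as c; so it cancels the error \<nu>.\<close>
  define \<mu> where "\<mu> = sc (1 / c) \<nu>"
  have \<nu>N: "\<nu> \<in> NN n k" using N by (simp add: \<nu>_def)
  have \<mu>N: "\<mu> \<in> NN n k" using N by (simp add: \<mu>_def \<nu>_def)
  obtain \<psi> where \<psi>: "aut n \<psi>" and \<psi>2: "\<And>w. w \<in> UU n \<Longrightarrow> \<psi> w - w - br \<mu> w \<in> NN n (Suc k)"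
    using unipotent_aut[OF \<mu>N k] by blast
  have \<psi>1: "\<psi> w - w \<in> NN n k" if "w \<in> UU n" for w
  proof -
    have "br \<mu> w \<in> NN n k" using br_NN[OF \<mu>N that] by simp
    moreover have "\<psi> w - w - br \<mu> w \<in> NN n k" using \<psi>2[OF that] NN_mono[of k "Suc k"] by simp
    ultimately have "(\<psi> w - w - br \<mu> w) + br \<mu> w \<in> NN n k" by (intro NN_add)
    then show ?thesis by simp
  qed
  have yU: "y \<in> UU n" using A_UU[of \<one>] y by simp
  have zU: "z \<in> UU n" using z ZZ_UU by blast
  define \<alpha> where "\<alpha> = \<psi> (y + z) - ?d"
  have \<alpha>: "\<alpha> \<in> NN n (Suc k)"
  proof -
    have e: "y + z = ?d + \<nu>" by (simp add: \<nu>_def)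
    have "\<alpha> = (\<psi> (y + z) - (y + z) - br \<mu> (y + z)) - (sc (1 / c) (br ?d \<nu>) - \<nu>) + br \<mu> \<nu>"
      unfolding \<alpha>_def using br_commute[of "?d" \<nu>]
      by (simp add: e br_add \<mu>_def br_sc fun_eq_iff)
    moreover have "br \<mu> \<nu> \<in> NN n (Suc k)"
      using br_NN[OF \<mu>N \<nu>N] k NN_mono[of "Suc k" "k + k"] by simp
    ultimately show ?thesis using \<psi>2[of "y + z"] yU zU act[OF \<nu>N] by (simp add: NN_add NN_diff)
  qed
  have "diag_graded G n (\<lambda>g. \<psi> ` A g) (Suc k)"
    unfolding diag_graded_def
  proof (intro ballI)
    fix g x' assume g: "g \<in> carrier G" and "x' \<in> \<psi> ` A g"
    then obtain x1 where x1: "x1 \<in> A g" "x' = \<psi> x1" by blast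
    have x1U: "x1 \<in> UU n" using g x1 A_UU by blast
    have "x' i i = x1 i i" for i
      using NN_zero_entry[OF \<psi>1[OF x1U], of i i] k x1(2) by simp
    then have dgx: "dg n x' = dg n x1" by (simp add: dg_def)
    obtain y1 z1 where y1: "y1 \<in> A g" and z1: "z1 \<in> ZZ n" and N1: "y1 + z1 - dg n x1 \<in> NN n k"
      using dgr x1 g unfolding diag_graded_def by blast
    have y1U: "y1 \<in> UU n" using g y1 A_UU by blast
    have z1U: "z1 \<in> UU n" using z1 ZZ_UU by blast
    define b where "b = \<psi> y1 + \<psi> z1"
    have b: "b = \<psi> (y1 + z1)" using aut_add[OF \<psi> y1U z1U] by (simp add: b_def)
    define \<beta> where "\<beta> = b - dg n x1"
    have "\<beta> = (\<psi> (y1 + z1) - (y1 + z1)) + (y1 + z1 - dg n x1)" by (simp add: \<beta>_def b)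
    then have \<beta>: "\<beta> \<in> NN n k" using \<psi>1[of "y1 + z1"] y1U z1U N1 by (simp only: NN_add)
    have bU: "b \<in> UU n" unfolding b using aut_UU[OF \<psi>] y1U z1U by simp
    \<comment> \<open>Since \<psi> y has degree \<open>\<one>\<close> and agrees with d modulo the
      centre and N_(k+1), and diagonal matrices commute, the subtracted term keeps the degree and
      equals the error \<beta> modulo N_(k+1).\<close>
    define y2 where "y2 = \<psi> y1 - sc (1 / c) (br (\<psi> y) (\<psi> y1))"
    have "y2 = \<psi> (y1 - sc (1 / c) (br y y1))"
      using yU y1U by (simp add: y2_def aut_diff[OF \<psi>] aut_sc[OF \<psi>] aut_br[OF \<psi>])
    moreover have "br y y1 \<in> A g" using A_br[OF _ g y y1] g by simp
    ultimately have y2: "y2 \<in> \<psi> ` A g" using g y1 by (auto intro!: A_diff A_sc)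
    have "\<psi> z \<in> ZZ n" "\<psi> z1 \<in> ZZ n" using aut_ZZ[OF \<psi>] z z1 by auto
    moreover have "\<psi> y \<in> UU n" "\<psi> y1 \<in> UU n" "\<psi> z \<in> UU n" "\<psi> z1 \<in> UU n"
      using aut_UU[OF \<psi>] yU y1U zU z1U by auto
    ultimately have "br (\<psi> y) (\<psi> y1) = br (\<psi> (y + z)) b"
      unfolding b_def aut_add[OF \<psi> yU zU] by (simp add: br_add)
    also have "\<dots> = br (?d + \<alpha>) (dg n x1 + \<beta>)" by (simp add: \<alpha>_def \<beta>_def)
    also have "\<dots> = br ?d \<beta> + br \<alpha> b"
      by (simp add: br_add \<beta>_def br_diff dg_dg)
    finally have e: "br (\<psi> y) (\<psi> y1) = br ?d \<beta> + br \<alpha> b" .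
    have "y2 + \<psi> z1 - dg n x1 = - (sc (1 / c) (br ?d \<beta>) - \<beta>) - sc (1 / c) (br \<alpha> b)"
      unfolding y2_def e by (simp add: \<beta>_def b_def sc_add fun_eq_iff)
    also have "\<dots> \<in> NN n (Suc k)"
    proof (rule NN_diff)
      show "- (sc (1 / c) (br ?d \<beta>) - \<beta>) \<in> NN n (Suc k)" using act[OF \<beta>] by (rule NN_uminus)
      show "sc (1 / c) (br \<alpha> b) \<in> NN n (Suc k)" using br_NN[OF \<alpha> bU] by (intro NN_sc) simp
    qed
    finally show "\<exists>y\<in>\<psi> ` A g. \<exists>z\<in>ZZ n. y + z - dg n x' \<in> NN n (Suc k)"
      unfolding dgx using y2 \<open>\<psi> z1 \<in> ZZ n\<close> by blast
  qed
  with \<psi> show ?thesis by blast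
qed

end

text \<open>The conjugations of successive depths are composed. The start is free: an element minus
  its diagonal part is strictly upper triangular.\<close>

theorem (in tri_grading) diag_graded_exists:
  "\<exists>\<psi>. aut n \<psi> \<and> diag_graded G n (\<lambda>g. \<psi> ` A g) n"
proof -
  have "\<exists>\<psi>. aut n \<psi> \<and> diag_graded G n (\<lambda>g. \<psi> ` A g) (Suc k)" for k
  proof (induction k)
    case 0
    have "diag_graded G n (\<lambda>g. (\<lambda>x. x) ` A g) (Suc 0)"
      unfolding diag_graded_def
    proof (intro ballI)
      fix g x assume "g \<in> carrier G" "x \<in> (\<lambda>x. x) ` A g"
      then have "x \<in> UU n" "x \<in> A g" using A_UU by auto
      then have "x + 0 - dg n x \<in> NN n (Suc 0)"
        by (intro NN_SucI) (auto simp: dg_def)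
      then show "\<exists>y\<in>(\<lambda>x. x) ` A g. \<exists>z\<in>ZZ n. y + z - dg n x \<in> NN n (Suc 0)"
        using \<open>x \<in> A g\<close> by (intro bexI[of _ x] bexI[of _ 0]) auto
    qed
    then show ?case using aut_id by blast
  next
    case (Suc k)
    then obtain \<psi> where \<psi>: "aut n \<psi>" "diag_graded G n (\<lambda>g. \<psi> ` A g) (Suc k)" by blast
    interpret B: tri_grading G n "\<lambda>g. \<psi> ` A g" by (rule image_grading[OF \<psi>(1)])
    obtain \<phi> where \<phi>: "aut n \<phi>" "diag_graded G n (\<lambda>g. \<phi> ` \<psi> ` A g) (Suc (Suc k))"
      using B.diag_graded_step[OF \<psi>(2)] by auto
    then have "diag_graded G n (\<lambda>g. (\<lambda>x. \<phi> (\<psi> x)) ` A g) (Suc (Suc k))" by (simp add: image_image)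
    then show ?case using aut_comp[OF \<phi>(1) \<psi>(1)] by (intro exI[of _ "\<lambda>x. \<phi> (\<psi> x)"]) simp
  qed
  then obtain \<psi> where \<psi>: "aut n \<psi>" "diag_graded G n (\<lambda>g. \<psi> ` A g) (Suc n)" by blast
  moreover have "diag_graded G n B n" if "diag_graded G n B (Suc n)" for B :: "'g \<Rightarrow> 'f tm set"
    using that NN_mono[of n "Suc n"] unfolding diag_graded_def by (meson le_SucI order_refl)
  ultimately show ?thesis by blast
qed

section \<open>Words and bracketings\<close>

datatype 'a bt = Leaf 'a | Node "'a bt" "'a bt"

text \<open>\<open>matches T w\<close>: the bracket monomial \<open>T\<close> does not vanish on consecutive simple root vectors whose
  labels are the letters of \<open>w\<close>, i.e. at every node the two subtrees occupy adjacent intervals.\<close>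

inductive matches :: "'a bt \<Rightarrow> 'a list \<Rightarrow> bool" where
  matches_Leaf: "matches (Leaf a) [a]"
| matches_Node1: "matches l u \<Longrightarrow> matches r v \<Longrightarrow> matches (Node l r) (u @ v)"
| matches_Node2: "matches l u \<Longrightarrow> matches r v \<Longrightarrow> matches (Node l r) (v @ u)"

lemma matches_Leaf_iff: "matches (Leaf a) w \<longleftrightarrow> w = [a]"
  by (subst matches.simps) auto

lemma matches_Node_iff:
  "matches (Node l r) w \<longleftrightarrow> (\<exists>u v. matches l u \<and> matches r v \<and> (w = u @ v \<or> w = v @ u))"
  by (subst matches.simps) auto

lemma matches_rev: "matches T w \<Longrightarrow> matches T (rev w)"
  by (induction rule: matches.induct) (auto intro: matches.intros)

lemma matches_rev_iff [simp]: "matches T (rev w) \<longleftrightarrow> matches T w"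
  using matches_rev[of T w] matches_rev[of T "rev w"] by auto

lemma matches_set: "matches T w \<Longrightarrow> set w = set_bt T"
  by (induction rule: matches.induct) auto

fun leaves :: "'a bt \<Rightarrow> nat" where
  "leaves (Leaf a) = 1"
| "leaves (Node l r) = leaves l + leaves r"

lemma matches_leaves: "matches T w \<Longrightarrow> length w = leaves T"
  by (induction rule: matches.induct) auto

lemma matches_length: "matches T w \<Longrightarrow> matches T v \<Longrightarrow> length w = length v"
  by (simp add: matches_leaves)

lemma matches_nonempty: "matches T w \<Longrightarrow> w \<noteq> []"
  by (induction rule: matches.induct) auto

fun comb :: "'a list \<Rightarrow> 'a bt" where
  "comb [] = undefined"
| "comb [a] = Leaf a"
| "comb (a # b # w) = Node (Leaf a) (comb (b # w))"

lemma matches_comb: "w \<noteq> [] \<Longrightarrow> matches (comb w) w"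
proof (induction w rule: comb.induct)
  case (3 a b w)
  then show ?case using matches_Node1[OF matches_Leaf[of a], of "comb (b # w)" "b # w"] by simp
qed (auto intro: matches.intros)

lemma matches_comb_replicate:
  assumes "j > 0" shows "matches (comb (replicate j a)) w \<longleftrightarrow> w = replicate j a"
proof
  assume m: "matches (comb (replicate j a)) w"
  have m': "matches (comb (replicate j a)) (replicate j a)" using assms by (intro matches_comb) auto
  have "length w = j" using matches_length[OF m m'] by simp
  moreover have "set w = {a}" using matches_set[OF m] matches_set[OF m'] assms by simp
  ultimately show "w = replicate j a" by (metis replicate_length_same singletonD)
qed (use assms in \<open>auto intro: matches_comb\<close>)

section \<open>Words are determined up to reversal by the trees that match them\<close>

definition same_bt :: "'a list \<Rightarrow> 'a list \<Rightarrow> bool" where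
  "same_bt u v \<longleftrightarrow> (\<forall>T. matches T u \<longleftrightarrow> matches T v)"

lemma same_bt_rev [simp]: "same_bt (rev u) v \<longleftrightarrow> same_bt u v" "same_bt u (rev v) \<longleftrightarrow> same_bt u v"
  by (auto simp: same_bt_def)

lemma same_bt_sym: "same_bt u v \<Longrightarrow> same_bt v u"
  by (auto simp: same_bt_def)

lemma same_bt_length: assumes "same_bt u v" shows "length u = length v"
proof (cases "u = []")
  case True
  then show ?thesis using assms matches_comb[of v] matches_nonempty unfolding same_bt_def by blast
next
  case False
  then show ?thesis using assms matches_comb[of u] matches_length unfolding same_bt_def by metis
qed

text \<open>A word that commutes with a two-letter word a b is a power of a b, or consists of one
  letter if a = b.\<close>

lemma commute_pair: "[a, b] @ z = z @ [a, b] \<Longrightarrow> rev z @ [b] = b # z"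
proof (induction z rule: length_induct)
  case (1 z)
  show ?case
  proof (cases z)
    case (Cons c z1)
    show ?thesis
    proof (cases z1)
      case Nil
      have "[a, b] @ [c] = [c] @ [a, b]" using 1(2) unfolding Cons Nil .
      then have "c = b" by (metis append_Cons append_Nil list.inject)
      then show ?thesis unfolding Cons Nil by simp
    next
      case (Cons d z2)
      with 1(2) \<open>z = c # z1\<close> have e: "z = a # b # z2" "[a, b] @ z2 = z2 @ [a, b]" by auto
      then have IH: "rev z2 @ [b] = b # z2" using 1(1) by auto
      have "rev z @ [b] = (rev z2 @ [b]) @ [a, b]" by (simp add: e)
      also have "\<dots> = b # z" unfolding IH using e by simp
      finally show ?thesis .
    qed
  qed simp
qed

text \<open>If x is nonempty, it is b followed by some x1, and y is x1 followed by a; the first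
  equation then says that x1 commutes with the word a b.\<close>

lemma alternating_palindrome:
  assumes "a # x = y @ [b]" "x @ [a] = b # y" shows "rev x = x"
proof (cases x)
  case (Cons c x1)
  with assms(2) have "c = b" "y = x1 @ [a]" by auto
  with assms(1) Cons have "[a, b] @ x1 = x1 @ [a, b]" by simp
  from commute_pair[OF this] show ?thesis using Cons \<open>c = b\<close> by simp
qed simp

lemma matches_Node_Leaf:
  "matches (Node (Leaf c) T) w \<longleftrightarrow> (\<exists>v. matches T v \<and> (w = c # v \<or> w = v @ [c]))"
  by (auto simp: matches_Node_iff matches_Leaf_iff)

text \<open>A single leaf at the root can split off only an end letter, and any remaining nonempty
  word is matched by a comb. So the set of end letters is visible to trees.\<close>

lemma ends_iff:
  assumes "length w \<ge> 2" shows "(\<exists>T. matches (Node (Leaf c) T) w) \<longleftrightarrow> c = hd w \<or> c = last w"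
proof
  assume "c = hd w \<or> c = last w"
  then show "\<exists>T. matches (Node (Leaf c) T) w"
  proof
    assume "c = hd w"
    then have "w = c # tl w" "tl w \<noteq> []" using assms by (cases w; auto)+
    then show ?thesis using matches_comb[of "tl w"] unfolding matches_Node_Leaf by metis
  next
    assume "c = last w"
    then have "w = butlast w @ [c]" "butlast w \<noteq> []" using assms by (cases w rule: rev_cases; auto)+
    then show ?thesis using matches_comb[of "butlast w"] unfolding matches_Node_Leaf by metis
  qed
qed (auto simp: matches_Node_Leaf)

text \<open>As the end letters differ, a leaf with one of them can be split off at one end only.
  Trees thus see both words of length one less, each up to reversal by induction; if both get
  reversed, they are alternating words and hence palindromes.\<close>

lemma same_bt_ends_differ:
  fixes \<eta> \<mu> :: "'a list"
  assumes IH: "\<And>u v :: 'a list. length u < length \<eta> \<Longrightarrow> same_bt u v \<Longrightarrow> v = u \<or> v = rev u"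
    and s: "same_bt \<eta> \<mu>" and ne: "hd \<eta> \<noteq> last \<eta>" and hd: "hd \<mu> = hd \<eta>" "last \<mu> = last \<eta>"
    and l: "length \<eta> \<ge> 2"
  shows "\<mu> = \<eta> \<or> \<mu> = rev \<eta>"
proof -
  define a b where "a = hd \<eta>" and "b = last \<eta>"
  have len: "length \<mu> \<ge> 2" using l same_bt_length[OF s] by simp
  define x y x' y' where "x = tl \<eta>" and "y = butlast \<eta>" and "x' = tl \<mu>" and "y' = butlast \<mu>"
  have e: "\<eta> = a # x" "\<eta> = y @ [b]" "\<mu> = a # x'" "\<mu> = y' @ [b]"
  proof -
    have "\<eta> \<noteq> []" "\<mu> \<noteq> []" using l len by auto
    then show "\<eta> = a # x" "\<eta> = y @ [b]" "\<mu> = a # x'" "\<mu> = y' @ [b]"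
      using hd append_butlast_last_id[of \<mu>] list.collapse[of \<mu>] by (auto simp: a_def b_def x_def y_def x'_def y'_def)
  qed
  have ab: "a \<noteq> b" using ne by (simp add: a_def b_def)
  have "matches T x \<longleftrightarrow> matches (Node (Leaf a) T) \<eta>" for T
    unfolding matches_Node_Leaf using e ab by auto
  moreover have "matches T x' \<longleftrightarrow> matches (Node (Leaf a) T) \<mu>" for T
    unfolding matches_Node_Leaf using e ab by auto
  ultimately have "same_bt x x'" using s by (simp add: same_bt_def)
  moreover have "length x < length \<eta>" by (simp add: e(1))
  ultimately have x: "x' = x \<or> x' = rev x" by (metis IH)
  have "matches T y \<longleftrightarrow> matches (Node (Leaf b) T) \<eta>" for T
    unfolding matches_Node_Leaf using e ab by auto
  moreover have "matches T y' \<longleftrightarrow> matches (Node (Leaf b) T) \<mu>" for T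
    unfolding matches_Node_Leaf using e ab by auto
  ultimately have "same_bt y y'" using s by (simp add: same_bt_def)
  moreover have "length y < length \<eta>" by (simp add: e(2))
  ultimately have y: "y' = y \<or> y' = rev y" by (metis IH)
  show ?thesis
  proof (cases "x' = x \<or> y' = y")
    case True then show ?thesis using e by auto
  next
    case False
    then have "x' = rev x" "y' = rev y" using x y by auto
    then have "a # rev x = rev y @ [b]" using e by simp
    then have "rev (a # rev x) = rev (rev y @ [b])" by (rule arg_cong)
    then have "x @ [a] = b # y" by simp
    then have "rev x = x" using e(1,2) alternating_palindrome[of a x y b] by simp
    then show ?thesis using \<open>x' = rev x\<close> e by simp
  qed
qed

lemma matches_Node_replicate:
  assumes "j > 0"
  shows "matches (Node (comb (replicate j a)) T) w \<longleftrightarrow>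
    (\<exists>v. matches T v \<and> (w = replicate j a @ v \<or> w = v @ replicate j a))"
  by (auto simp: matches_Node_iff matches_comb_replicate[OF assms])

lemma replicate_prefix_bound:
  assumes "replicate r a @ w @ t = replicate j a @ v" "w \<noteq> []" "hd w \<noteq> a" shows "j \<le> r"
proof (rule ccontr)
  assume "\<not> j \<le> r"
  then have r: "r < j" by simp
  have "(replicate r a @ w @ t) ! r = hd w" using assms(2) by (cases w) (auto simp: nth_append)
  moreover have "(replicate j a @ v) ! r = a" using r by (auto simp: nth_append)
  ultimately show False using assms by simp
qed

lemma replicate_suffix_bound:
  assumes "t @ w @ replicate r a = v @ replicate j a" "w \<noteq> []" "last w \<noteq> a" shows "j \<le> r"
proof -
  have "rev (t @ w @ replicate r a) = rev (v @ replicate j a)" using assms(1) by (rule arg_cong)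
  then have "replicate r a @ rev w @ rev t = replicate j a @ rev v" by simp
  then show ?thesis by (rule replicate_prefix_bound) (use assms in \<open>auto simp: hd_rev\<close>)
qed

text \<open>With equal ends a single letter could be split off at either end, so a whole run is
  removed instead: the comb of m letters a fits only at an end that begins with a run of length m.
  This m is an invariant, and so is whether the other end run has the same length.\<close>

lemma same_bt_runs:
  fixes \<eta> \<mu> :: "'a list"
  assumes IH: "\<And>u v :: 'a list. length u < length \<eta> \<Longrightarrow> same_bt u v \<Longrightarrow> v = u \<or> v = rev u"
    and s: "same_bt \<eta> \<mu>"
    and \<eta>: "\<eta> = replicate r a @ w @ replicate m a" "w \<noteq> []" "hd w \<noteq> a" "last w \<noteq> a" "0 < r" "r \<le> m"
    and \<mu>: "\<mu> = replicate r' a @ w' @ replicate m' a" "w' \<noteq> []" "hd w' \<noteq> a" "last w' \<noteq> a" "0 < r'" "r' \<le> m'"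
  shows "\<mu> = \<eta> \<or> \<mu> = rev \<eta>"
proof -
  have bound: "j \<le> m1"
    if b: "W = replicate r1 a @ w1 @ replicate m1 a" "w1 \<noteq> []" "hd w1 \<noteq> a" "last w1 \<noteq> a" "r1 \<le> m1"
      "matches (Node (comb (replicate j a)) T) W" for W r1 w1 m1 j T
  proof (cases "j > 0")
    case True
    obtain v where "W = replicate j a @ v \<or> W = v @ replicate j a"
      using b(6) unfolding matches_Node_replicate[OF True] by auto
    then show ?thesis
      using replicate_prefix_bound[of r1 a w1 "replicate m1 a" j v]
        replicate_suffix_bound[of "replicate r1 a" w1 m1 a v j] that by auto
  qed simp
  have ex: "matches (Node (comb (replicate m1 a)) (comb (replicate r1 a @ w1))) (replicate r1 a @ w1 @ replicate m1 a)"
    if "w1 \<noteq> []" "m1 > 0" for r1 w1 m1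
    unfolding matches_Node_replicate[OF that(2)] using that matches_comb[of "replicate r1 a @ w1"] by auto
  have m: "0 < m" "0 < m'" using \<eta> \<mu> by auto
  have "m \<le> m'" using bound[OF \<mu>(1-4,6)] ex[OF \<eta>(2) m(1), of r] s \<eta>(1) unfolding same_bt_def by blast
  moreover have "m' \<le> m" using bound[OF \<eta>(1-4,6)] ex[OF \<mu>(2) m(2), of r'] s \<mu>(1) unfolding same_bt_def by blast
  ultimately have mm: "m' = m" by simp
  have short: "matches (Node (comb (replicate m a)) T) (replicate r1 a @ w1 @ replicate m a) \<longleftrightarrow> matches T (replicate r1 a @ w1)"
    if "w1 \<noteq> []" "hd w1 \<noteq> a" "r1 < m" for r1 w1 T
  proof
    assume "matches (Node (comb (replicate m a)) T) (replicate r1 a @ w1 @ replicate m a)"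
    then obtain v where v: "matches T v" "replicate r1 a @ w1 @ replicate m a = replicate m a @ v \<or>
        replicate r1 a @ w1 @ replicate m a = v @ replicate m a"
      unfolding matches_Node_replicate[OF m(1)] by blast
    then have "replicate r1 a @ w1 @ replicate m a = v @ replicate m a"
      using replicate_prefix_bound[of r1 a w1 "replicate m a" m v] that by auto
    then have "v = replicate r1 a @ w1" by (metis append.assoc append_same_eq)
    then show "matches T (replicate r1 a @ w1)" using v by simp
  next
    assume "matches T (replicate r1 a @ w1)"
    then show "matches (Node (comb (replicate m a)) T) (replicate r1 a @ w1 @ replicate m a)"
      unfolding matches_Node_replicate[OF m(1)] by (metis append.assoc)
  qed
  have long: "matches (Node (comb (replicate m a)) (Node (comb (replicate m a)) T)) (replicate m a @ w1 @ replicate m a) \<longleftrightarrow> matches T w1"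
    if "w1 \<noteq> []" "hd w1 \<noteq> a" "last w1 \<noteq> a" for w1 T
  proof
    assume "matches (Node (comb (replicate m a)) (Node (comb (replicate m a)) T)) (replicate m a @ w1 @ replicate m a)"
    then obtain v u where v: "replicate m a @ w1 @ replicate m a = replicate m a @ v \<or>
        replicate m a @ w1 @ replicate m a = v @ replicate m a"
      and u: "matches T u" "v = replicate m a @ u \<or> v = u @ replicate m a"
      unfolding matches_Node_replicate[OF m(1)] by blast
    from v have "v = w1 @ replicate m a \<or> v = replicate m a @ w1"
      by (metis append.assoc append_same_eq same_append_eq)
    then have "u = w1"
    proof
      assume "v = w1 @ replicate m a"
      then show ?thesis using u(2) replicate_prefix_bound[of 0 a w1 "replicate m a" m u] that m by auto
    next
      assume "v = replicate m a @ w1"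
      then show ?thesis using u(2) replicate_suffix_bound[of "replicate m a" w1 0 a u m] that m by auto
    qed
    then show "matches T w1" using u by simp
  next
    assume "matches T w1"
    then have "matches (Node (comb (replicate m a)) T) (w1 @ replicate m a)"
      unfolding matches_Node_replicate[OF m(1)] by blast
    then show "matches (Node (comb (replicate m a)) (Node (comb (replicate m a)) T)) (replicate m a @ w1 @ replicate m a)"
      unfolding matches_Node_replicate[OF m(1), of _ "Node _ _"] by blast
  qed
  \<comment> \<open>A run of length m can be removed twice from a word with two end runs of length
    m, but only once if the other end run is shorter.\<close>
  have mixed: False
    if "w1 \<noteq> []" "hd w1 \<noteq> a" "last w1 \<noteq> a" "r1 < m" "w2 \<noteq> []" "hd w2 \<noteq> a" "last w2 \<noteq> a"
      "same_bt (replicate r1 a @ w1 @ replicate m a) (replicate m a @ w2 @ replicate m a)" for r1 w1 w2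
  proof -
    let ?c = "comb (replicate m a)"
    have "matches (Node ?c (Node ?c (comb w2))) (replicate m a @ w2 @ replicate m a)"
      using long[OF that(5-7)] matches_comb[OF that(5)] by simp
    then have "matches (Node ?c (Node ?c (comb w2))) (replicate r1 a @ w1 @ replicate m a)"
      using that(8) by (simp add: same_bt_def)
    then have "matches (Node ?c (comb w2)) (replicate r1 a @ w1)"
      using short[OF that(1,2,4)] by simp
    then obtain v where "replicate r1 a @ w1 = replicate m a @ v \<or> replicate r1 a @ w1 = v @ replicate m a"
      unfolding matches_Node_replicate[OF m(1)] by blast
    then show False
      using replicate_prefix_bound[of r1 a w1 "[]" m v] replicate_suffix_bound[of "replicate r1 a" w1 0 a v m]
        that m by auto
  qed
  have \<mu>': "\<mu> = replicate r' a @ w' @ replicate m a" using \<mu>(1) mm by simp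
  consider "r < m" "r' < m" | "r < m" "r' = m" | "r = m" "r' < m" | "r = m" "r' = m"
    using \<eta>(6) \<mu>(6) mm by linarith
  then show ?thesis
  proof cases
    case 1
    have "same_bt (replicate r a @ w) (replicate r' a @ w')"
      using s short[OF \<eta>(2,3) 1(1)] short[OF \<mu>(2,3) 1(2)] unfolding same_bt_def \<eta>(1) \<mu>' by blast
    moreover have "length (replicate r a @ w) < length \<eta>" using m by (simp add: \<eta>(1))
    ultimately have "replicate r' a @ w' = replicate r a @ w \<or> replicate r' a @ w' = rev (replicate r a @ w)"
      by (metis IH)
    moreover have "hd (replicate r' a @ w') = a" using \<mu>(5) by (cases r') auto
    moreover have "hd (rev (replicate r a @ w)) \<noteq> a" using \<eta>(2,4) by (simp add: hd_rev)
    ultimately have "replicate r' a @ w' = replicate r a @ w" by metis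
    then show ?thesis unfolding \<eta>(1) \<mu>' by (metis append.assoc)
  next
    case 2
    then show ?thesis using mixed[OF \<eta>(2-4) 2(1) \<mu>(2-4)] s \<eta>(1) \<mu>' by auto
  next
    case 3
    then show ?thesis using mixed[OF \<mu>(2-4) 3(2) \<eta>(2-4)] same_bt_sym[OF s] \<eta>(1) \<mu>' by auto
  next
    case 4
    have "same_bt w w'"
      using s long[OF \<eta>(2-4)] long[OF \<mu>(2-4)] 4 unfolding same_bt_def \<eta>(1) \<mu>' by metis
    moreover have "length w < length \<eta>" using m by (simp add: \<eta>(1))
    ultimately have "w' = w \<or> w' = rev w" by (metis IH)
    then show ?thesis unfolding \<eta>(1) \<mu>' using 4 by auto
  qed
qed

lemma run_decomposition:
  assumes "\<not> set w \<subseteq> {a}"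
  shows "\<exists>r v m. w = replicate r a @ v @ replicate m a \<and> v \<noteq> [] \<and> hd v \<noteq> a \<and> last v \<noteq> a"
  using assms
proof (induction w rule: length_induct)
  case (1 w)
  then have ne: "w \<noteq> []" by auto
  show ?case
  proof (cases "hd w = a")
    case True
    then obtain w1 where w1: "w = a # w1" using ne by (cases w) auto
    then have "length w1 < length w" "\<not> set w1 \<subseteq> {a}" using 1(2) by auto
    then obtain r v m where "w1 = replicate r a @ v @ replicate m a" "v \<noteq> []" "hd v \<noteq> a" "last v \<noteq> a"
      using 1(1) by blast
    then show ?thesis using w1 by (intro exI[of _ "Suc r"] exI[of _ v] exI[of _ m]) auto
  next
    case False
    show ?thesis
    proof (cases "last w = a")
      case True
      then obtain w1 where w1: "w = w1 @ [a]" using ne by (cases w rule: rev_cases) auto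
      then have "length w1 < length w" "\<not> set w1 \<subseteq> {a}" using 1(2) by auto
      then obtain r v m where "w1 = replicate r a @ v @ replicate m a" "v \<noteq> []" "hd v \<noteq> a" "last v \<noteq> a"
        using 1(1) by blast
      then show ?thesis using w1
        by (intro exI[of _ r] exI[of _ v] exI[of _ "Suc m"]) (auto simp: replicate_append_same)
    next
      case False
      with \<open>hd w \<noteq> a\<close> ne show ?thesis by (intro exI[of _ 0] exI[of _ w]) auto
    qed
  qed
qed

text \<open>Strong induction on the length. If the ends agree, both words are first reversed if
  necessary so that the longer end run is on the right.\<close>

theorem same_bt_imp_eq_or_rev: "same_bt \<eta> \<mu> \<Longrightarrow> \<mu> = \<eta> \<or> \<mu> = rev \<eta>"
proof (induction "length \<eta>" arbitrary: \<eta> \<mu> rule: less_induct)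
  case less
  note IH = less.hyps[OF _ ]
  note s = less.prems
  have len: "length \<mu> = length \<eta>" using same_bt_length[OF s] by simp
  show ?case
  proof (cases "length \<eta> \<ge> 2")
    case False
    then consider "\<eta> = []" | c where "\<eta> = [c]" by (cases \<eta>; cases "tl \<eta>") auto
    then show ?thesis
    proof cases
      case (2 c)
      then show ?thesis using s matches_Leaf_iff unfolding same_bt_def by metis
    qed (use len in simp)
  next
    case True
    then have T': "length \<mu> \<ge> 2" using len by simp
    have ends: "c = hd \<mu> \<or> c = last \<mu> \<longleftrightarrow> c = hd \<eta> \<or> c = last \<eta>" for c
    proof -
      have "(\<exists>T. matches (Node (Leaf c) T) \<mu>) \<longleftrightarrow> (\<exists>T. matches (Node (Leaf c) T) \<eta>)"
        using s by (simp add: same_bt_def)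
      then show ?thesis by (simp only: ends_iff[OF True] ends_iff[OF T'])
    qed
    have ne: "\<eta> \<noteq> []" "\<mu> \<noteq> []" using True T' by auto
    show ?thesis
    proof (cases "hd \<eta> = last \<eta>")
      case False
      then consider "hd \<mu> = hd \<eta>" "last \<mu> = last \<eta>" | "hd \<mu> = last \<eta>" "last \<mu> = hd \<eta>"
        using ends by metis
      then show ?thesis
      proof cases
        case 1
        show ?thesis by (rule same_bt_ends_differ[OF IH s False 1 True])
      next
        case 2
        have "rev \<mu> = \<eta> \<or> rev \<mu> = rev \<eta>"
          by (rule same_bt_ends_differ[OF IH _ False _ _ True]) (use s 2 ne in \<open>auto simp: hd_rev last_rev\<close>)
        then show ?thesis by auto
      qed
    next
      case hl: True
      define a where "a = hd \<eta>"
      have a: "hd \<eta> = a" "last \<eta> = a" "hd \<mu> = a" "last \<mu> = a" using hl ends a_def by metis+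
      show ?thesis
      proof (cases "set \<eta> \<subseteq> {a}")
        case True
        have "set \<mu> = set \<eta>"
          using s matches_comb[OF ne(1)] matches_set unfolding same_bt_def by metis
        then have "\<eta> = replicate (length \<eta>) a" "\<mu> = replicate (length \<eta>) a"
          using True len by (auto intro!: replicate_eqI simp: subset_iff)
        then show ?thesis by simp
      next
        case False
        have "set \<mu> = set \<eta>"
          using s matches_comb[OF ne(1)] matches_set unfolding same_bt_def by metis
        then have False': "\<not> set \<mu> \<subseteq> {a}" using False by simp
        have norm: "\<exists>x r v m. (x = y \<or> x = rev y) \<and> x = replicate r a @ v @ replicate m a \<and> v \<noteq> [] \<and>
            hd v \<noteq> a \<and> last v \<noteq> a \<and> 0 < r \<and> r \<le> m"
          if y: "\<not> set y \<subseteq> {a}" "hd y = a" "last y = a" for y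
        proof -
          obtain r v m where v: "y = replicate r a @ v @ replicate m a" "v \<noteq> []" "hd v \<noteq> a" "last v \<noteq> a"
            using run_decomposition[OF y(1)] by blast
          have "r > 0" "m > 0" using v y(2,3) by (auto intro!: Nat.gr0I simp: last_append split: if_splits)
          show ?thesis
          proof (cases "r \<le> m")
            case True then show ?thesis using v \<open>r > 0\<close> by blast
          next
            case False
            have "rev y = replicate m a @ rev v @ replicate r a" using v by simp
            then show ?thesis using False v \<open>m > 0\<close>
              by (intro exI[of _ "rev y"] exI[of _ m] exI[of _ "rev v"] exI[of _ r]) (auto simp: hd_rev last_rev)
          qed
        qed
        obtain x r v m where x: "x = \<eta> \<or> x = rev \<eta>" "x = replicate r a @ v @ replicate m a" "v \<noteq> []"
            "hd v \<noteq> a" "last v \<noteq> a" "0 < r" "r \<le> m" using norm[OF False a(1,2)] by blast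
        obtain x' r' v' m' where x': "x' = \<mu> \<or> x' = rev \<mu>" "x' = replicate r' a @ v' @ replicate m' a" "v' \<noteq> []"
            "hd v' \<noteq> a" "last v' \<noteq> a" "0 < r'" "r' \<le> m'" using norm[OF False' a(3,4)] by blast
        have sx: "same_bt x x'" using s x(1) x'(1) by auto
        have lx: "length x = length \<eta>" using x(1) by auto
        have "x' = x \<or> x' = rev x"
          by (rule same_bt_runs[OF IH sx x(2-7) x'(2-7)]) (auto simp: lx)
        then show ?thesis using x(1) x'(1) by auto
      qed
    qed
  qed
qed

section \<open>Values of bracket monomials\<close>

text \<open>Values, not their span; the leaves are chosen independently even if they carry the same
  degree, as in a multilinear monomial with distinct variables.\<close>

fun val :: "('g \<Rightarrow> 'f::field tm set) \<Rightarrow> 'g bt \<Rightarrow> 'f tm set" where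
  "val B (Leaf g) = B g"
| "val B (Node l r) = {br x y |x y. x \<in> val B l \<and> y \<in> val B r}"

definition nonvanishing :: "('g \<Rightarrow> 'f::field tm set) \<Rightarrow> 'g bt \<Rightarrow> bool" where
  "nonvanishing B T \<longleftrightarrow> (\<exists>v\<in>val B T. v \<noteq> 0)"

text \<open>Leaves are excluded: a component may be nonzero and yet central, which is invisible in
  the quotient.\<close>

definition same_monomials :: "('g, 'm) monoid_scheme \<Rightarrow> ('g \<Rightarrow> 'f::field tm set) \<Rightarrow> ('g \<Rightarrow> 'f tm set) \<Rightarrow> bool" where
  "same_monomials G A B \<longleftrightarrow> (\<forall>l r. set_bt l \<subseteq> carrier G \<longrightarrow> set_bt r \<subseteq> carrier G \<longrightarrow>
     nonvanishing A (Node l r) = nonvanishing B (Node l r))"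

text \<open>The bracket in the leaf guarantees that its values are strictly upper triangular.\<close>

fun bracket_leaves :: "'g \<Rightarrow> 'g bt \<Rightarrow> 'g bt" where
  "bracket_leaves e (Leaf g) = Node (Leaf e) (Leaf g)"
| "bracket_leaves e (Node l r) = Node (bracket_leaves e l) (bracket_leaves e r)"

lemma set_bracket_leaves: "set_bt (bracket_leaves e T) = insert e (set_bt T)"
  by (induction T) auto

lemma bracket_leaves_Node: "\<exists>l r. bracket_leaves e T = Node l r"
  by (cases T) auto

text \<open>An element of a coarse component is a sum of elements of finer ones, so brackets of such
  elements expand into sums of values of trees with leaves changed along R. A nonzero sum has a
  nonzero term.\<close>

inductive_set val_span :: "('g \<Rightarrow> 'g \<Rightarrow> bool) \<Rightarrow> ('g \<Rightarrow> 'f::field tm set) \<Rightarrow> 'g bt \<Rightarrow> 'f tm set"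
  for R B T where
  val_span_base: "rel_bt R T T' \<Longrightarrow> w \<in> val B T' \<Longrightarrow> w \<in> val_span R B T"
| val_span_add: "v \<in> val_span R B T \<Longrightarrow> w \<in> val_span R B T \<Longrightarrow> v + w \<in> val_span R B T"

lemma val_span_br:
  assumes "x \<in> val_span R B l" "y \<in> val_span R B r" shows "br x y \<in> val_span R B (Node l r)"
  using assms(1)
proof induction
  case (val_span_base l' x)
  from assms(2) show ?case
  proof induction
    case (val_span_base r' y)
    show ?case
    proof (rule val_span.val_span_base)
      show "rel_bt R (Node l r) (Node l' r')" using val_span_base \<open>rel_bt R l l'\<close> by simp
      show "br x y \<in> val B (Node l' r')" using val_span_base \<open>x \<in> val B l'\<close> by auto
    qed
  qed (simp only: br_add val_span.val_span_add)
qed (simp only: br_add val_span.val_span_add)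

lemma val_span_nonzero:
  assumes "v \<in> val_span R B T" "v \<noteq> 0" shows "\<exists>T'. rel_bt R T T' \<and> nonvanishing B T'"
  using assms
proof induction
  case (val_span_add v w)
  show ?case
  proof (cases "v = 0")
    case True
    then have "w \<noteq> 0" using val_span_add.prems by simp
    then show ?thesis by (rule val_span_add.IH(2))
  qed (rule val_span_add.IH(1))
qed (auto simp: nonvanishing_def)

lemma val_mono_rel:
  assumes "rel_bt R T T'" "\<And>g h. R g h \<Longrightarrow> B h \<subseteq> C g" shows "val B T' \<subseteq> val C T"
  using assms(1)
proof (induction T T' rule: bt.rel_induct)
  case (Leaf a b) then show ?case using assms(2) by simp
next
  case (Node l r l' r') then show ?case by auto
qed

section \<open>Gradings with homogeneous diagonal\<close>

lemma dg_sum: "dg n (sum f S) = (\<Sum>s\<in>S. dg n (f s))" for f :: "'s \<Rightarrow> 'f::field tm"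
proof (rule tm_eqI)
  fix i j
  have "(if c then sum h S else 0) = (\<Sum>s\<in>S. if c then h s else 0)" for c and h :: "'s \<Rightarrow> 'f" by simp
  then show "dg n (sum f S) i j = (\<Sum>s\<in>S. dg n (f s)) i j"
    unfolding dg_def sum_fun_apply2 diag_apply by blast
qed

definition unit_diag :: "nat \<Rightarrow> nat \<Rightarrow> 'f::field tm" where
  "unit_diag n k = diag n (\<lambda>l. if l = k then 1 else 0)"

lemma unit_diag_UU [simp]: "unit_diag n k \<in> UU n" by (simp add: unit_diag_def)

text \<open>The iterated bracket multiplies the entry at (a, b) by the differences of the indicators
  of i and of j, a product that is nonzero only if a and b are i and j in some order.\<close>

lemma unit_diag_br_br:
  assumes x: "x \<in> UU n" and ij: "i < j"
  shows "br (unit_diag n i) (br (unit_diag n j) x) = - sc (x i j) (ee i j)"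
    and "br (unit_diag n j) (br (unit_diag n i) x) = - sc (x i j) (ee i j)"
proof -
  have e: "br (unit_diag n k) (br (unit_diag n l) x) a b
      = ((if a = k then 1 else 0) - (if b = k then 1 else 0)) *
        (((if a = l then 1 else 0) - (if b = l then 1 else 0)) * x a b)" for k l a b
  proof -
    have "br (unit_diag n l) x \<in> UU n" using x by simp
    from diag_br[OF this, of "\<lambda>l. if l = k then 1 else 0"] diag_br[OF x, of "\<lambda>m. if m = l then 1 else 0"]
    show ?thesis unfolding unit_diag_def by simp
  qed
  have "x a b = 0" if "\<not> a \<le> b" for a b using NN_zero_entry[OF x, of a b] that by simp
  then show "br (unit_diag n i) (br (unit_diag n j) x) = - sc (x i j) (ee i j)"
    "br (unit_diag n j) (br (unit_diag n i) x) = - sc (x i j) (ee i j)"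
    using ij by (auto intro!: tm_eqI simp: e ee_def)
qed

section \<open>Homogeneity modulo the centre\<close>

context tri_grading
begin

text \<open>The coset of x in the quotient by the centre has degree g. Scalar matrices satisfy this
  for every g in \<open>carrier G\<close>.\<close>

definition hz :: "'g \<Rightarrow> 'f tm \<Rightarrow> bool" where
  "hz g x \<longleftrightarrow> (\<exists>z\<in>ZZ n. x + z \<in> A g)"

lemma hz_A: "x \<in> A g \<Longrightarrow> hz g x"
  unfolding hz_def by (intro bexI[of _ 0]) auto

lemma hz_ZZ: "hz g x \<Longrightarrow> z \<in> ZZ n \<Longrightarrow> hz g (x + z)"
proof -
  assume "hz g x" and z: "z \<in> ZZ n"
  then obtain w where w: "w \<in> ZZ n" "x + w \<in> A g" by (auto simp: hz_def)
  have "(x + z) + (w - z) = x + w" by (simp only: algebra_simps)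
  then show "hz g (x + z)" using w ZZ_diff[OF w(1) z] unfolding hz_def by metis
qed

lemma hz_UU: assumes "g \<in> carrier G" "hz g x" shows "x \<in> UU n"
proof -
  obtain z where "z \<in> ZZ n" "x + z \<in> A g" using assms(2) by (auto simp: hz_def)
  then have "x + z - z \<in> UU n" using A_UU[OF assms(1)] ZZ_UU by (intro NN_diff) auto
  then show ?thesis by simp
qed

lemma hz_br:
  assumes "g \<in> carrier G" "h \<in> carrier G" "hz g d" "x \<in> A h" shows "br d x \<in> A (g \<otimes> h)"
proof -
  obtain z where z: "z \<in> ZZ n" "d + z \<in> A g" using assms(3) by (auto simp: hz_def)
  have "br (d + z) x = br d x" using z(1) A_UU[OF assms(2,4)] by (simp add: br_add)
  then show ?thesis using A_br[OF assms(1,2) z(2) assms(4)] by simp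
qed

end

locale normal_grading = tri_grading +
  fixes t :: 'a
  assumes type: "grading_type t" and diag: "diag_graded G n A n"
begin

lemma tc [simp]: "t \<in> carrier G" using type by (simp add: grading_type_def)
lemma tt [simp]: "t \<otimes> t = \<one>" using type by (simp add: grading_type_def)
lemma ttg [simp]: "g \<in> carrier G \<Longrightarrow> t \<otimes> (t \<otimes> g) = g" by (simp add: m_assoc[symmetric])

lemma hz_dg: assumes "g \<in> carrier G" "x \<in> A g" shows "hz g (dg n x)"
proof -
  obtain y z where y: "y \<in> A g" and z: "z \<in> ZZ n" and N: "y + z - dg n x \<in> NN n n"
    using diag assms unfolding diag_graded_def by blast
  have "y + z - dg n x = 0" using NN_top[OF N] by simp
  then have "dg n x + - z = y" by (simp add: algebra_simps)
  then show ?thesis using y ZZ_uminus[OF z] unfolding hz_def by metis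
qed

lemma dconst_ZZ: "dconst x \<Longrightarrow> dg n x \<in> ZZ n"
proof -
  assume d: "dconst x"
  have "dg n x = diag n (\<lambda>_. x 0 0)"
    using d unfolding dconst_def dg_def by (intro tm_eqI) auto
  then show ?thesis by (auto simp: ZZ_iff)
qed

text \<open>Components of degree other than \<open>\<one>\<close> and t have scalar diagonals and go
  into z. For \<open>t = \<one>\<close> setting q to 0 avoids counting one component twice.\<close>

lemma diag_split:
  "\<exists>p\<in>A \<one>. \<exists>q\<in>A t. \<exists>z\<in>ZZ n. diag n f = dg n p + dg n q + z \<and> (t = \<one> \<longrightarrow> q = 0)"
proof -
  define u where "u = diag n f"
  have uU: "u \<in> UU n" by (simp add: u_def)
  define r where "r h = dg n (pr h u)" for h
  have rz: "r h \<in> ZZ n" if "h \<in> supp" "h \<noteq> \<one>" "h \<noteq> t" for h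
  proof -
    have "h \<in> carrier G" using that supp_carrier by auto
    then have "dconst (pr h u)" using that type pr_A[OF uU] unfolding grading_type_def by blast
    then show ?thesis unfolding r_def by (rule dconst_ZZ)
  qed
  have r0: "r h = 0" if "h \<notin> supp" for h
    unfolding r_def using pr_not_supp[OF uU that] by (intro tm_eqI) (simp add: dg_def)
  have "u = dg n u" by (intro tm_eqI) (simp add: u_def dg_def)
  also have "\<dots> = (\<Sum>h\<in>supp. r h)" unfolding r_def dg_sum[symmetric] sum_pr[OF uU, symmetric] ..
  also have "\<dots> = (\<Sum>h\<in>supp - {\<one>, t}. r h) + (\<Sum>h\<in>supp \<inter> {\<one>, t}. r h)"
    using sum.Int_Diff[OF finite_supp, of r "{\<one>, t}"] by (simp add: add.commute)
  also have "(\<Sum>h\<in>supp \<inter> {\<one>, t}. r h) = (\<Sum>h\<in>{\<one>, t}. r h)"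
    by (rule sum.mono_neutral_left) (auto simp: r0)
  finally have e: "u = (\<Sum>h\<in>supp - {\<one>, t}. r h) + (\<Sum>h\<in>{\<one>, t}. r h)" .
  have z: "(\<Sum>h\<in>S. r h) \<in> ZZ n" if "finite S" "S \<subseteq> supp - {\<one>, t}" for S
    using that by (induction S rule: finite_induct) (auto simp: rz ZZ_add)
  have z': "(\<Sum>h\<in>supp - {\<one>, t}. r h) \<in> ZZ n" by (rule z) (auto simp: finite_supp)
  have p: "pr \<one> u \<in> A \<one>" "pr t u \<in> A t" using uU by (auto intro!: pr_A)
  show ?thesis
  proof (cases "t = \<one>")
    case True
    have "u = dg n (pr \<one> u) + dg n 0 + (\<Sum>h\<in>supp - {\<one>, t}. r h)"
      by (subst e, intro tm_eqI) (simp add: True r_def dg_def)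
    then show ?thesis using p(1) z' True unfolding u_def[symmetric] by (metis A_0 tc)
  next
    case False
    then have "u = dg n (pr \<one> u) + dg n (pr t u) + (\<Sum>h\<in>supp - {\<one>, t}. r h)"
      by (subst e, intro tm_eqI) (simp add: r_def)
    then show ?thesis using p z' False unfolding u_def[symmetric] by metis
  qed
qed

lemma diag_degree_1: assumes "t = \<one>" shows "hz \<one> (diag n f)"
proof -
  obtain p q z where p: "p \<in> A \<one>" "z \<in> ZZ n" "diag n f = dg n p + dg n q + z" "q = 0"
    using diag_split[of f] assms by blast
  have "dg n q = 0" using p(4) by (intro tm_eqI) (simp add: dg_def)
  then show ?thesis using hz_ZZ[OF hz_dg[OF one_closed p(1)] p(2)] p(3) by simp
qed

text \<open>The degree t part of f is symmetric and the degree \<open>\<one>\<close> part has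
  constant mirror sums. If f is antisymmetric, twice the former is constant; if f is symmetric,
  twice the latter is constant.\<close>

lemma diag_degree_t:
  assumes t1: "t \<noteq> \<one>"
  shows "(\<And>i. i < n \<Longrightarrow> f (n-1-i) = - f i) \<Longrightarrow> hz \<one> (diag n f)"
    and "(\<And>i. i < n \<Longrightarrow> f (n-1-i) = f i) \<Longrightarrow> hz t (diag n f)"
proof -
  obtain p q z where pq: "p \<in> A \<one>" "q \<in> A t" and z: "z \<in> ZZ n" and e: "diag n f = dg n p + dg n q + z"
    using diag_split[of f] by blast
  obtain c where c: "z = diag n (\<lambda>_. c)" using z by (auto simp: ZZ_iff)
  have fi: "f i = p i i + q i i + c" if "i < n" for i
    using arg_cong[OF e, of "\<lambda>x. x i i"] that by (simp add: dg_def c)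
  have two: "(2::'c) \<noteq> 0" using type t1 by (simp add: grading_type_def)
  have qs: "q (n-1-i) (n-1-i) = q i i" if "i < n" for i
    using type t1 pq that unfolding grading_type_def by blast
  have ps: "p i i + p (n-1-i) (n-1-i) = p j j + p (n-1-j) (n-1-j)" if "i < n" "j < n" for i j
    using type t1 pq that unfolding grading_type_def by blast
  have half: "dconst x" if "\<And>i j. i < n \<Longrightarrow> j < n \<Longrightarrow> 2 * x i i = 2 * x j j" for x :: "'c tm"
    unfolding dconst_def using that two by (metis mult_left_cancel)
  {
    assume a: "\<And>i. i < n \<Longrightarrow> f (n-1-i) = - f i"
    have "2 * q i i = - (p i i + p (n-1-i) (n-1-i)) - 2 * c" if i: "i < n" for i
    proof -
      have "p (n-1-i) (n-1-i) + q i i + c = - (p i i + q i i + c)"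
        using a[OF i] fi[OF i] fi[of "n-1-i"] qs[OF i] i by simp
      then show ?thesis by (simp add: algebra_simps eq_neg_iff_add_eq_0)
    qed
    then have "dconst q" using ps by (intro half) metis
    then have "dg n q + z \<in> ZZ n" using z by (intro ZZ_add dconst_ZZ)
    then have "hz \<one> (dg n p + (dg n q + z))" using hz_dg[OF one_closed pq(1)] by (intro hz_ZZ)
    then show "hz \<one> (diag n f)" unfolding e by (simp add: add.assoc)
  }
  {
    assume a: "\<And>i. i < n \<Longrightarrow> f (n-1-i) = f i"
    have "2 * p i i = p i i + p (n-1-i) (n-1-i)" if i: "i < n" for i
      using a[OF i] fi[OF i] fi[of "n-1-i"] qs[OF i] i by simp
    then have "dconst p" using ps by (intro half) metis
    then have "dg n p + z \<in> ZZ n" using z by (intro ZZ_add dconst_ZZ)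
    then have "hz t (dg n q + (dg n p + z))" using hz_dg[OF tc pq(2)] by (intro hz_ZZ)
    then show "hz t (diag n f)" unfolding e by (simp add: add_ac)
  }
qed

text \<open>The component of the coarser decomposition indexed by the cosets {g, t g}. Modulo the
  centre it puts all diagonal matrices into \<open>CC \<one>\<close>, so brackets with diagonal
  idempotents preserve each component and isolate root vectors.\<close>

definition CC :: "'a \<Rightarrow> 'c tm set" where "CC g = {x + y |x y. x \<in> A g \<and> y \<in> A (t \<otimes> g)}"

lemma CC_A: "g \<in> carrier G \<Longrightarrow> h = g \<or> h = t \<otimes> g \<Longrightarrow> x \<in> A h \<Longrightarrow> x \<in> CC g"
proof -
  assume g: "g \<in> carrier G" and h: "h = g \<or> h = t \<otimes> g" and x: "x \<in> A h"
  have "0 \<in> A g" "0 \<in> A (t \<otimes> g)" using g by simp_all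
  moreover have "x = x + 0" "x = 0 + x" by simp_all
  ultimately show "x \<in> CC g" using h x unfolding CC_def by blast
qed
lemma CC_UU: "g \<in> carrier G \<Longrightarrow> x \<in> CC g \<Longrightarrow> x \<in> UU n"
  unfolding CC_def using A_UU[of g] A_UU[of "t \<otimes> g"] by auto
lemma CC_add: "g \<in> carrier G \<Longrightarrow> x \<in> CC g \<Longrightarrow> y \<in> CC g \<Longrightarrow> x + y \<in> CC g"
proof -
  assume g: "g \<in> carrier G" and "x \<in> CC g" "y \<in> CC g"
  then obtain a b c d where "a \<in> A g" "b \<in> A (t \<otimes> g)" "x = a + b" "c \<in> A g" "d \<in> A (t \<otimes> g)" "y = c + d"
    unfolding CC_def by blast
  then have "x + y = (a + c) + (b + d)" "a + c \<in> A g" "b + d \<in> A (t \<otimes> g)"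
    using g by (auto simp: A_add add_ac)
  then show ?thesis unfolding CC_def by blast
qed
lemma CC_sc: "g \<in> carrier G \<Longrightarrow> x \<in> CC g \<Longrightarrow> sc a x \<in> CC g"
proof -
  assume g: "g \<in> carrier G" and "x \<in> CC g"
  then obtain c b where "c \<in> A g" "b \<in> A (t \<otimes> g)" "x = c + b" unfolding CC_def by blast
  then have "sc a x = sc a c + sc a b" "sc a c \<in> A g" "sc a b \<in> A (t \<otimes> g)"
    using g by (auto simp: A_sc sc_add)
  then show ?thesis unfolding CC_def by blast
qed

lemma CC_br_hz:
  assumes g: "g \<in> carrier G" and d: "hz \<one> d \<or> hz t d" and x: "x \<in> CC g" shows "br d x \<in> CC g"
proof -
  obtain a b where ab: "a \<in> A g" "b \<in> A (t \<otimes> g)" "x = a + b" using x unfolding CC_def by blast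
  from d show ?thesis
  proof
    assume "hz \<one> d"
    then have "br d a \<in> A g" "br d b \<in> A (t \<otimes> g)"
      using hz_br[of \<one> g d a] hz_br[of \<one> "t \<otimes> g" d b] ab g by auto
    then show ?thesis unfolding ab(3) br_add CC_def by blast
  next
    assume "hz t d"
    then have "br d b \<in> A g" "br d a \<in> A (t \<otimes> g)"
      using hz_br[of t g d a] hz_br[of t "t \<otimes> g" d b] ab g by auto
    then have "br d b + br d a \<in> CC g" unfolding CC_def by blast
    then show ?thesis unfolding ab(3) br_add by (simp only: add.commute)
  qed
qed

lemma CC_br_CC:
  assumes g: "g \<in> carrier G" and d: "d \<in> CC \<one>" and x: "x \<in> CC g" shows "br d x \<in> CC g"
proof -
  obtain a b where ab: "a \<in> A \<one>" "b \<in> A t" "d = a + b" using d unfolding CC_def by auto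
  then show ?thesis using CC_br_hz[OF g _ x, of a] CC_br_hz[OF g _ x, of b] hz_A
    unfolding ab(3) br_add by (intro CC_add[OF g]) blast+
qed

lemma CC_diag: "\<exists>d\<in>CC \<one>. \<exists>z\<in>ZZ n. diag n f = d + z"
proof -
  obtain p q z where pq: "p \<in> A \<one>" "q \<in> A t" "z \<in> ZZ n" "diag n f = dg n p + dg n q + z"
    using diag_split[of f] by blast
  obtain z1 z2 where zz: "z1 \<in> ZZ n" "dg n p + z1 \<in> A \<one>" "z2 \<in> ZZ n" "dg n q + z2 \<in> A t"
    using hz_dg[OF one_closed pq(1)] hz_dg[OF tc pq(2)] unfolding hz_def by blast
  have "(dg n p + z1) + (dg n q + z2) \<in> CC \<one>" unfolding CC_def using zz(2,4) by auto
  moreover have "diag n f = ((dg n p + z1) + (dg n q + z2)) + (z - z1 - z2)" unfolding pq(4) by simp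
  moreover have "z - z1 - z2 \<in> ZZ n" using pq zz by (intro ZZ_diff)
  ultimately show ?thesis by metis
qed

lemma CC_br_diag: assumes g: "g \<in> carrier G" and x: "x \<in> CC g" shows "br (diag n f) x \<in> CC g"
proof -
  obtain d z where d: "d \<in> CC \<one>" "z \<in> ZZ n" "diag n f = d + z" using CC_diag by blast
  have "br (diag n f) x = br d x" unfolding d(3) using d(2) CC_UU[OF g x] by (simp add: br_add)
  then show ?thesis using CC_br_CC[OF g d(1) x] by simp
qed

lemma CC_entry:
  assumes g: "g \<in> carrier G" and x: "x \<in> CC g" and ij: "i < j"
  shows "sc (x i j) (ee i j) \<in> CC g"
proof -
  have "br (unit_diag n i) (br (unit_diag n j) x) \<in> CC g"
    unfolding unit_diag_def by (intro CC_br_diag g x)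
  from CC_sc[OF g this, of "- 1"] show ?thesis
    using unit_diag_br_br[OF CC_UU[OF g x] ij] by (simp add: sc_uminus)
qed

lemma CC_disjoint:
  assumes g: "g \<in> carrier G" "h \<in> carrier G" and w: "w \<in> CC g" "w \<in> CC h" "w \<noteq> 0"
  shows "h = g \<or> h = t \<otimes> g"
proof -
  have 0: "pr k w = 0" if c: "k \<noteq> c" "k \<noteq> t \<otimes> c" "w \<in> CC c" "c \<in> carrier G" for k c
  proof -
    obtain a b where ab: "a \<in> A c" "b \<in> A (t \<otimes> c)" "w = a + b" using c(3) unfolding CC_def by blast
    have "t \<otimes> c \<in> carrier G" using c(4) by simp
    note A_UU[OF this ab(2)] A_UU[OF c(4) ab(1)]
    then have "pr k w = pr k a + pr k b" unfolding ab(3) by (intro pr_add)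
    also have "pr k a = 0" using pr_hom[OF ab(1) c(4), of k] c(1) by simp
    also have "pr k b = 0" using pr_hom[OF ab(2) \<open>t \<otimes> c \<in> carrier G\<close>, of k] c(2) by simp
    finally show ?thesis by simp
  qed
  have wU: "w \<in> UU n" by (rule CC_UU[OF g(1) w(1)])
  have "\<exists>k. pr k w \<noteq> 0"
  proof (rule ccontr)
    assume "\<not> (\<exists>k. pr k w \<noteq> 0)"
    then have "(\<Sum>k\<in>supp. pr k w) = 0" by (intro sum.neutral) auto
    then show False using w(3) unfolding sum_pr[OF wU, symmetric] by simp
  qed
  then obtain k where "pr k w \<noteq> 0" by blast
  then have "k = g \<or> k = t \<otimes> g" "k = h \<or> k = t \<otimes> h" using 0 w g by blast+
  then show ?thesis using g by (metis ttg)
qed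

text \<open>Chosen from the set {g, t g}, so the value depends only on the coset and on t. Labels of
  two gradings with the same t can therefore be compared literally.\<close>

definition rep :: "'a \<Rightarrow> 'a" where "rep g = (SOME h. h \<in> {g, t \<otimes> g})"

lemma rep_cases: "rep g = g \<or> rep g = t \<otimes> g"
  using someI[of "\<lambda>h. h \<in> {g, t \<otimes> g}" g] by (auto simp: rep_def)
lemma rep_closed: "g \<in> carrier G \<Longrightarrow> rep g \<in> carrier G"
  using rep_cases[of g] by auto
lemma rep_t: "g \<in> carrier G \<Longrightarrow> rep (t \<otimes> g) = rep g"
  unfolding rep_def by (simp add: insert_commute)
lemma rep_rep: "g \<in> carrier G \<Longrightarrow> rep (rep g) = rep g"
  using rep_cases[of g] rep_t[of g] by auto

lemma root_label_exists:
  assumes "Suc i < n" shows "\<exists>g\<in>carrier G. ee i (Suc i) \<in> CC g"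
proof -
  let ?e = "ee i (Suc i) :: 'c tm"
  have eU: "?e \<in> UU n" using assms by auto
  have "(\<Sum>g\<in>supp. pr g ?e) i (Suc i) = 1" unfolding sum_pr[OF eU, symmetric] by (simp add: ee_def)
  then have "(\<Sum>g\<in>supp. pr g ?e i (Suc i)) \<noteq> 0" by (simp only: sum_fun_apply2) simp
  then obtain g where g: "g \<in> supp" "pr g ?e i (Suc i) \<noteq> 0" by (metis (no_types, lifting) sum.neutral)
  have gc: "g \<in> carrier G" using g supp_carrier by auto
  have "pr g ?e \<in> CC g" using pr_A[OF eU gc] by (intro CC_A[OF gc]) auto
  from CC_entry[OF gc this, of i "Suc i"] have "sc (pr g ?e i (Suc i)) ?e \<in> CC g" by simp
  from CC_sc[OF gc this, of "1 / pr g ?e i (Suc i)"] g(2) show ?thesis using gc by auto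
qed

definition lab :: "nat \<Rightarrow> 'a" where
  "lab i = rep (SOME g. g \<in> carrier G \<and> ee i (Suc i) \<in> CC g)"

lemma lab:
  assumes "Suc i < n"
  shows "lab i \<in> carrier G" "rep (lab i) = lab i"
    "g \<in> carrier G \<Longrightarrow> ee i (Suc i) \<in> CC g \<longleftrightarrow> rep g = lab i"
proof -
  define c where "c = (SOME g. g \<in> carrier G \<and> (ee i (Suc i) :: 'c tm) \<in> CC g)"
  have c: "c \<in> carrier G" "(ee i (Suc i) :: 'c tm) \<in> CC c"
    using someI_ex[of "\<lambda>g. g \<in> carrier G \<and> (ee i (Suc i) :: 'c tm) \<in> CC g"] root_label_exists[OF assms]
    unfolding c_def by blast+
  have l: "lab i = rep c" by (simp add: lab_def c_def)
  show "lab i \<in> carrier G" "rep (lab i) = lab i" unfolding l using c by (simp_all add: rep_closed rep_rep)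
  assume g: "g \<in> carrier G"
  have e0: "(ee i (Suc i) :: 'c tm) \<noteq> 0" by simp
  have CCt: "CC (t \<otimes> k) = CC k" if "k \<in> carrier G" for k
  proof -
    have "CC (t \<otimes> k) = {x + y |x y. x \<in> A (t \<otimes> k) \<and> y \<in> A k}" unfolding CC_def using that by simp
    also have "\<dots> = CC k"
    proof -
      have "{x + y |x y. x \<in> P \<and> y \<in> Q} \<subseteq> {x + y |x y. x \<in> Q \<and> y \<in> P}" for P Q :: "'c tm set"
      proof
        fix w assume "w \<in> {x + y |x y. x \<in> P \<and> y \<in> Q}"
        then obtain x y where "w = y + x" "x \<in> P" "y \<in> Q" by (auto simp: add.commute)
        then show "w \<in> {x + y |x y. x \<in> Q \<and> y \<in> P}" by blast
      qed
      then show ?thesis unfolding CC_def by (intro subset_antisym)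
    qed
    finally show ?thesis .
  qed
  show "ee i (Suc i) \<in> CC g \<longleftrightarrow> rep g = lab i"
  proof
    assume "ee i (Suc i) \<in> CC g"
    from CC_disjoint[OF c(1) g c(2) this e0] have "g = c \<or> g = t \<otimes> c" .
    then show "rep g = lab i" unfolding l using rep_t c by auto
  next
    assume "rep g = lab i"
    then have "rep g = rep c" by (simp add: l)
    then have "g = c \<or> g = t \<otimes> c"
      using rep_cases[of g] rep_cases[of c] g c by (metis ttg)
    then show "ee i (Suc i) \<in> CC g" using CCt[OF c(1)] c(2) by auto
  qed
qed

text \<open>The leading superdiagonal entry of a bracket is a difference of two products of leading
  entries, one for each order of two adjacent intervals. The extra bracket at each leaf makes its
  value start on the first superdiagonal.\<close>

lemma val_CC_entry:
  assumes "set_bt T \<subseteq> carrier G" "\<And>g. g \<in> set_bt T \<Longrightarrow> rep g = g" "v \<in> val CC (bracket_leaves \<one> T)"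
  shows "v \<in> NN n (leaves T) \<and>
    (\<forall>i. v i (i + leaves T) \<noteq> 0 \<longrightarrow> matches T (map lab [i..<i + leaves T]))"
  using assms
proof (induction T arbitrary: v)
  case (Leaf g)
  then obtain d x where dx: "d \<in> CC \<one>" "x \<in> CC g" "v = br d x" by auto
  have g: "g \<in> carrier G" "rep g = g" using Leaf by auto
  have N: "v \<in> NN n 1" unfolding dx(3) using dx g CC_UU by (intro br_UU_UU) auto
  moreover have "matches (Leaf g) (map lab [i..<i + 1])" if v: "v i (i + 1) \<noteq> 0" for i
  proof -
    have i: "Suc i < n" using NN_zero_entry[OF N, of i "i + 1"] v by auto
    have "v \<in> CC g" unfolding dx(3) by (rule CC_br_CC[OF g(1) dx(1,2)])
    from CC_sc[OF g(1) CC_entry[OF g(1) this, of i "Suc i"], of "1 / v i (Suc i)"]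
    have "ee i (Suc i) \<in> CC g" using v by simp
    then have "g = lab i" using lab(3)[OF i g(1)] g(2) by simp
    then show ?thesis by (simp add: matches_Leaf_iff)
  qed
  ultimately show ?case by simp
next
  case (Node l r)
  then obtain x y where xy: "x \<in> val CC (bracket_leaves \<one> l)" "y \<in> val CC (bracket_leaves \<one> r)" "v = br x y"
    by auto
  have x: "x \<in> NN n (leaves l)" "\<And>i. x i (i + leaves l) \<noteq> 0 \<Longrightarrow> matches l (map lab [i..<i + leaves l])"
    using Node.IH(1)[OF _ _ xy(1)] Node.prems by auto
  have y: "y \<in> NN n (leaves r)" "\<And>i. y i (i + leaves r) \<noteq> 0 \<Longrightarrow> matches r (map lab [i..<i + leaves r])"
    using Node.IH(2)[OF _ _ xy(2)] Node.prems by auto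
  have "matches (Node l r) (map lab [i..<i + (leaves l + leaves r)])" if v: "v i (i + (leaves l + leaves r)) \<noteq> 0" for i
  proof -
    have split: "map lab [i..<i + (leaves l + leaves r)] = map lab [i..<i + p] @ map lab [i + p..<i + p + q]"
      if "p + q = leaves l + leaves r" for p q
      using that upt_add_eq_append[of i "i + p" q] by (simp add: add.assoc flip: map_append)
    have "v i (i + leaves l + leaves r) \<noteq> 0" using v by (simp add: add.assoc)
    then consider "x i (i + leaves l) \<noteq> 0" "y (i + leaves l) (i + leaves l + leaves r) \<noteq> 0" |
      "y i (i + leaves r) \<noteq> 0" "x (i + leaves r) (i + leaves l + leaves r) \<noteq> 0"
      unfolding xy(3) br_entry[OF x(1) y(1)] by fastforce
    then show ?thesis
    proof cases
      case 1
      then show ?thesis using x(2)[of i] y(2)[of "i + leaves l"] split[of "leaves l" "leaves r"] matches_Node1 by metis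
    next
      case 2
      then have "x (i + leaves r) (i + leaves r + leaves l) \<noteq> 0" by (simp add: add_ac)
      then show ?thesis using 2 x(2)[of "i + leaves r"] y(2)[of i] split[of "leaves r" "leaves l"] matches_Node2
        by (metis add.commute)
    qed
  qed
  then show ?case using br_NN[OF x(1) y(1)] xy(3) by simp
qed

text \<open>The root vectors themselves realise the monomial: a diagonal idempotent, up to the
  centre in \<open>CC \<one>\<close>, serves as the extra factor at each leaf, and the order of the
  two intervals at a node affects only the sign.\<close>

lemma val_CC_root:
  assumes "matches T w" "w = map lab [i..<j]" "j < n"
  shows "\<exists>v\<in>val CC (bracket_leaves \<one> T). v = ee i j \<or> v = - ee i j"
  using assms
proof (induction arbitrary: i j rule: matches.induct)
  case (matches_Leaf a)
  then have ij: "j = Suc i" by (metis diff_Suc_1 Suc_diff_le length_Cons length_map length_upt list.size(3) 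
      diff_add_inverse2 le_add_diff_inverse nat_le_linear add_Suc_right add_0_right diff_is_0_eq' zero_neq_one One_nat_def)
  then have a: "a = lab i" using matches_Leaf by simp
  have i: "Suc i < n" using matches_Leaf ij by simp
  have e: "(ee i (Suc i) :: 'c tm) \<in> CC a" using lab[OF i] a by simp
  obtain d z where d: "d \<in> CC \<one>" "z \<in> ZZ n" "diag n (\<lambda>l. if l = i then 1 else 0) = d + z" using CC_diag by blast
  have eU: "(ee i (Suc i) :: 'c tm) \<in> UU n" using i by auto
  have "br (d + z) (ee i (Suc i)) = ee i (Suc i)"
    unfolding d(3)[symmetric] diag_br[OF eU] by (intro tm_eqI) (auto simp: ee_def)
  then have "br d (ee i (Suc i)) = ee i (Suc i)" using d(2) eU by (simp add: br_add)
  then show ?case using d(1) e ij by force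
next
  case (matches_Node1 l u r v)
  define m where "m = i + length u"
  have len: "length u + length v = j - i" using arg_cong[OF matches_Node1.prems(1), of length] by simp
  have ne: "u \<noteq> []" "v \<noteq> []" using matches_Node1.hyps matches_nonempty by auto
  then have m: "i < m" "m < j" using len by (cases u; cases v; simp add: m_def)+
  have "[i..<j] = [i..<m] @ [m..<j]" using m by (metis upt_add_eq_append le_add_diff_inverse less_imp_le)
  then have "u @ v = map lab [i..<m] @ map lab [m..<j]" using matches_Node1.prems(1) by simp
  then have uv: "u = map lab [i..<m]" "v = map lab [m..<j]" using m_def by (auto simp: append_eq_append_conv)
  obtain x where x: "x \<in> val CC (bracket_leaves \<one> l)" "x = ee i m \<or> x = - ee i m"
    using matches_Node1.IH(1)[OF uv(1)] m matches_Node1.prems by auto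
  obtain y where y: "y \<in> val CC (bracket_leaves \<one> r)" "y = ee m j \<or> y = - ee m j"
    using matches_Node1.IH(2)[OF uv(2)] m matches_Node1.prems by auto
  have "br (ee i m) (ee m j) = (ee i j :: 'c tm)" using m by (simp add: ee_br)
  then have "br x y = ee i j \<or> br x y = - ee i j" using x(2) y(2) by (auto simp: br_uminus)
  moreover have "br x y \<in> val CC (bracket_leaves \<one> (Node l r))" using x(1) y(1) by auto
  ultimately show ?case by blast
next
  case (matches_Node2 l u r v)
  define m where "m = i + length v"
  have len: "length u + length v = j - i" using arg_cong[OF matches_Node2.prems(1), of length] by simp
  have ne: "u \<noteq> []" "v \<noteq> []" using matches_Node2.hyps matches_nonempty by auto
  then have m: "i < m" "m < j" using len by (cases u; cases v; simp add: m_def)+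
  have "[i..<j] = [i..<m] @ [m..<j]" using m by (metis upt_add_eq_append le_add_diff_inverse less_imp_le)
  then have "v @ u = map lab [i..<m] @ map lab [m..<j]" using matches_Node2.prems(1) by simp
  then have uv: "v = map lab [i..<m]" "u = map lab [m..<j]" using m_def by (auto simp: append_eq_append_conv)
  obtain x where x: "x \<in> val CC (bracket_leaves \<one> l)" "x = ee m j \<or> x = - ee m j"
    using matches_Node2.IH(1)[OF uv(2)] m matches_Node2.prems by auto
  obtain y where y: "y \<in> val CC (bracket_leaves \<one> r)" "y = ee i m \<or> y = - ee i m"
    using matches_Node2.IH(2)[OF uv(1)] m matches_Node2.prems by auto
  have "br (ee m j) (ee i m) = - (ee i j :: 'c tm)" using m by (simp add: ee_br)
  then have "br x y = ee i j \<or> br x y = - ee i j" using x(2) y(2) by (auto simp: br_uminus)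
  moreover have "br x y \<in> val CC (bracket_leaves \<one> (Node l r))" using x(1) y(1) by auto
  ultimately show ?case by blast
qed

lemma val_CC_span:
  assumes "v \<in> val CC T" "set_bt T \<subseteq> carrier G"
  shows "v \<in> val_span (\<lambda>g h. h = g \<or> h = t \<otimes> g) A T"
  using assms
proof (induction T arbitrary: v)
  case (Leaf g)
  then obtain x y where "x \<in> A g" "y \<in> A (t \<otimes> g)" "v = x + y" by (auto simp: CC_def)
  then show ?case
    by (auto intro!: val_span_add intro: val_span_base[of _ _ "Leaf g"] val_span_base[of _ _ "Leaf (t \<otimes> g)"])
next
  case (Node l r)
  then obtain x y where "x \<in> val CC l" "y \<in> val CC r" "v = br x y" by auto
  with Node show ?case by (auto intro!: val_span_br)
qed

definition labels :: "'a list" where "labels = map lab [0..<n - 1]"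

text \<open>With n - 1 leaves all values lie in the one-dimensional corner
  \<open>NN n (n - 1)\<close>, so the only possible interval is the whole word.\<close>

lemma labels_matches_iff:
  assumes "set_bt T \<subseteq> carrier G" "\<And>g. g \<in> set_bt T \<Longrightarrow> rep g = g" "leaves T = n - 1" "n > 1"
  shows "matches T labels \<longleftrightarrow> nonvanishing CC (bracket_leaves \<one> T)"
proof
  assume "matches T labels"
  then obtain v where "v \<in> val CC (bracket_leaves \<one> T)" "v = ee 0 (n - 1) \<or> v = - ee 0 (n - 1)"
    using val_CC_root[of T labels 0 "n - 1"] assms(4) by (auto simp: labels_def)
  moreover from this(2) have "v \<noteq> 0" by (metis ee_nonzero neg_equal_0_iff_equal)
  ultimately show "nonvanishing CC (bracket_leaves \<one> T)" unfolding nonvanishing_def by blast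
next
  assume "nonvanishing CC (bracket_leaves \<one> T)"
  then obtain v where v: "v \<in> val CC (bracket_leaves \<one> T)" "v \<noteq> 0" by (auto simp: nonvanishing_def)
  from val_CC_entry[OF assms(1,2) v(1)] have N: "v \<in> NN n (n - 1)"
    and m: "\<And>i. v i (i + (n - 1)) \<noteq> 0 \<Longrightarrow> matches T (map lab [i..<i + (n - 1)])" by (auto simp: assms(3))
  have "v 0 (0 + (n - 1)) \<noteq> 0"
  proof
    assume 0: "v 0 (0 + (n - 1)) = 0"
    have "v \<in> NN n (Suc (n - 1))"
    proof (rule NN_SucI[OF N])
      fix i assume "i + (n - 1) < n"
      then have "i = 0" using assms(4) by simp
      then show "v i (i + (n - 1)) = 0" using 0 by simp
    qed
    then have "v = 0" using assms(4) by (intro NN_top[of v n "Suc (n - 1)"]) auto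
    with v(2) show False ..
  qed
  from m[OF this] show "matches T labels" by (simp add: labels_def)
qed

end

section \<open>Detecting t by iterated brackets\<close>

context normal_grading
begin

fun ad_bt :: "'a \<Rightarrow> nat \<Rightarrow> 'a \<Rightarrow> 'a bt" where
  "ad_bt g 0 h = Leaf h"
| "ad_bt g (Suc k) h = Node (Leaf g) (ad_bt g k h)"

lemma set_ad_bt: "set_bt (ad_bt g k h) \<subseteq> {g, h}"
  by (induction k) auto

text \<open>The diagonal part of x is homogeneous modulo the centre and scales the entry at (i, j)
  by a nonzero difference; repeating the bracket never kills this entry.\<close>

lemma ad_nonvanishing:
  assumes g: "g \<in> carrier G" and x: "x \<in> A g" "\<not> dconst x"
  shows "\<exists>h\<in>carrier G. \<forall>k. nonvanishing A (ad_bt g k h)"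
proof -
  obtain i j where ij: "i < j" "j < n" "x i i \<noteq> x j j"
    using x(2) unfolding dconst_def by (metis nat_neq_iff)
  obtain z where z: "z \<in> ZZ n" "dg n x + z \<in> A g" using hz_dg[OF g x(1)] by (auto simp: hz_def)
  have eU: "(ee i j :: 'c tm) \<in> UU n" using ij by auto
  have "(\<Sum>h\<in>supp. pr h (ee i j)) i j = (1::'c)" unfolding sum_pr[OF eU, symmetric] by (simp add: ee_def)
  then have "(\<Sum>h\<in>supp. pr h (ee i j) i j) \<noteq> (0::'c)" by (simp only: sum_fun_apply2) simp
  then obtain h where h: "h \<in> supp" "pr h (ee i j) i j \<noteq> (0::'c)" by (metis (no_types, lifting) sum.neutral)
  have hc: "h \<in> carrier G" using h supp_carrier by auto
  have "\<exists>v\<in>val A (ad_bt g k h). v \<in> UU n \<and> v i j \<noteq> 0" for k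
  proof (induction k)
    case 0
    show ?case using pr_A[OF eU hc] pr_UU[OF eU] h(2) by auto
  next
    case (Suc k)
    then obtain v where v: "v \<in> val A (ad_bt g k h)" "v \<in> UU n" "v i j \<noteq> 0" by blast
    have "br (dg n x + z) v = br (dg n x) v" using z(1) v(2) by (simp add: br_add)
    moreover have "br (dg n x) v i j = (x i i - x j j) * v i j" unfolding dg_def diag_br[OF v(2)] ..
    ultimately have "br (dg n x + z) v i j \<noteq> 0" using ij v(3) by simp
    moreover have "br (dg n x + z) v \<in> UU n" using v(2) ZZ_UU[OF z(1)] by simp
    moreover have "br (dg n x + z) v \<in> val A (ad_bt g (Suc k) h)" using v(1) z(2) by auto
    ultimately show ?case by blast
  qed
  then show ?thesis using hc unfolding nonvanishing_def by (metis zero_fun_apply)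
qed

text \<open>An element with scalar diagonal acts as zero on each N_k / N_(k+1), so every bracket
  moves one step down the filtration.\<close>

lemma ad_vanishing:
  assumes g: "g \<in> carrier G" "h \<in> carrier G" and x: "\<And>x. x \<in> A g \<Longrightarrow> dconst x"
  shows "\<not> nonvanishing A (ad_bt g n h)"
proof -
  have "val A (ad_bt g k h) \<subseteq> NN n k" for k
  proof (induction k)
    case 0 then show ?case using A_UU[OF g(2)] by auto
  next
    case (Suc k)
    show ?case
    proof
      fix w assume "w \<in> val A (ad_bt g (Suc k) h)"
      then obtain y v where y: "y \<in> A g" "v \<in> val A (ad_bt g k h)" "w = br y v" by auto
      have v: "v \<in> NN n k" using Suc y(2) by auto
      have yU: "y \<in> UU n" using A_UU[OF g(1) y(1)] .
      show "w \<in> NN n (Suc k)" unfolding y(3)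
      proof (rule NN_SucI)
        show "br y v \<in> NN n k" using yU v by simp
        fix i assume "i + k < n"
        then have "y i i = y (i + k) (i + k)" using x[OF y(1)] unfolding dconst_def by (meson add_leD1 less_or_eq_imp_le le_less_trans le_add1)
        then show "br y v i (i + k) = 0" unfolding br_entry_UU[OF yU v] by simp
      qed
    qed
  qed
  then show ?thesis unfolding nonvanishing_def using NN_top[of _ n n] by blast
qed

subsection \<open>Homogeneous simple root vectors\<close>

lemma root_degree_1:
  assumes "t = \<one>" "Suc i < n" shows "ee i (Suc i) \<in> A (lab i)"
proof -
  have "(ee i (Suc i) :: 'c tm) \<in> CC (lab i)" using lab[OF assms(2)] by simp
  then obtain x y where "x \<in> A (lab i)" "y \<in> A (lab i)" "(ee i (Suc i) :: 'c tm) = x + y"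
    unfolding CC_def using assms(1) lab(1)[OF assms(2)] by auto
  then show ?thesis using A_add lab(1)[OF assms(2)] by auto
qed

lemma two_neq: "t \<noteq> \<one> \<Longrightarrow> (2::'c) \<noteq> 0" using type by (simp add: grading_type_def)

text \<open>For \<open>i = i* = n - 2 - i\<close> the two summands coincide.\<close>

lemma pair_components:
  assumes t1: "t \<noteq> \<one>" and g: "g \<in> carrier G" and x: "x \<in> A g" and i: "Suc i < n"
  defines "y \<equiv> sc (x i (Suc i)) (ee i (Suc i))"
    and "y' \<equiv> sc (x (n-2-i) (n-1-i)) (ee (n-2-i) (n-1-i))"
  shows "y + y' \<in> A g" "y - y' \<in> A (t \<otimes> g)"
proof -
  have two: "(2::'c) \<noteq> 0" using two_neq[OF t1] .
  have xU: "x \<in> UU n" using A_UU[OF g x] .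
  \<comment> \<open>E - E' and F - F' are antisymmetric, of degree \<open>\<one>\<close>, while E +
    E' and F + F' are symmetric, of degree t. Products of factors of the same or of opposite kind
    add up to twice E F + E' F' or E F - E' F', which isolates the two entries of x.\<close>
  define E E' F F' where "E = (unit_diag n i :: 'c tm)" and "E' = (unit_diag n (n-1-i) :: 'c tm)"
    and "F = (unit_diag n (Suc i) :: 'c tm)" and "F' = (unit_diag n (n-2-i) :: 'c tm)"
  have anti: "hz \<one> (unit_diag n k - unit_diag n (n-1-k))" and sym: "hz t (unit_diag n k + unit_diag n (n-1-k))"
    if "k < n" for k
  proof -
    have "hz \<one> (diag n (\<lambda>l. (if l = k then 1 else 0) - (if l = n-1-k then 1 else 0)))"
      by (rule diag_degree_t(1)[OF t1]) (use that in auto)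
    moreover have "diag n (\<lambda>l. (if l = k then 1 else 0) - (if l = n-1-k then 1 else 0)) = (unit_diag n k - unit_diag n (n-1-k) :: 'c tm)"
      by (intro tm_eqI) (simp add: unit_diag_def)
    ultimately show "hz \<one> (unit_diag n k - unit_diag n (n-1-k))" by simp
    have "hz t (diag n (\<lambda>l. (if l = k then 1 else 0) + (if l = n-1-k then 1 else 0)))"
      by (rule diag_degree_t(2)[OF t1]) (use that in auto)
    moreover have "diag n (\<lambda>l. (if l = k then 1 else 0) + (if l = n-1-k then 1 else 0)) = (unit_diag n k + unit_diag n (n-1-k) :: 'c tm)"
      by (intro tm_eqI) (simp add: unit_diag_def)
    ultimately show "hz t (unit_diag n k + unit_diag n (n-1-k))" by simp
  qed
  have k: "n - 1 - Suc i = n - 2 - i" using i by simp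
  have aE: "hz \<one> (E - E')" "hz t (E + E')" using anti[of i] sym[of i] i by (auto simp: E_def E'_def)
  have aF: "hz \<one> (F - F')" "hz t (F + F')" using anti[of "Suc i"] sym[of "Suc i"] i unfolding F_def F'_def k by auto
  have s: "br E (br F x) = - y" "br E' (br F' x) = - y'"
    using unit_diag_br_br(1)[OF xU, of i "Suc i"] unit_diag_br_br(2)[OF xU, of "n-2-i" "n-1-i"] i
    unfolding E_def E'_def F_def F'_def y_def y'_def by auto
  have tg: "t \<otimes> g \<in> carrier G" using g by simp
  have h1: "br (F - F') x \<in> A g" "br (F + F') x \<in> A (t \<otimes> g)"
    using hz_br[OF one_closed g aF(1) x] hz_br[OF tc g aF(2) x] g by auto
  have "br (E - E') (br (F - F') x) + br (E + E') (br (F + F') x) \<in> A g"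
    using hz_br[OF one_closed g aE(1) h1(1)] hz_br[OF tc tg aE(2) h1(2)] g by (auto intro!: A_add)
  moreover have "br (E - E') (br (F - F') x) + br (E + E') (br (F + F') x) = sc (- 2) (y + y')"
    by (intro tm_eqI) (simp add: br_add br_diff s)
  ultimately have "sc (- (1/2)) (sc (- 2) (y + y')) \<in> A g" by (metis A_sc g)
  then show "y + y' \<in> A g" using two by simp
  have "br (E - E') (br (F + F') x) + br (E + E') (br (F - F') x) \<in> A (t \<otimes> g)"
    using hz_br[OF one_closed tg aE(1) h1(2)] hz_br[OF tc g aE(2) h1(1)] g by (auto intro!: A_add)
  moreover have "br (E - E') (br (F + F') x) + br (E + E') (br (F - F') x) = sc (- 2) (y - y')"
    by (intro tm_eqI) (simp add: br_add br_diff s)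
  ultimately have "sc (- (1/2)) (sc (- 2) (y - y')) \<in> A (t \<otimes> g)" by (metis A_sc tg)
  then show "y - y' \<in> A (t \<otimes> g)" using two by simp
qed

lemma root_part_exists:
  assumes "Suc i < n"
  shows "\<exists>g x. (g = lab i \<or> g = t \<otimes> lab i) \<and> x \<in> A g \<and> x i (Suc i) \<noteq> 0"
proof -
  have "(ee i (Suc i) :: 'c tm) \<in> CC (lab i)" using lab[OF assms] by simp
  then obtain x y where xy: "x \<in> A (lab i)" "y \<in> A (t \<otimes> lab i)" "(ee i (Suc i) :: 'c tm) = x + y"
    unfolding CC_def by blast
  have "(ee i (Suc i) :: 'c tm) i (Suc i) \<noteq> 0" by (simp add: ee_def)
  then have "x i (Suc i) \<noteq> 0 \<or> y i (Suc i) \<noteq> 0" unfolding xy(3) by auto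
  then show ?thesis using xy by blast
qed

text \<open>Here c is the ratio of the mirrored entries in a homogeneous element that involves the
  root. If it were zero, the root vector would have the two different degrees g and t g.\<close>

lemma root_pair:
  assumes t1: "t \<noteq> \<one>" and i: "Suc i < n" and ne: "n - 2 - i \<noteq> i"
  shows "\<exists>c. c \<noteq> 0 \<and> ee i (Suc i) + sc c (ee (n-2-i) (n-1-i)) \<in> A (lab i) \<and>
    ee i (Suc i) - sc c (ee (n-2-i) (n-1-i)) \<in> A (t \<otimes> lab i)"
proof -
  let ?e = "ee i (Suc i) :: 'c tm" and ?e' = "ee (n-2-i) (n-1-i) :: 'c tm"
  obtain g x where g: "g = lab i \<or> g = t \<otimes> lab i" and x: "x \<in> A g" "x i (Suc i) \<noteq> 0"
    using root_part_exists[OF i] by blast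
  have l: "lab i \<in> carrier G" using lab(1)[OF i] .
  have gc: "g \<in> carrier G" and tg: "t \<otimes> g \<in> carrier G" using g l by auto
  define c where "c = x (n-2-i) (n-1-i) / x i (Suc i)"
  have p: "?e + sc c ?e' \<in> A g" "?e - sc c ?e' \<in> A (t \<otimes> g)"
  proof -
    note pc = pair_components[OF t1 gc x(1) i]
    have "sc (1 / x i (Suc i)) (sc (x i (Suc i)) ?e + sc (x (n-2-i) (n-1-i)) ?e') \<in> A g"
      by (rule A_sc[OF gc pc(1)])
    then show "?e + sc c ?e' \<in> A g" using x(2) by (simp add: sc_add c_def)
    have "sc (1 / x i (Suc i)) (sc (x i (Suc i)) ?e - sc (x (n-2-i) (n-1-i)) ?e') \<in> A (t \<otimes> g)"
      by (rule A_sc[OF tg pc(2)])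
    then show "?e - sc c ?e' \<in> A (t \<otimes> g)" using x(2) by (simp add: sc_diff c_def)
  qed
  have c0: "c \<noteq> 0"
  proof
    assume "c = 0"
    then have "?e \<in> A g" "?e \<in> A (t \<otimes> g)" using p by simp_all
    then have "?e = (if t \<otimes> g = g then ?e else 0)" using pr_hom[of ?e "t \<otimes> g" "t \<otimes> g"] pr_hom[of ?e g "t \<otimes> g"] gc tg by simp
    moreover have "t \<otimes> g \<noteq> g" using t1 gc by simp
    ultimately show False by simp
  qed
  from g show ?thesis
  proof
    assume "g = lab i" then show ?thesis using p c0 by blast
  next
    \<comment> \<open>Exchanging the degrees g and t g amounts to changing the sign of c.\<close>
    assume g: "g = t \<otimes> lab i"
    then have "t \<otimes> g = lab i" using l by simp
    then have "?e + sc (- c) ?e' \<in> A (lab i)" "?e - sc (- c) ?e' \<in> A (t \<otimes> lab i)"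
      using p g by (simp_all add: sc_uminus[symmetric]) (simp_all add: sc_def fun_eq_iff minus_mult_left[symmetric] del: minus_mult_left)
    then show ?thesis using c0 by (intro exI[of _ "- c"]) auto
  qed
qed

text \<open>Both mirrored entries coincide, so their sum is twice the root vector itself. Its label
  fixes the degree only up to t, which is why a later argument has to compare the two gradings
  here.\<close>

lemma root_center:
  assumes t1: "t \<noteq> \<one>" and i: "Suc i < n" and c: "n - 2 - i = i"
  shows "\<exists>g\<in>carrier G. ee i (Suc i) \<in> A g"
proof -
  obtain g x where g: "g = lab i \<or> g = t \<otimes> lab i" and x: "x \<in> A g" "x i (Suc i) \<noteq> 0"
    using root_part_exists[OF i] by blast
  have gc: "g \<in> carrier G" using g lab(1)[OF i] by auto
  have "n - 1 - i = Suc i" using c i by auto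
  then have "sc (1 / (2 * x i (Suc i))) (sc (x i (Suc i)) (ee i (Suc i)) + sc (x i (Suc i)) (ee i (Suc i))) \<in> A g"
    using A_sc[OF gc pair_components(1)[OF t1 gc x(1) i]] c by simp
  moreover have "sc (1 / (2 * x i (Suc i))) (sc (x i (Suc i)) (ee i (Suc i)) + sc (x i (Suc i)) (ee i (Suc i)))
      = (ee i (Suc i) :: 'c tm)"
    using two_neq[OF t1] x(2) by (intro tm_eqI) (simp add: field_simps)
  ultimately show ?thesis using gc by auto
qed

text \<open>A root vector and its mirror image are combinations of the same two homogeneous vectors,
  whose degrees form one coset.\<close>

lemma lab_flip:
  assumes t1: "t \<noteq> \<one>" and i: "Suc i < n" shows "lab (n-2-i) = lab i"
proof (cases "n - 2 - i = i")
  case False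
  let ?e = "ee i (Suc i) :: 'c tm" and ?e' = "ee (n-2-i) (n-1-i) :: 'c tm"
  obtain c where c: "c \<noteq> 0" "?e + sc c ?e' \<in> A (lab i)" "?e - sc c ?e' \<in> A (t \<otimes> lab i)"
    using root_pair[OF t1 i False] by blast
  have l: "lab i \<in> carrier G" "rep (lab i) = lab i" using lab[OF i] by auto
  have "(?e + sc c ?e') + sc (- 1) (?e - sc c ?e') \<in> CC (lab i)"
    using c l by (intro CC_add CC_sc CC_A[OF l(1)]) auto
  then have "sc (1 / (2 * c)) ((?e + sc c ?e') + sc (- 1) (?e - sc c ?e')) \<in> CC (lab i)" by (rule CC_sc[OF l(1)])
  moreover have "sc (1 / (2 * c)) ((?e + sc c ?e') + sc (- 1) (?e - sc c ?e')) = ?e'"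
    using c(1) two_neq[OF t1] by (intro tm_eqI) (simp add: field_simps)
  ultimately have m: "?e' \<in> CC (lab i)" by simp
  have s: "n - 1 - i = Suc (n - 2 - i)" "Suc (n - 2 - i) < n" using i by auto
  have "rep (lab i) = lab (n - 2 - i)" using lab(3)[OF s(2) l(1)] m unfolding s(1) by simp
  then show ?thesis using l(2) by simp
qed simp

end

section \<open>Comparing two gradings\<close>

text \<open>The bracket of a component of z with a homogeneous element is a component of the bracket
  of z with it, hence zero; so the centre is graded.\<close>

lemma (in tri_grading) pr_ZZ:
  assumes z: "z \<in> ZZ n" and g: "g \<in> carrier G" shows "pr g z \<in> ZZ n"
  unfolding ZZ_center
proof (intro conjI ballI)
  have zU: "z \<in> UU n" using z by (rule ZZ_UU)
  show "pr g z \<in> UU n" by (rule pr_UU[OF zU])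
  fix x :: "'f tm" assume x: "x \<in> UU n"
  have 0: "br (pr g z) (pr h x) = 0" if "h \<in> supp" for h
  proof -
    have h: "h \<in> carrier G" using that supp_carrier by auto
    have "pr (g \<otimes> h) (br z (pr h x)) = br (pr g z) (pr h x)"
      by (rule pr_br_hom_right[OF pr_A[OF x h] h zU g])
    then show ?thesis using z pr_UU[OF x, of h] by simp
  qed
  have "br (pr g z) x = (\<Sum>h\<in>supp. br (pr g z) (pr h x))"
    unfolding br_sum(2)[symmetric] sum_pr[OF x, symmetric] ..
  also have "\<dots> = 0" by (rule sum.neutral) (use 0 in blast)
  finally show "br (pr g z) x = 0" .
qed

locale two_gradings = A: tri_grading G n A + B: tri_grading G n B
  for G :: "('g, 'm) monoid_scheme" (structure) and n and A B :: "'g \<Rightarrow> 'f::field tm set"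
begin

text \<open>It is a subalgebra, so equality of two gradings modulo the centre can be checked on
  generators.\<close>

inductive_set common :: "'f tm set" where
  common_base: "g \<in> carrier G \<Longrightarrow> A.hz g x \<Longrightarrow> B.hz g x \<Longrightarrow> x \<in> common"
| common_add: "x \<in> common \<Longrightarrow> y \<in> common \<Longrightarrow> x + y \<in> common"

lemma common_UU: "x \<in> common \<Longrightarrow> x \<in> UU n"
  by (induction rule: common.induct) (auto intro: A.hz_UU)

lemma hz_sc_A: "g \<in> carrier G \<Longrightarrow> A.hz g x \<Longrightarrow> A.hz g (sc a x)"
  unfolding A.hz_def by (metis A.A_sc ZZ_sc sc_add)
lemma hz_sc_B: "g \<in> carrier G \<Longrightarrow> B.hz g x \<Longrightarrow> B.hz g (sc a x)"
  unfolding B.hz_def by (metis B.A_sc ZZ_sc sc_add)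

lemma common_sc: "x \<in> common \<Longrightarrow> sc a x \<in> common"
  by (induction rule: common.induct)
    (auto intro: common_base common_add hz_sc_A hz_sc_B simp only: sc_add)

lemma common_0: "0 \<in> common"
  using common_base[of \<one> 0] A.hz_A[of 0 \<one>] B.hz_A[of 0 \<one>] by simp

lemma common_sum: "(\<And>s. s \<in> S \<Longrightarrow> f s \<in> common) \<Longrightarrow> sum f S \<in> common"
  by (induction S rule: infinite_finite_induct) (auto intro: common_0 common_add)

lemma hz_br_A: "g \<in> carrier G \<Longrightarrow> h \<in> carrier G \<Longrightarrow> A.hz g x \<Longrightarrow> A.hz h y \<Longrightarrow> A.hz (g \<otimes> h) (br x y)"
proof -
  assume gh: "g \<in> carrier G" "h \<in> carrier G" and x: "A.hz g x" and "A.hz h y"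
  then obtain z where z: "z \<in> ZZ n" "y + z \<in> A h" by (auto simp: A.hz_def)
  have "br x (y + z) = br x y" using A.hz_UU[OF gh(1) x] z(1) by (simp add: br_add)
  then show ?thesis using A.hz_A[OF A.hz_br[OF gh x z(2)]] by simp
qed

lemma hz_br_B: "g \<in> carrier G \<Longrightarrow> h \<in> carrier G \<Longrightarrow> B.hz g x \<Longrightarrow> B.hz h y \<Longrightarrow> B.hz (g \<otimes> h) (br x y)"
proof -
  assume gh: "g \<in> carrier G" "h \<in> carrier G" and x: "B.hz g x" and "B.hz h y"
  then obtain z where z: "z \<in> ZZ n" "y + z \<in> B h" by (auto simp: B.hz_def)
  have "br x (y + z) = br x y" using B.hz_UU[OF gh(1) x] z(1) by (simp add: br_add)
  then show ?thesis using B.hz_A[OF B.hz_br[OF gh x z(2)]] by simp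
qed

lemma common_br: assumes "x \<in> common" "y \<in> common" shows "br x y \<in> common"
  using assms(1)
proof induction
  case (common_base g x)
  from assms(2) show ?case
  proof induction
    case (common_base h y)
    then show ?case using \<open>g \<in> carrier G\<close> \<open>A.hz g x\<close> \<open>B.hz g x\<close>
      by (intro common.common_base[of "g \<otimes> h"] hz_br_A hz_br_B) auto
  next
    case (common_add y y')
    then show ?case unfolding br_add by (intro common.common_add)
  qed
next
  case (common_add x x')
  then show ?case unfolding br_add by (intro common.common_add)
qed

lemma common_pr: assumes "x \<in> common" "g \<in> carrier G" shows "B.hz g (A.pr g x)"
  using assms(1)
proof induction
  case (common_base h x)
  obtain z where z: "z \<in> ZZ n" "x + z \<in> A h" using common_base(2) by (auto simp: A.hz_def)
  have xU: "x \<in> UU n" using A.hz_UU common_base by blast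
  have "A.pr g (x + z) = (if g = h then x + z else 0)" by (rule A.pr_hom[OF z(2) common_base(1)])
  then have e: "A.pr g x = (if g = h then x + z else 0) + - A.pr g z"
    using A.pr_add[OF xU ZZ_UU[OF z(1)], of g] by (simp add: algebra_simps)
  have pz: "- A.pr g z \<in> ZZ n" using A.pr_ZZ[OF z(1) assms(2)] by (rule ZZ_uminus)
  show ?case
  proof (cases "g = h")
    case True
    then have "B.hz g (x + z)" using B.hz_ZZ[OF common_base(3) z(1)] by simp
    then show ?thesis using e True B.hz_ZZ[OF _ pz] by simp
  next
    case False
    have "B.hz g 0" using assms(2) by (intro B.hz_A) simp
    from B.hz_ZZ[OF this pz] show ?thesis using e False by simp
  qed
next
  case (common_add x y)
  then obtain z w where "z \<in> ZZ n" "A.pr g x + z \<in> B g" "w \<in> ZZ n" "A.pr g y + w \<in> B g"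
    by (auto simp: B.hz_def)
  then have "(A.pr g x + A.pr g y) + (z + w) \<in> B g" "z + w \<in> ZZ n"
    using B.A_add[OF assms(2), of "A.pr g x + z" "A.pr g y + w"] ZZ_add by (simp_all add: add_ac)
  then have "B.hz g (A.pr g x + A.pr g y)" unfolding B.hz_def by blast
  then show ?case using A.pr_add common_UU common_add by simp
qed

text \<open>The diagonal units and the simple root vectors generate the algebra, so everything is a
  sum of elements with the same degree in both gradings modulo the centre; projecting to degree g
  finishes by \<open>common_pr\<close>.\<close>

theorem same_components:
  assumes units: "\<And>k. k < n \<Longrightarrow> unit_diag n k \<in> common"
    and roots: "\<And>i. Suc i < n \<Longrightarrow> ee i (Suc i) \<in> common"
    and g: "g \<in> carrier G" "x \<in> A g"
  shows "B.hz g x"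
proof -
  have e: "ee i (i + k) \<in> common" if "i + k < n" for i k
    using that
  proof (induction k arbitrary: i)
    case 0
    have "unit_diag n i = (ee i i :: 'f tm)" using 0 by (intro tm_eqI) (auto simp: unit_diag_def ee_def)
    then show ?case using units[of i] 0 by simp
  next
    case (Suc k)
    show ?case
    proof (cases k)
      case 0 then show ?thesis using roots Suc.prems by simp
    next
      case (Suc k')
      have "br (ee i (Suc i)) (ee (Suc i) (Suc i + k)) \<in> common"
        using roots[of i] Suc.IH[of "Suc i"] \<open>i + Suc k < n\<close> by (intro common_br) auto
      then show ?thesis using Suc by (simp add: ee_br)
    qed
  qed
  have xU: "x \<in> UU n" using A.A_UU g by blast
  have "x \<in> common"
  proof (subst NN_expand[OF xU], rule common_sum)
    fix p assume "p \<in> {(i, j). i + 0 \<le> j \<and> j < n}"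
    then obtain i j where p: "p = (i, j)" "i \<le> j" "j < n" by auto
    then have "ee i j \<in> common" using e[of i "j - i"] by simp
    then show "(case p of (i, j) \<Rightarrow> sc (x i j) (ee i j)) \<in> common" using p by (simp add: common_sc)
  qed
  from common_pr[OF this g(1)] show ?thesis using A.pr_hom[OF g(2,1), of g] by simp
qed

end

lemma rel_bt_set: "rel_bt R T T' \<Longrightarrow> h \<in> set_bt T' \<Longrightarrow> \<exists>g\<in>set_bt T. R g h"
  by (induction T T' rule: bt.rel_induct) auto

text \<open>Iterated brackets with degree t stay nonzero in A. By \<open>ad_vanishing\<close> degree
  t then carries a nonscalar diagonal in B, and besides the identity only t' can do so.\<close>

lemma same_type:
  assumes A: "normal_grading G n A t" and B: "normal_grading G n B t'" and same: "same_monomials G A B"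
    and t: "t \<noteq> \<one>\<^bsub>G\<^esub>"
  shows "t' = t"
proof -
  interpret A: normal_grading G n A t by (rule A)
  interpret B: normal_grading G n B t' by (rule B)
  obtain x where x: "x \<in> A t" "\<not> A.dconst x" using A.type t unfolding A.grading_type_def by blast
  \<comment> \<open>Needed so that the tree with n brackets is a \<open>Node\<close>, to which the
    hypothesis on monomials applies.\<close>
  then have "n > 0" unfolding A.dconst_def by auto
  then obtain k where k: "n = Suc k" by (cases n) auto
  obtain h where h: "h \<in> carrier G" "\<And>k. nonvanishing A (A.ad_bt t k h)"
    using A.ad_nonvanishing[OF A.tc x] by blast
  have "nonvanishing A (A.ad_bt t n h)" by (rule h(2))
  moreover have "set_bt (Leaf t) \<subseteq> carrier G" "set_bt (A.ad_bt t k h) \<subseteq> carrier G"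
    using A.set_ad_bt[of t k h] h(1) A.tc by auto
  ultimately have "nonvanishing B (A.ad_bt t n h)"
    using same unfolding same_monomials_def k A.ad_bt.simps by blast
  then obtain y where "y \<in> B t" "\<not> A.dconst y" using B.ad_vanishing[OF A.tc h(1)] by blast
  then show ?thesis using B.type A.tc t unfolding B.grading_type_def by blast
qed

locale two_normal = A: normal_grading G n A t + B: normal_grading G n B t
  for G :: "('g, 'm) monoid_scheme" (structure) and n and A B :: "'g \<Rightarrow> 'f::field tm set" and t +
  assumes same: "same_monomials G A B"
begin

sublocale two_gradings G n A B by unfold_locales

text \<open>A nonzero value in the coarse components of A contains a nonzero monomial in genuine
  components, with some leaves g replaced by t g. This monomial transfers to B, where coarsening
  undoes the replacement.\<close>

lemma labels_matches:
  assumes "n > 1" "matches T A.labels" shows "matches T B.labels"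
proof -
  have l: "leaves T = n - 1" using matches_leaves[OF assms(2)] by (simp add: A.labels_def)
  have "set_bt T = set A.labels" using matches_set[OF assms(2)] by simp
  then have s: "set_bt T \<subseteq> carrier G" "\<And>g. g \<in> set_bt T \<Longrightarrow> A.rep g = g"
    using A.lab assms(1) by (auto simp: A.labels_def)
  let ?N = "bracket_leaves \<one> T"
  have sN: "set_bt ?N \<subseteq> carrier G" using s(1) by (simp add: set_bracket_leaves)
  have "nonvanishing A.CC ?N" using A.labels_matches_iff[OF s l assms(1)] assms(2) by simp
  then obtain v where v: "v \<in> val A.CC ?N" "v \<noteq> 0" by (auto simp: nonvanishing_def)
  obtain T' where T': "rel_bt (\<lambda>g h. h = g \<or> h = t \<otimes> g) ?N T'" "nonvanishing A T'"
    using val_span_nonzero[OF A.val_CC_span[OF v(1) sN] v(2)] by blast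
  obtain l r where "?N = Node l r" using bracket_leaves_Node[of "\<one>" T] by blast
  then obtain l' r' where lr: "T' = Node l' r'" using T'(1) by (cases T') auto
  have "set_bt T' \<subseteq> carrier G"
  proof
    fix h assume "h \<in> set_bt T'"
    then obtain g where "g \<in> set_bt ?N" "h = g \<or> h = t \<otimes> g"
      using rel_bt_set[OF T'(1)] by blast
    then show "h \<in> carrier G" using sN by auto
  qed
  then have "nonvanishing B T'" using same T'(2) unfolding same_monomials_def lr by simp
  then obtain w where w: "w \<in> val B T'" "w \<noteq> 0" by (auto simp: nonvanishing_def)
  \<comment> \<open>The value \<open>UNIV\<close> outside \<open>carrier G\<close> makes the
    inclusion of leaf sets hold for all labels, as monotonicity requires.\<close>
  have "w \<in> val (\<lambda>g. if g \<in> carrier G then B.CC g else UNIV) ?N"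
    using w(1) val_mono_rel[OF T'(1), of B "\<lambda>g. if g \<in> carrier G then B.CC g else UNIV"] B.CC_A by fastforce
  moreover have "val (\<lambda>g. if g \<in> carrier G then C g else UNIV) S = val C S" if "set_bt S \<subseteq> carrier G"
    for S and C :: "'g \<Rightarrow> 'f tm set"
    using that by (induction S) auto
  ultimately have "nonvanishing B.CC ?N" using w(2) sN unfolding nonvanishing_def by auto
  then show ?thesis using B.labels_matches_iff[OF s l assms(1)] by simp
qed

end

lemma same_monomials_sym: "same_monomials G A B \<Longrightarrow> same_monomials G B A"
  by (simp add: same_monomials_def)

context two_normal
begin

lemma labels_eq_or_rev: assumes "n > 1" shows "B.labels = A.labels \<or> B.labels = rev A.labels"
proof (rule same_bt_imp_eq_or_rev)
  interpret S: two_normal G n B A t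
    by (intro two_normal.intro B.normal_grading_axioms A.normal_grading_axioms two_normal_axioms.intro
        same_monomials_sym[OF same])
  show "same_bt A.labels B.labels"
    unfolding same_bt_def using labels_matches[OF assms] S.labels_matches[OF assms] by blast
qed

lemma unit_common_1: assumes "t = \<one>" shows "unit_diag n k \<in> common"
  unfolding unit_diag_def using A.diag_degree_1[OF assms] B.diag_degree_1[OF assms]
  by (intro common_base[of \<one>]) auto

lemma B_hz_elementary:
  assumes t1: "t = \<one>" and n: "n > 1" and l: "B.labels = A.labels" and g: "g \<in> carrier G" "x \<in> A g"
  shows "B.hz g x"
proof (rule same_components[OF unit_common_1[OF t1] _ g])
  fix i assume i: "Suc i < n"
  then have "map B.lab [0..<n-1] ! i = map A.lab [0..<n-1] ! i" using l by (simp add: A.labels_def B.labels_def)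
  then have "B.lab i = A.lab i" using i by simp
  then show "ee i (Suc i) \<in> common"
    using A.root_degree_1[OF t1 i] B.root_degree_1[OF t1 i] A.lab(1)[OF i]
    by (intro common_base[of "A.lab i"] A.hz_A B.hz_A) auto
qed

end

section \<open>The flip automorphism and torus automorphisms\<close>

text \<open>The negative of reflection in the antidiagonal. The reflection reverses products, so its
  negative respects brackets.\<close>

definition flip :: "nat \<Rightarrow> 'f::field tm \<Rightarrow> 'f tm" where
  "flip n x = (\<lambda>i j. if i < n \<and> j < n then - x (n-1-j) (n-1-i) else 0)"

text \<open>Conjugation by the diagonal matrix with entries q.\<close>

definition torus :: "(nat \<Rightarrow> 'f::field) \<Rightarrow> 'f tm \<Rightarrow> 'f tm" where
  "torus q x = (\<lambda>i j. q i / q j * x i j)"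

lemma flip_UU: "x \<in> UU n \<Longrightarrow> flip n x \<in> UU n"
  unfolding NN_iff
proof (intro allI impI)
  fix i j assume x: "\<forall>i j. x i j \<noteq> 0 \<longrightarrow> i + 0 \<le> j \<and> j < n" and "flip n x i j \<noteq> 0"
  then have ij: "i < n" "j < n" "x (n-1-j) (n-1-i) \<noteq> 0" by (auto simp: flip_def split: if_splits)
  then have "n-1-j \<le> n-1-i" using x by fastforce
  then show "i + 0 \<le> j \<and> j < n" using ij by auto
qed

lemma flip_mm:
  assumes x: "x \<in> UU n" and y: "y \<in> UU n"
  shows "mm (flip n x) (flip n y) = - flip n (mm y x)"
proof (rule tm_eqI)
  fix i j
  show "mm (flip n x) (flip n y) i j = (- flip n (mm y x)) i j"
  proof (cases "i \<le> j \<and> j < n")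
    case True
    then have ij: "i \<le> j" "j < n" "i < n" by auto
    have "mm (flip n x) (flip n y) i j = (\<Sum>k\<in>{i..j}. y (n-1-j) (n-1-k) * x (n-1-k) (n-1-i))"
      unfolding mm_def by (rule sum.cong) (use ij in \<open>auto simp: flip_def\<close>)
    also have "\<dots> = (\<Sum>k\<in>{n-1-j..n-1-i}. y (n-1-j) k * x k (n-1-i))"
      by (rule sum.reindex_bij_witness[of _ "\<lambda>k. n-1-k" "\<lambda>k. n-1-k"]) (use ij in auto)
    finally show ?thesis using ij by (simp add: flip_def mm_def)
  next
    case False
    have U: "mm (flip n x) (flip n y) \<in> UU n" "flip n (mm y x) \<in> UU n" using x y by (simp_all add: flip_UU)
    show ?thesis using False NN_zero_entry[OF U(1), of i j] NN_zero_entry[OF U(2), of i j] by simp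
  qed
qed

lemma flip_flip: assumes "x \<in> UU n" shows "flip n (flip n x) = x"
proof (rule tm_eqI)
  fix i j
  show "flip n (flip n x) i j = x i j"
  proof (cases "i < n \<and> j < n")
    case False
    then show ?thesis using NN_zero_entry[OF assms, of i j] by (auto simp: flip_def)
  qed (auto simp: flip_def)
qed

lemma flip_add: "flip n (x + y) = flip n x + flip n y" by (intro tm_eqI) (simp add: flip_def)
lemma flip_sc: "flip n (sc a x) = sc a (flip n x)" by (intro tm_eqI) (simp add: flip_def)

lemma aut_flip: "aut n (flip n)"
  unfolding aut_def
proof (intro conjI ballI allI)
  show "bij_betw (flip n) (UU n) (UU n)"
    by (rule bij_betw_byWitness[where f' = "flip n"]) (auto simp: flip_flip flip_UU)
  fix x :: "'a tm" assume x: "x \<in> UU n"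
  show "flip n (sc a x) = sc a (flip n x)" for a by (rule flip_sc)
  fix y :: "'a tm" assume y: "y \<in> UU n"
  show "flip n (x + y) = flip n x + flip n y" by (rule flip_add)
  have "flip n (br x y) = flip n (mm x y) + flip n (sc (- 1) (mm y x))"
    unfolding br_def flip_add[symmetric] by (simp add: sc_uminus)
  also have "\<dots> = flip n (mm x y) - flip n (mm y x)" unfolding flip_sc by (simp add: sc_uminus)
  finally show "flip n (br x y) = br (flip n x) (flip n y)"
    unfolding br_def flip_mm[OF x y] flip_mm[OF y x] by simp
qed

lemma aut_torus: assumes q: "\<And>i. q i \<noteq> 0" shows "aut n (torus q)"
  unfolding aut_def
proof (intro conjI ballI allI)
  have U: "torus q' x \<in> UU n" if "x \<in> UU n" for q' and x :: "'a tm" using that by (auto simp: torus_def NN_iff)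
  have inv: "torus (\<lambda>i. 1 / q i) (torus q x) = x" "torus q (torus (\<lambda>i. 1 / q i) x) = x" for x
    by (intro tm_eqI; simp add: torus_def q)+
  show "bij_betw (torus q) (UU n) (UU n)"
    by (rule bij_betw_byWitness[where f' = "torus (\<lambda>i. 1 / q i)"]) (use inv U in blast)+
  fix x :: "'a tm" assume x: "x \<in> UU n"
  show "torus q (sc a x) = sc a (torus q x)" for a by (intro tm_eqI) (simp add: torus_def)
  fix y :: "'a tm" assume y: "y \<in> UU n"
  show "torus q (x + y) = torus q x + torus q y" by (intro tm_eqI) (simp add: torus_def algebra_simps)
  have m: "torus q (mm a b) = mm (torus q a) (torus q b)" for a b
    by (intro tm_eqI) (auto simp: torus_def mm_def sum_distrib_left q intro!: sum.cong)
  have "torus q (br x y) = torus q (mm x y) - torus q (mm y x)"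
    by (intro tm_eqI) (simp add: br_def torus_def algebra_simps)
  then show "torus q (br x y) = br (torus q x) (torus q y)" by (simp add: br_def m)
qed

lemma torus_diag: assumes "\<And>i. q i \<noteq> 0" shows "torus q (diag n f) = diag n f"
  using assms by (intro tm_eqI) (simp add: torus_def)
lemma torus_ee: "torus q (ee i j) = sc (q i / q j) (ee i j)"
  by (intro tm_eqI) (simp add: torus_def ee_def)
lemma flip_ee: "i < n \<Longrightarrow> j < n \<Longrightarrow> flip n (ee i j) = - ee (n-1-j) (n-1-i)"
  by (intro tm_eqI) (auto simp: flip_def ee_def)
lemma flip_diag: "flip n (diag n f) = diag n (\<lambda>i. - f (n-1-i))"
  by (intro tm_eqI) (auto simp: flip_def)

lemma val_image:
  assumes a: "aut n \<psi>" and B: "\<And>g. g \<in> set_bt T \<Longrightarrow> B g \<subseteq> UU n"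
  shows "val (\<lambda>g. \<psi> ` B g) T = \<psi> ` val B T \<and> val B T \<subseteq> UU n"
  using B
proof (induction T)
  case (Node l r)
  then have IH: "val (\<lambda>g. \<psi> ` B g) l = \<psi> ` val B l" "val B l \<subseteq> UU n"
    "val (\<lambda>g. \<psi> ` B g) r = \<psi> ` val B r" "val B r \<subseteq> UU n" by auto
  have U: "val B (Node l r) \<subseteq> UU n"
  proof
    fix w assume "w \<in> val B (Node l r)"
    then obtain x y where "w = br x y" "x \<in> UU n" "y \<in> UU n" using IH(2,4) by auto
    then show "w \<in> UU n" by simp
  qed
  have "val (\<lambda>g. \<psi> ` B g) (Node l r) = \<psi> ` val B (Node l r)"
  proof (intro subset_antisym subsetI)
    fix w assume "w \<in> val (\<lambda>g. \<psi> ` B g) (Node l r)"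
    then obtain x y where xy: "x \<in> val B l" "y \<in> val B r" "w = br (\<psi> x) (\<psi> y)" using IH by auto
    then have "w = \<psi> (br x y)" using aut_br[OF a, of x y] subsetD[OF IH(2)] subsetD[OF IH(4)] by simp
    then show "w \<in> \<psi> ` val B (Node l r)" using xy by auto
  next
    fix w assume "w \<in> \<psi> ` val B (Node l r)"
    then obtain x y where xy: "x \<in> val B l" "y \<in> val B r" "w = \<psi> (br x y)" by auto
    then have "w = br (\<psi> x) (\<psi> y)" using aut_br[OF a, of x y] subsetD[OF IH(2)] subsetD[OF IH(4)] by simp
    then show "w \<in> val (\<lambda>g. \<psi> ` B g) (Node l r)" using xy IH by auto
  qed
  with U show ?case by blast
qed simp

lemma (in tri_grading) nonvanishing_image:
  assumes a: "aut n \<psi>" and T: "set_bt T \<subseteq> carrier G"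
  shows "nonvanishing (\<lambda>g. \<psi> ` A g) T = nonvanishing A T"
proof -
  have A: "\<And>g. g \<in> set_bt T \<Longrightarrow> A g \<subseteq> UU n" using T A_UU by blast
  note v = val_image[OF a, of T A, OF A]
  have "\<psi> w = 0 \<longleftrightarrow> w = 0" if "w \<in> val A T" for w
    using aut_inj[OF a, of w 0] aut_0[OF a] v that by auto
  then show ?thesis unfolding nonvanishing_def using v by auto
qed

lemma (in tri_grading) hz_image:
  assumes a: "aut n \<psi>" and g: "g \<in> carrier G" and x: "hz g x"
  shows "tri_grading.hz n (\<lambda>g. \<psi> ` A g) g (\<psi> x)"
proof -
  interpret I: tri_grading G n "\<lambda>g. \<psi> ` A g" by (rule image_grading[OF a])
  obtain z where z: "z \<in> ZZ n" "x + z \<in> A g" using x by (auto simp: hz_def)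
  have "\<psi> (x + z) = \<psi> x + \<psi> z" using aut_add[OF a hz_UU[OF g x] ZZ_UU[OF z(1)]] .
  then have "\<psi> x + \<psi> z \<in> \<psi> ` A g" using z(2) by (metis image_eqI)
  then show ?thesis unfolding I.hz_def using aut_ZZ[OF a z(1)] by blast
qed

section \<open>The degree of the middle root vector\<close>

lemma foldl_br_add: "foldl br (x + y) ws = foldl br x ws + foldl br y ws"
  by (induction ws arbitrary: x y) (auto simp: br_add)

text \<open>Each bracket with the next simple root lengthens the interval by one; together with the
  downward version this brings a single root vector to the corner.\<close>

lemma foldl_br_roots_up:
  assumes "c < m" shows "foldl br (ee c (Suc c)) (map (\<lambda>i. ee i (Suc i)) [Suc c..<m]) = ee c m"
  using assms
proof (induction m)
  case (Suc m)
  then show ?case by (cases "c < m") (auto simp: ee_br less_Suc_eq)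
qed simp

lemma foldl_br_roots_down:
  assumes "j < k" "w = ee j k \<or> w = - ee j k"
  shows "foldl br w (map (\<lambda>i. ee i (Suc i)) (rev [0..<j])) \<in> {ee 0 k, - ee 0 k}"
  using assms
proof (induction j arbitrary: w)
  case (Suc j)
  have "br (ee (Suc j) k) (ee j (Suc j)) = - (ee j k :: 'a tm)" using Suc.prems by (simp add: ee_br)
  then have "br w (ee j (Suc j)) = ee j k \<or> br w (ee j (Suc j)) = - ee j k"
    using Suc.prems(2) by (auto simp: br_uminus)
  then show ?case using Suc.IH[of "br w (ee j (Suc j))"] Suc.prems by simp
qed auto

lemma NN_last:
  assumes "w \<in> NN n (n - 1)" "n > 0" shows "w = sc (w 0 (n - 1)) (ee 0 (n - 1))"
proof (rule tm_eqI)
  fix i j show "w i j = sc (w 0 (n - 1)) (ee 0 (n - 1)) i j"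
  proof (cases "i = 0 \<and> j = n - 1")
    case False
    then have "\<not> (i + (n - 1) \<le> j \<and> j < n)" using assms(2) by linarith
    then show ?thesis using NN_zero_entry[OF assms(1)] False by (auto simp: ee_def)
  qed (simp add: ee_def)
qed

lemma (in group) foldl_mult_closed:
  "x \<in> carrier G \<Longrightarrow> set hs \<subseteq> carrier G \<Longrightarrow> foldl (\<otimes>) x hs \<in> carrier G"
  by (induction hs arbitrary: x) auto

lemma (in group) foldl_mult_cancel:
  "x \<in> carrier G \<Longrightarrow> y \<in> carrier G \<Longrightarrow> set hs \<subseteq> carrier G \<Longrightarrow> foldl (\<otimes>) x hs = foldl (\<otimes>) y hs \<Longrightarrow> x = y"
proof (induction hs arbitrary: x y)
  case (Cons h hs)
  then have "x \<otimes> h = y \<otimes> h" by simp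
  then show ?case using Cons.prems by simp
qed simp

context two_gradings
begin

text \<open>A fixed element \<open>\<rho>\<close> of degree \<open>\<one>\<close> in both gradings acts as the identity on simple root vectors.
  The degree of a product that contains the root vector \<open>e\<close> once, and otherwise elements of the same degree
  in both gradings, determines the degree of \<open>e\<close>.\<close>

lemma single_root_degree:
  assumes sameAB: "same_monomials G A B" and n: "n > 0"
    and \<rho>: "A.hz \<one> \<rho>" "B.hz \<one> \<rho>"
    and e: "\<kappa> \<in> carrier G" "e \<in> A \<kappa>" "\<kappa>' \<in> carrier G" "e \<in> B \<kappa>'" "br \<rho> e = e"
    and ws: "\<And>w. w \<in> set ws \<Longrightarrow> \<exists>h h' p p'. h \<in> carrier G \<and> h' \<in> carrier G \<and> w = p + p' \<and>
      p \<in> A h \<and> p \<in> B h \<and> br \<rho> p = p \<and> p' \<in> A h' \<and> p' \<in> B h' \<and> br \<rho> p' = p'"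
    and nz: "foldl br e ws \<noteq> 0" and len: "length ws = n - 2" "n \<ge> 2"
  shows "\<kappa> = \<kappa>'"
proof -
  define good where "good h x \<longleftrightarrow> h \<in> carrier G \<and> x \<in> A h \<and> x \<in> B h \<and> br \<rho> x = x" for h x
  \<comment> \<open>Each factor is a sum of two good summands, and by additivity one of them keeps
    the iterated bracket nonzero.\<close>
  have "\<exists>hs xs. list_all2 good hs xs \<and> length xs = length ws \<and> foldl br z xs \<noteq> 0"
    if "foldl br z ws \<noteq> 0" for z
    using ws that
  proof (induction ws arbitrary: z)
    case Nil
    then show ?case by (intro exI[of _ "[]"]) auto
  next
    case (Cons w ws)
    obtain h h' p p' where p: "good h p" "good h' p'" "w = p + p'"
      using Cons.prems(1)[of w] unfolding good_def by auto
    have "foldl br (br z p) ws + foldl br (br z p') ws \<noteq> 0"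
      using Cons.prems(2) by (simp add: p(3) br_add foldl_br_add)
    then consider "foldl br (br z p) ws \<noteq> 0" | "foldl br (br z p') ws \<noteq> 0" by fastforce
    then show ?case
    proof cases
      case 1
      then obtain hs xs where "list_all2 good hs xs" "length xs = length ws" "foldl br (br z p) xs \<noteq> 0"
        using Cons.IH[of "br z p"] Cons.prems(1) by auto
      then show ?thesis using p by (intro exI[of _ "h # hs"] exI[of _ "p # xs"]) simp
    next
      case 2
      then obtain hs xs where "list_all2 good hs xs" "length xs = length ws" "foldl br (br z p') xs \<noteq> 0"
        using Cons.IH[of "br z p'"] Cons.prems(1) by auto
      then show ?thesis using p by (intro exI[of _ "h' # hs"] exI[of _ "p' # xs"]) simp
    qed
  qed
  then obtain hs xs where hx: "list_all2 good hs xs" and lx: "length xs = length ws" and nz': "foldl br e xs \<noteq> 0"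
    using nz by blast
  have lh: "length hs = n - 2" using list_all2_lengthD[OF hx] lx len by simp
  have hsc: "set hs \<subseteq> carrier G" using hx by (auto simp: list_all2_conv_all_nth in_set_conv_nth good_def)
  \<comment> \<open>The extra bracket forces strictly upper triangular values in B, so that n - 1
    factors end in the corner. In A it costs nothing, because \<rho> has degree
    \<open>\<one>\<close> modulo the centre and fixes the chosen factors.\<close>
  define L where "L = (\<lambda>h. Node (Leaf \<one>) (Leaf h))"
  define T where "T = foldl Node (L \<kappa>) (map L hs)"
  have \<rho>U: "\<rho> \<in> UU n" using A.hz_UU[OF A.one_closed \<rho>(1)] .
  have inL: "x \<in> val A (L h)" if "h \<in> carrier G" "x \<in> A h" "br \<rho> x = x" for h x
  proof -
    obtain z where z: "z \<in> ZZ n" "\<rho> + z \<in> A \<one>" using \<rho>(1) by (auto simp: A.hz_def)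
    have "br (\<rho> + z) x = x" using that A.A_UU z(1) by (simp add: br_add)
    then show ?thesis unfolding L_def using that(2) z(2) by force
  qed
  have valT: "foldl br x0 ys \<in> val A (foldl Node T0 (map L ks))"
    if "list_all2 good ks ys" "x0 \<in> val A T0" for ks ys x0 T0
    using that
  proof (induction arbitrary: x0 T0 rule: list_all2_induct)
    case (Cons k ks y ys)
    have "y \<in> val A (L k)" using inL Cons(1) unfolding good_def by blast
    then have "br x0 y \<in> val A (Node T0 (L k))" using Cons.prems by auto
    then show ?case using Cons.IH by simp
  qed simp
  have "foldl br e xs \<in> val A T" unfolding T_def by (rule valT[OF hx inL[OF e(1,2,5)]])
  then have nvA: "nonvanishing A T" using nz' unfolding nonvanishing_def by blast
  have nodeT: "(\<exists>l r. foldl Node (L k) Ts = Node l r)" for k Ts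
    by (induction Ts rule: rev_induct) (auto simp: L_def)
  have setT: "set_bt (foldl Node T0 (map L ks)) \<subseteq> carrier G" if "set_bt T0 \<subseteq> carrier G" "set ks \<subseteq> carrier G" for ks T0
    using that by (induction ks arbitrary: T0) (auto simp: L_def)
  have "set_bt T \<subseteq> carrier G" unfolding T_def using e(1) hsc by (intro setT) (auto simp: L_def)
  then have "nonvanishing B T"
    using sameAB nvA nodeT[of \<kappa> "map L hs"] unfolding same_monomials_def T_def by auto
  then obtain w where w: "w \<in> val B T" "w \<noteq> 0" by (auto simp: nonvanishing_def)
  have inL': "val B (L h) \<subseteq> NN n 1 \<inter> B h" if "h \<in> carrier G" for h
  proof
    fix x assume "x \<in> val B (L h)"
    then obtain a b where ab: "a \<in> B \<one>" "b \<in> B h" "x = br a b" by (auto simp: L_def)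
    then have "x \<in> NN n 1" using br_UU_UU[OF B.A_UU[OF A.one_closed ab(1)] B.A_UU[OF that ab(2)]] by simp
    moreover have "x \<in> B h" using B.A_br[OF _ that ab(1,2)] that ab(3) by simp
    ultimately show "x \<in> NN n 1 \<inter> B h" by simp
  qed
  have valB: "val B (foldl Node (L \<kappa>) (map L ks)) \<subseteq> NN n (1 + length ks) \<inter> B (foldl (\<otimes>) \<kappa> ks)"
    if "set ks \<subseteq> carrier G" for ks
    using that
  proof (induction ks rule: rev_induct)
    case Nil
    then show ?case using inL'[OF e(1)] by simp
  next
    case (snoc k ks)
    show ?case
    proof
      fix x assume "x \<in> val B (foldl Node (L \<kappa>) (map L (ks @ [k])))"
      then obtain a b where ab: "a \<in> val B (foldl Node (L \<kappa>) (map L ks))" "b \<in> val B (L k)" "x = br a b" by auto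
      then have a: "a \<in> NN n (1 + length ks)" "a \<in> B (foldl (\<otimes>) \<kappa> ks)" using snoc by auto
      have b: "b \<in> NN n 1" "b \<in> B k" using inL'[of k] ab(2) snoc.prems by auto
      have "foldl (\<otimes>) \<kappa> ks \<in> carrier G" using A.foldl_mult_closed[OF e(1)] snoc.prems by simp
      then show "x \<in> NN n (1 + length (ks @ [k])) \<inter> B (foldl (\<otimes>) \<kappa> (ks @ [k]))"
        using br_NN[OF a(1) b(1)] B.A_br[OF _ _ a(2) b(2)] snoc.prems by (simp add: ab(3))
    qed
  qed
  have valx: "foldl br x0 ys \<in> NN n (m + length ks) \<inter> B (foldl (\<otimes>) k0 ks)"
    if "list_all2 good ks ys" "x0 \<in> NN n m" "x0 \<in> B k0" "k0 \<in> carrier G" for ks ys x0 k0 m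
    using that
  proof (induction arbitrary: x0 k0 m rule: list_all2_induct)
    case (Cons k ks y ys)
    have y: "k \<in> carrier G" "y \<in> B k" "br \<rho> y = y" using Cons(1) by (auto simp: good_def)
    have "y \<in> NN n 1" using br_UU_UU[OF \<rho>U B.A_UU[OF y(1,2)]] unfolding y(3) .
    then have "br x0 y \<in> NN n (m + 1)" "br x0 y \<in> B (k0 \<otimes> k)"
      using br_NN[OF Cons.prems(1), of y 1] B.A_br[OF Cons.prems(3) y(1) Cons.prems(2) y(2)] by auto
    then show ?case using Cons.IH[of "br x0 y" "m + 1" "k0 \<otimes> k"] Cons.prems(3) y(1) by simp
  qed simp
  have eN: "e \<in> NN n 1" using br_UU_UU[OF \<rho>U A.A_UU[OF e(1,2)]] e(5) by simp
  \<comment> \<open>\<open>NN n (n - 1)\<close> is spanned by the corner vector, so any nonzero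
    homogeneous element there determines its degree.\<close>
  have last: "ee 0 (n - 1) \<in> B d" if "d \<in> carrier G" "v \<in> B d" "v \<in> NN n (n - 1)" "v \<noteq> 0" for v d
  proof -
    have v: "v = sc (v 0 (n - 1)) (ee 0 (n - 1))" using NN_last[OF that(3) n] .
    then have "v 0 (n - 1) \<noteq> 0" using that(4) by (metis sc_0(1))
    moreover have "sc (1 / v 0 (n - 1)) v \<in> B d" using B.A_sc that by blast
    ultimately show ?thesis using v by (metis nonzero_divide_eq_eq sc_1 sc_sc)
  qed
  have n2: "1 + length hs = n - 1" using lh len by simp
  have d: "foldl (\<otimes>) \<kappa> hs \<in> carrier G" "foldl (\<otimes>) \<kappa>' hs \<in> carrier G"
    using A.foldl_mult_closed e hsc by auto
  \<comment> \<open>The corner vector receives two degrees in B: one from the monomial with leaf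
    \<kappa>, transferred from A, and one from the iterated bracket starting at e, which has degree
    \<kappa>' in B. Cancelling the common right factors gives the claim.\<close>
  have "ee 0 (n - 1) \<in> B (foldl (\<otimes>) \<kappa> hs)"
    using last[OF d(1), of w] w valB[OF hsc] n2 unfolding T_def by auto
  moreover have "ee 0 (n - 1) \<in> B (foldl (\<otimes>) \<kappa>' hs)"
    using last[OF d(2), of "foldl br e xs"] nz' valx[OF hx eN e(4,3)] n2 by auto
  ultimately have "foldl (\<otimes>) \<kappa> hs = foldl (\<otimes>) \<kappa>' hs"
    using B.pr_hom[of "ee 0 (n - 1)" "foldl (\<otimes>) \<kappa> hs" "foldl (\<otimes>) \<kappa> hs"]
      B.pr_hom[of "ee 0 (n - 1)" "foldl (\<otimes>) \<kappa>' hs" "foldl (\<otimes>) \<kappa> hs"] d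
    by (metis ee_nonzero)
  then show ?thesis using A.foldl_mult_cancel[OF e(1,3) hsc] by blast
qed

end

section \<open>Aligning two gradings in normal form\<close>

context two_normal
begin

lemma align_elementary:
  assumes t1: "t = \<one>"
  shows "\<exists>\<psi>. aut n \<psi> \<and> (\<forall>g\<in>carrier G. \<forall>x\<in>A g. B.hz g (\<psi> x))"
proof (cases "n > 1")
  case False
  have "B.hz g x" if "g \<in> carrier G" "x \<in> A g" for g x
    by (rule same_components[OF unit_common_1[OF t1] _ that]) (use False in auto)
  then show ?thesis using aut_id by blast
next
  case n: True
  from labels_eq_or_rev[OF n] show ?thesis
  proof
    assume "B.labels = A.labels"
    then show ?thesis using B_hz_elementary[OF t1 n] aut_id by blast
  next
    assume l: "B.labels = rev A.labels"
    interpret F: tri_grading G n "\<lambda>g. flip n ` A g" by (rule A.image_grading[OF aut_flip])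
    interpret FB: two_gradings G n "\<lambda>g. flip n ` A g" B by unfold_locales
    have "B.hz g x" if g: "g \<in> carrier G" "x \<in> flip n ` A g" for g x
    proof (rule FB.same_components[OF _ _ g])
      fix k assume k: "k < n"
      have "unit_diag n k = flip n (diag n (\<lambda>l. - (if n - 1 - l = k then 1 else 0 :: 'f)))"
        unfolding flip_diag by (intro tm_eqI) (auto simp: unit_diag_def)
      then have "F.hz \<one> (unit_diag n k)"
        using A.hz_image[OF aut_flip A.one_closed A.diag_degree_1[OF t1]] by metis
      moreover have "B.hz \<one> (unit_diag n k)" unfolding unit_diag_def by (rule B.diag_degree_1[OF t1])
      ultimately show "unit_diag n k \<in> FB.common" by (intro FB.common_base[of \<one>]) auto
    next
      fix i assume i: "Suc i < n"
      then have j: "Suc (n - 2 - i) < n" by simp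
      have "map B.lab [0..<n-1] ! i = rev (map A.lab [0..<n-1]) ! i" using l by (simp add: A.labels_def B.labels_def)
      then have lab: "B.lab i = A.lab (n - 2 - i)" using i by (simp add: rev_nth)
      have "- (ee (n - 2 - i) (Suc (n - 2 - i)) :: 'f tm) \<in> A (B.lab i)"
        unfolding lab using A.root_degree_1[OF t1 j] A.lab(1)[OF j] by (intro A.A_uminus)
      then have "flip n (- (ee (n - 2 - i) (Suc (n - 2 - i)) :: 'f tm)) \<in> flip n ` A (B.lab i)" by (rule imageI)
      moreover have "flip n (- (ee (n - 2 - i) (Suc (n - 2 - i)) :: 'f tm)) = ee i (Suc i)"
      proof -
        have "flip n (sc (- 1) (ee (n - 2 - i) (Suc (n - 2 - i)) :: 'f tm)) = sc (- 1) (- ee (n - 1 - Suc (n - 2 - i)) (n - 1 - (n - 2 - i)))"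
          unfolding flip_sc using i by (subst flip_ee) auto
        moreover have "n - 1 - Suc (n - 2 - i) = i" "n - 1 - (n - 2 - i) = Suc i" using i by auto
        ultimately show ?thesis by (simp add: sc_uminus)
      qed
      ultimately have "ee i (Suc i) \<in> flip n ` A (B.lab i)" by simp
      then show "ee i (Suc i) \<in> FB.common"
        using B.root_degree_1[OF t1 i] B.lab(1)[OF i] by (intro FB.common_base[of "B.lab i"] F.hz_A B.hz_A)
    qed
    then have "B.hz g (flip n x)" if "g \<in> carrier G" "x \<in> A g" for g x using that by blast
    then show ?thesis using aut_flip by blast
  qed
qed

text \<open>If \<open>t \<noteq> \<one>\<close>, a torus automorphism matches the coefficients \<open>c\<close> of the homogeneous root vectors
  \<open>e\<^sub>i + c e\<^sub>i\<^sub>*\<close> with \<open>i* = n - 2 - i \<noteq> i\<close>.\<close>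

lemma align_flip_type:
  assumes t1: "t \<noteq> \<one>"
  shows "\<exists>\<psi>. aut n \<psi> \<and> (\<forall>g\<in>carrier G. \<forall>x\<in>A g. B.hz g (\<psi> x))"
proof -
  have n0: "n > 1"
  proof (rule ccontr)
    assume "\<not> n > 1"
    then have "i = j" if "i < n" "j < n" for i j using that by linarith
    then have "A.dconst x" for x unfolding A.dconst_def by metis
    then show False using A.type t1 unfolding A.grading_type_def by blast
  qed
  have two: "(2::'f) \<noteq> 0" by (rule A.two_neq[OF t1])
  \<comment> \<open>Mirror roots have equal labels, so the word is a palindrome and its reversal
    gives no second case.\<close>
  have flipA: "rev A.labels = A.labels"
  proof (rule nth_equalityI)
    fix i assume "i < length (rev A.labels)"
    then have i: "Suc i < n" by (simp add: A.labels_def)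
    then show "rev A.labels ! i = A.labels ! i" using A.lab_flip[OF t1 i] by (simp add: A.labels_def rev_nth)
  qed simp
  then have "B.labels = A.labels" using labels_eq_or_rev[OF n0] by metis
  then have lab: "B.lab i = A.lab i" if "Suc i < n" for i
  proof -
    have "map B.lab [0..<n-1] ! i = map A.lab [0..<n-1] ! i"
      using arg_cong[OF \<open>B.labels = A.labels\<close>, of "\<lambda>l. l ! i"] unfolding A.labels_def B.labels_def .
    then show ?thesis using that by simp
  qed
  let ?e = "\<lambda>i. ee i (Suc i) :: 'f tm"
  have star: "ee (n-2-i) (n-1-i) = ?e (n-2-i)" if "Suc i < n" for i
  proof -
    have "n - 1 - i = Suc (n - 2 - i)" using that by simp
    then show ?thesis by simp
  qed
  have "\<exists>c. c \<noteq> 0 \<and> ?e i + sc c (?e (n-2-i)) \<in> A (A.lab i) \<and> ?e i - sc c (?e (n-2-i)) \<in> A (t \<otimes> A.lab i)"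
    if "Suc i < n" "n - 2 - i \<noteq> i" for i
    using A.root_pair[OF t1 that] unfolding star[OF that(1)] .
  then obtain cA where cA: "\<And>i. Suc i < n \<Longrightarrow> n - 2 - i \<noteq> i \<Longrightarrow> cA i \<noteq> 0 \<and>
      ?e i + sc (cA i) (?e (n-2-i)) \<in> A (A.lab i) \<and> ?e i - sc (cA i) (?e (n-2-i)) \<in> A (t \<otimes> A.lab i)"
    by metis
  have "\<exists>c. c \<noteq> 0 \<and> ?e i + sc c (?e (n-2-i)) \<in> B (A.lab i) \<and> ?e i - sc c (?e (n-2-i)) \<in> B (t \<otimes> A.lab i)"
    if "Suc i < n" "n - 2 - i \<noteq> i" for i
    using B.root_pair[OF t1 that] unfolding star[OF that(1)] lab[OF that(1)] .
  then obtain cB where cB: "\<And>i. Suc i < n \<Longrightarrow> n - 2 - i \<noteq> i \<Longrightarrow> cB i \<noteq> 0 \<and>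
      ?e i + sc (cB i) (?e (n-2-i)) \<in> B (A.lab i) \<and> ?e i - sc (cB i) (?e (n-2-i)) \<in> B (t \<otimes> A.lab i)"
    by metis
  \<comment> \<open>Only the larger index of each mirror pair is rescaled, which turns the
    coefficient \<open>cA\<close> into \<open>cB\<close>. The middle root gets the factor 1 and
    stays fixed.\<close>
  define lam where "lam l = (if Suc l < n \<and> n - 2 - l < l then cB (n-2-l) / cA (n-2-l) else 1)" for l
  have lam0: "lam l \<noteq> 0" for l
  proof (cases "Suc l < n \<and> n - 2 - l < l")
    case True
    then have "Suc (n - 2 - l) < n" "n - 2 - (n - 2 - l) \<noteq> n - 2 - l" by auto
    then have "cA (n - 2 - l) \<noteq> 0" "cB (n - 2 - l) \<noteq> 0" using cA cB by blast+
    then show ?thesis by (simp add: lam_def)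
  qed (simp only: lam_def if_False; simp)
  \<comment> \<open>Consecutive quotients telescope, so conjugation by q scales the i-th simple root
    vector by \<open>lam i\<close>.\<close>
  define q where "q j = (\<Prod>l<j. inverse (lam l))" for j
  have q0: "q j \<noteq> 0" for j using lam0 by (simp add: q_def)
  have qlam: "q i / q (Suc i) = lam i" for i
  proof -
    have "q (Suc i) = q i * inverse (lam i)" by (simp add: q_def)
    then have "q i = lam i * q (Suc i)" using lam0[of i] by simp
    then show ?thesis using q0[of "Suc i"] by simp
  qed
  define \<psi> where "\<psi> = (torus q :: 'f tm \<Rightarrow> 'f tm)"
  have a: "aut n \<psi>" unfolding \<psi>_def by (rule aut_torus[OF q0])
  have \<psi>e: "\<psi> (?e i) = sc (lam i) (?e i)" for i unfolding \<psi>_def torus_ee qlam ..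
  have \<psi>d: "\<psi> (diag n f) = diag n f" for f unfolding \<psi>_def by (rule torus_diag[OF q0])
  interpret P: tri_grading G n "\<lambda>g. \<psi> ` A g" by (rule A.image_grading[OF a])
  interpret PB: two_gradings G n "\<lambda>g. \<psi> ` A g" B by unfold_locales
  have hzP: "P.hz g (diag n f)" if "g \<in> carrier G" "A.hz g (diag n f)" for g f
    using A.hz_image[OF a that] \<psi>d by simp
  have units: "unit_diag n k \<in> PB.common" if k: "k < n" for k
  proof -
    let ?f = "\<lambda>l. (if l = k then 1 else 0) - (if l = n-1-k then 1 else 0) :: 'f"
    let ?g = "\<lambda>l. (if l = k then 1 else 0) + (if l = n-1-k then 1 else 0) :: 'f"
    have "A.hz \<one> (diag n ?f)" "B.hz \<one> (diag n ?f)"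
      by (rule A.diag_degree_t(1)[OF t1] B.diag_degree_t(1)[OF t1]; use k in auto)+
    then have "diag n ?f \<in> PB.common" by (intro PB.common_base[of \<one>] hzP) auto
    moreover have "A.hz t (diag n ?g)" "B.hz t (diag n ?g)"
      by (rule A.diag_degree_t(2)[OF t1] B.diag_degree_t(2)[OF t1]; use k in auto)+
    then have "diag n ?g \<in> PB.common" by (intro PB.common_base[of t] hzP) auto
    ultimately have "sc (1/2) (diag n ?f + diag n ?g) \<in> PB.common" by (intro PB.common_sc PB.common_add)
    moreover have "sc (1/2) (diag n ?f + diag n ?g) = unit_diag n k"
      using two by (intro tm_eqI) (auto simp: unit_diag_def)
    ultimately show ?thesis by simp
  qed
  have uv: "?e i + sc (cB i) (?e (n-2-i)) \<in> \<psi> ` A (A.lab i)" "?e i - sc (cB i) (?e (n-2-i)) \<in> \<psi> ` A (t \<otimes> A.lab i)"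
    if i: "Suc i < n" "i < n - 2 - i" for i
  proof -
    have ne: "n - 2 - i \<noteq> i" using i by simp
    have eU: "?e i \<in> UU n" "?e (n-2-i) \<in> UU n" using i by auto
    have j: "n - 2 - (n - 2 - i) = i" "Suc (n - 2 - i) < n" using i by auto
    have l: "lam i = 1" "lam (n-2-i) = cB i / cA i" using i j by (auto simp: lam_def)
    have s: "\<psi> (sc (cA i) (?e (n-2-i))) = sc (cB i) (?e (n-2-i))"
      unfolding aut_sc[OF a eU(2)] \<psi>e l(2) sc_sc using cA[OF i(1) ne] by simp
    have "\<psi> (?e i + sc (cA i) (?e (n-2-i))) = ?e i + sc (cB i) (?e (n-2-i))"
      using aut_add[OF a eU(1), of "sc (cA i) (?e (n-2-i))"] eU s \<psi>e[of i] l(1) by simp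
    then show "?e i + sc (cB i) (?e (n-2-i)) \<in> \<psi> ` A (A.lab i)" using cA[OF i(1) ne] by (metis image_eqI)
    have "\<psi> (?e i - sc (cA i) (?e (n-2-i))) = ?e i - sc (cB i) (?e (n-2-i))"
      using aut_diff[OF a eU(1), of "sc (cA i) (?e (n-2-i))"] eU s \<psi>e[of i] l(1) by simp
    then show "?e i - sc (cB i) (?e (n-2-i)) \<in> \<psi> ` A (t \<otimes> A.lab i)" using cA[OF i(1) ne] by (metis image_eqI)
  qed
  \<comment> \<open>The antisymmetric diagonal with constant step 1: it has degree
    \<open>\<one>\<close> modulo the centre in both gradings and fixes every simple root vector,
    including those of a mirror pair.\<close>
  define \<rho> where "\<rho> = diag n (\<lambda>i. (of_nat (n-1-i) - of_nat i) / 2 :: 'f)"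
  have \<rho>hz: "A.hz \<one> \<rho>" "B.hz \<one> \<rho>"
    unfolding \<rho>_def by (rule A.diag_degree_t(1)[OF t1] B.diag_degree_t(1)[OF t1]; simp add: minus_divide_left)+
  have \<rho>P: "P.hz \<one> \<rho>" using hzP[OF A.one_closed] \<rho>hz(1) unfolding \<rho>_def by blast
  have \<rho>e: "br \<rho> (?e i) = ?e i" if i: "Suc i < n" for i
  proof -
    have "?e i \<in> UU n" using i by auto
    note b = diag_br[OF this, of "\<lambda>i. (of_nat (n-1-i) - of_nat i) / 2"]
    have "n - 1 - i = Suc (n - 1 - Suc i)" using i by simp
    then have "(of_nat (n-1-i) - of_nat i) / 2 - (of_nat (n-1-Suc i) - of_nat (Suc i)) / 2 = (1::'f)"
      using two by (simp add: diff_divide_distrib[symmetric] algebra_simps)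
    then show ?thesis unfolding \<rho>_def b by (intro tm_eqI) (simp add: ee_def)
  qed
  have split: "\<exists>h h' p p'. h \<in> carrier G \<and> h' \<in> carrier G \<and> ?e i = p + p' \<and>
      p \<in> \<psi> ` A h \<and> p \<in> B h \<and> br \<rho> p = p \<and> p' \<in> \<psi> ` A h' \<and> p' \<in> B h' \<and> br \<rho> p' = p'"
    if i: "Suc i < n" "n - 2 - i \<noteq> i" for i
  proof -
    define k where "k = min i (n - 2 - i)"
    have k: "Suc k < n" "k < n - 2 - k" using i by (auto simp: k_def min_def)
    have k': "n - 2 - k \<noteq> k" "Suc (n - 2 - k) < n" using k by auto
    have ki: "i = k \<or> i = n - 2 - k" using i by (auto simp: k_def min_def)
    have lc: "A.lab k \<in> carrier G" "t \<otimes> A.lab k \<in> carrier G" using A.lab(1)[OF k(1)] by auto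
    define u v where "u = ?e k + sc (cB k) (?e (n-2-k))" and "v = ?e k - sc (cB k) (?e (n-2-k))"
    have u: "u \<in> \<psi> ` A (A.lab k)" "u \<in> B (A.lab k)" and v: "v \<in> \<psi> ` A (t \<otimes> A.lab k)" "v \<in> B (t \<otimes> A.lab k)"
      using uv[OF k] cB[OF k(1) k'(1)] by (auto simp: u_def v_def)
    have r: "br \<rho> u = u" "br \<rho> v = v"
      using \<rho>e[OF k(1)] \<rho>e[OF k'(2)] by (simp_all add: u_def v_def br_add br_diff br_sc)
    have main: "\<exists>h h' p p'. h \<in> carrier G \<and> h' \<in> carrier G \<and> ?e i = p + p' \<and>
      p \<in> \<psi> ` A h \<and> p \<in> B h \<and> br \<rho> p = p \<and> p' \<in> \<psi> ` A h' \<and> p' \<in> B h' \<and> br \<rho> p' = p'"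
      if "?e i = sc b u + sc b' v" for b b'
      using lc u v r that P.A_sc[OF lc(1) u(1)] B.A_sc[OF lc(1) u(2)] P.A_sc[OF lc(2) v(1)] B.A_sc[OF lc(2) v(2)]
      by (intro exI[of _ "A.lab k"] exI[of _ "t \<otimes> A.lab k"] exI[of _ "sc b u"] exI[of _ "sc b' v"]) (simp add: br_sc)
    from ki show ?thesis
    proof
      assume "i = k"
      then have "?e i = sc (1/2) u + sc (1/2) v"
        using two by (intro tm_eqI) (simp add: u_def v_def field_simps)
      then show ?thesis by (rule main)
    next
      assume "i = n - 2 - k"
      then have "?e i = sc (1/(2 * cB k)) u + sc (- (1/(2 * cB k))) v"
      proof -
        have "u - v = sc (2 * cB k) (?e (n-2-k))" by (intro tm_eqI) (simp add: u_def v_def)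
        then have "sc (1/(2 * cB k)) (u - v) = ?e (n-2-k)" using two cB[OF k(1) k'(1)] by simp
        moreover have "sc (- (1/(2 * cB k))) v = - sc (1/(2 * cB k)) v" by (intro tm_eqI) simp
        ultimately show ?thesis using \<open>i = n - 2 - k\<close> by (simp add: sc_diff)
      qed
      then show ?thesis by (rule main)
    qed
  qed
  have roots: "?e i \<in> PB.common" if i: "Suc i < n" for i
  proof (cases "n - 2 - i = i")
    case False
    from split[OF i this] obtain h h' p p' where p: "h \<in> carrier G" "h' \<in> carrier G" "?e i = p + p'"
      "p \<in> \<psi> ` A h" "p \<in> B h" "p' \<in> \<psi> ` A h'" "p' \<in> B h'" by blast
    show ?thesis unfolding p(3)
      by (intro PB.common_add PB.common_base[of h p] PB.common_base[of h' p'] P.hz_A B.hz_A p)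
  next
    case c: True
    \<comment> \<open>The middle root has one degree in each grading, but equal labels identify
      these only up to t.\<close>
    obtain \<kappa> where \<kappa>: "\<kappa> \<in> carrier G" "?e i \<in> A \<kappa>" using A.root_center[OF t1 i c] by blast
    obtain \<kappa>' where \<kappa>': "\<kappa>' \<in> carrier G" "?e i \<in> B \<kappa>'" using B.root_center[OF t1 i c] by blast
    have "\<psi> (?e i) = ?e i" using c by (simp add: \<psi>e lam_def)
    then have \<kappa>P: "?e i \<in> \<psi> ` A \<kappa>" using \<kappa>(2) by (metis image_eqI)
    have sameP: "same_monomials G (\<lambda>g. \<psi> ` A g) B"
      unfolding same_monomials_def
    proof (intro allI impI)
      fix l r assume "set_bt l \<subseteq> carrier G" "set_bt r \<subseteq> carrier G"
      then show "nonvanishing (\<lambda>g. \<psi> ` A g) (Node l r) = nonvanishing B (Node l r)"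
        using A.nonvanishing_image[OF a, of "Node l r"] same unfolding same_monomials_def by simp
    qed
    \<comment> \<open>All other simple roots, those above i in rising order and then those below i
      in falling order; each extends the interval, up to the whole word.\<close>
    define ws where "ws = map ?e [Suc i..<n-1] @ map ?e (rev [0..<i])"
    have "foldl br (?e i) (map ?e [Suc i..<n-1]) = ee i (n-1)"
      by (rule foldl_br_roots_up) (use i in simp)
    then have "foldl br (?e i) ws \<in> {ee 0 (n-1), - ee 0 (n-1)}"
    proof -
      have "i < n - 1" using i by simp
      then show ?thesis using foldl_br_roots_down[of i "n-1" "ee i (n-1) :: 'f tm"] \<open>foldl br (?e i) _ = _\<close>
        by (simp add: ws_def)
    qed
    then have nz: "foldl br (?e i) ws \<noteq> 0" by (metis ee_nonzero empty_iff insert_iff neg_equal_0_iff_equal)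
    have len: "length ws = n - 2" using i by (simp add: ws_def)
    have "\<kappa> = \<kappa>'"
    proof (rule PB.single_root_degree[OF sameP _ \<rho>P \<rho>hz(2) \<kappa>(1) \<kappa>P \<kappa>' \<rho>e[OF i] _ nz len])
      fix w assume "w \<in> set ws"
      then have "w \<in> ?e ` ({Suc i..<n-1} \<union> {0..<i})" unfolding ws_def by auto
      then obtain j where j': "j \<in> {Suc i..<n-1} \<union> {0..<i}" "w = ?e j" by (rule imageE)
      then have j: "w = ?e j" "Suc j < n" "j \<noteq> i" using i by auto
      have "n - 2 - j \<noteq> j" using j c i by auto
      from split[OF j(2) this] show "\<exists>h h' p p'. h \<in> carrier G \<and> h' \<in> carrier G \<and> w = p + p' \<and>
          p \<in> \<psi> ` A h \<and> p \<in> B h \<and> br \<rho> p = p \<and> p' \<in> \<psi> ` A h' \<and> p' \<in> B h' \<and> br \<rho> p' = p'"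
        unfolding j(1) .
    qed (use n0 in simp_all)
    then show ?thesis using \<kappa>P \<kappa>' by (intro PB.common_base[of \<kappa>'] P.hz_A B.hz_A) auto
  qed
  have "B.hz g x" if "g \<in> carrier G" "x \<in> \<psi> ` A g" for g x
    by (rule PB.same_components[OF units roots that])
  then show ?thesis using a by blast
qed

theorem align: "\<exists>\<psi>. aut n \<psi> \<and> (\<forall>g\<in>carrier G. \<forall>x\<in>A g. B.hz g (\<psi> x))"
  using align_elementary align_flip_type by blast

end

section \<open>The normal form theorem\<close>

theorem (in tri_grading) normal_form_exists:
  "\<exists>\<psi> t. aut n \<psi> \<and> normal_grading G n (\<lambda>g. \<psi> ` A g) t"
proof -
  obtain \<psi> where \<psi>: "aut n \<psi>" "diag_graded G n (\<lambda>g. \<psi> ` A g) n" using diag_graded_exists by blast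
  interpret P: tri_grading G n "\<lambda>g. \<psi> ` A g" by (rule image_grading[OF \<psi>(1)])
  obtain t where "P.grading_type t" using P.grading_type_exists by blast
  then have "normal_grading G n (\<lambda>g. \<psi> ` A g) t" using \<psi>(2) by unfold_locales
  then show ?thesis using \<psi>(1) by blast
qed

text \<open>Automorphisms of the algebra preserve nonvanishing of monomials, so both gradings may be
  replaced by their normal forms; the alignment is then carried back by the inverse of the second
  normalisation.\<close>

theorem same_monomials_imp_isomorphic:
  assumes A: "tri_grading G n A" and B: "tri_grading G n B" and same: "same_monomials G A B"
  shows "\<exists>\<theta>. aut n \<theta> \<and> (\<forall>g\<in>carrier G. \<forall>x\<in>A g. tri_grading.hz n B g (\<theta> x))"
proof -
  interpret AA: tri_grading G n A by (rule A)
  interpret BB: tri_grading G n B by (rule B)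
  obtain \<phi> s where \<phi>: "aut n \<phi>" "normal_grading G n (\<lambda>g. \<phi> ` A g) s" using AA.normal_form_exists by blast
  obtain \<psi> t where \<psi>: "aut n \<psi>" "normal_grading G n (\<lambda>g. \<psi> ` B g) t" using BB.normal_form_exists by blast
  have s: "same_monomials G (\<lambda>g. \<phi> ` A g) (\<lambda>g. \<psi> ` B g)"
    unfolding same_monomials_def
  proof (intro allI impI)
    fix l r assume "set_bt l \<subseteq> carrier G" "set_bt r \<subseteq> carrier G"
    then show "nonvanishing (\<lambda>g. \<phi> ` A g) (Node l r) = nonvanishing (\<lambda>g. \<psi> ` B g) (Node l r)"
      using AA.nonvanishing_image[OF \<phi>(1), of "Node l r"] BB.nonvanishing_image[OF \<psi>(1), of "Node l r"] same
      unfolding same_monomials_def by simp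
  qed
  have "s = t"
    using same_type[OF \<phi>(2) \<psi>(2) s] same_type[OF \<psi>(2) \<phi>(2) same_monomials_sym[OF s]] by metis
  then interpret two_normal G n "\<lambda>g. \<phi> ` A g" "\<lambda>g. \<psi> ` B g" t
    using \<phi>(2) \<psi>(2) s by (intro two_normal.intro two_normal_axioms.intro) simp_all
  obtain \<chi> where \<chi>: "aut n \<chi>" "\<And>g x. g \<in> carrier G \<Longrightarrow> x \<in> \<phi> ` A g \<Longrightarrow> B.hz g (\<chi> x)"
    using align by blast
  define i where "i = inv_into (UU n) \<psi>"
  have i: "aut n i" unfolding i_def by (rule aut_inv[OF \<psi>(1)])
  have i\<psi>: "i (\<psi> x) = x" if "x \<in> UU n" for x
    unfolding i_def using \<psi>(1) that by (simp add: aut_def bij_betw_def)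
  have a: "aut n (\<lambda>x. i (\<chi> (\<phi> x)))" by (rule aut_comp[OF i aut_comp[OF \<chi>(1) \<phi>(1)]])
  have "BB.hz g (i (\<chi> (\<phi> x)))" if g: "g \<in> carrier G" "x \<in> A g" for g x
  proof -
    have U: "\<chi> (\<phi> x) \<in> UU n" by (rule aut_UU[OF \<chi>(1) aut_UU[OF \<phi>(1) AA.A_UU[OF g]]])
    obtain z where z: "z \<in> ZZ n" "\<chi> (\<phi> x) + z \<in> \<psi> ` B g"
      using \<chi>(2)[OF g(1), of "\<phi> x"] g(2) unfolding B.hz_def by blast
    then obtain b where b: "b \<in> B g" "\<chi> (\<phi> x) + z = \<psi> b" by blast
    have "i (\<chi> (\<phi> x)) + i z = i (\<psi> b)" using aut_add[OF i U ZZ_UU[OF z(1)]] b(2) by simp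
    then show ?thesis using b(1) i\<psi>[OF BB.A_UU[OF g(1) b(1)]] aut_ZZ[OF i z(1)] unfolding BB.hz_def by metis
  qed
  with a show ?thesis by blast
qed

section \<open>Passage to matrices and to the quotient by the centre\<close>

definition fm :: "nat \<Rightarrow> 'f::field mat \<Rightarrow> 'f tm" where
  "fm n X = (\<lambda>i j. if i < n \<and> j < n then X $$ (i, j) else 0)"

definition mf :: "nat \<Rightarrow> 'f::field tm \<Rightarrow> 'f mat" where
  "mf n x = mat n n (\<lambda>(i, j). x i j)"

abbreviation UT :: "nat \<Rightarrow> ('f::field, 'f mat) module" where
  "UT n \<equiv> UT_lie TYPE('f) n"

lemma fm_UU: "X \<in> carrier (UT n) \<Longrightarrow> fm n X \<in> UU n"
  by (auto simp: fm_def NN_iff upper_triangular_def split: if_splits) (meson leI)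

lemma mf_carrier: "x \<in> UU n \<Longrightarrow> mf n x \<in> carrier (UT n)"
  by (auto simp: mf_def NN_iff upper_triangular_def) (metis leD order.strict_trans)

lemma fm_mf: "x \<in> UU n \<Longrightarrow> fm n (mf n x) = x"
proof (intro tm_eqI)
  fix i j assume "x \<in> UU n"
  then show "fm n (mf n x) i j = x i j" using NN_zero_entry[of x n 0 i j] by (auto simp: fm_def mf_def)
qed

lemma mf_fm: "X \<in> carrier (UT n) \<Longrightarrow> mf n (fm n X) = X"
  by (intro eq_matI) (auto simp: fm_def mf_def)

lemma mf_add: "mf n (x + y) = mf n x + mf n y" by (intro eq_matI) (auto simp: mf_def)
lemma mf_sc: "mf n (sc a x) = a \<cdot>\<^sub>m mf n x" by (intro eq_matI) (auto simp: mf_def)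
lemma mf_0: "mf n 0 = 0\<^sub>m n n" by (intro eq_matI) (auto simp: mf_def)

lemma mf_mm:
  assumes "x \<in> UU n" "y \<in> UU n" shows "mf n (mm x y) = mf n x * mf n y"
proof (rule eq_matI)
  fix i j assume "i < dim_row (mf n x * mf n y)" "j < dim_col (mf n x * mf n y)"
  then have ij: "i < n" "j < n" by (auto simp: mf_def)
  have "(\<Sum>k\<in>{i..j}. x i k * y k j) = (\<Sum>k\<in>{0..<n}. x i k * y k j)"
  proof (rule sum.mono_neutral_left)
    show "\<forall>k\<in>{0..<n} - {i..j}. x i k * y k j = 0"
      using NN_zero_entry[OF assms(1), of i] NN_zero_entry[OF assms(2), of _ j] by force
  qed (use ij in auto)
  then show "mf n (mm x y) $$ (i, j) = (mf n x * mf n y) $$ (i, j)"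
    using ij by (simp add: mf_def mm_def scalar_prod_def)
qed (auto simp: mf_def)

lemma mf_br: "x \<in> UU n \<Longrightarrow> y \<in> UU n \<Longrightarrow> mf n (br x y) = mf n x \<otimes>\<^bsub>UT n\<^esub> mf n y"
  unfolding br_def UT_lie_simps mf_mm[symmetric] by (intro eq_matI) (auto simp: mf_def)

lemma mf_inj: "x \<in> UU n \<Longrightarrow> y \<in> UU n \<Longrightarrow> mf n x = mf n y \<Longrightarrow> x = y"
  by (metis fm_mf)

lemma mf_surj: "X \<in> carrier (UT n) \<Longrightarrow> \<exists>x\<in>UU n. X = mf n x"
  by (metis fm_UU mf_fm)

lemma mf_center: "x \<in> UU n \<Longrightarrow> mf n x \<in> lie_center (UT n) \<longleftrightarrow> x \<in> ZZ n"
proof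
  assume x: "x \<in> UU n" and c: "mf n x \<in> lie_center (UT n)"
  have "br x y = 0" if y: "y \<in> UU n" for y
  proof (rule mf_inj)
    show "mf n (br x y) = mf n 0"
      using c mf_carrier[OF y] unfolding mf_br[OF x y] mf_0 lie_center_def by simp
  qed (use x y in auto)
  then show "x \<in> ZZ n" using x unfolding ZZ_center by blast
next
  assume x: "x \<in> UU n" and z: "x \<in> ZZ n"
  have "mf n x \<otimes>\<^bsub>UT n\<^esub> Y = \<zero>\<^bsub>UT n\<^esub>" if Y: "Y \<in> carrier (UT n)" for Y
  proof -
    obtain y where y: "y \<in> UU n" "Y = mf n y" using mf_surj[OF Y] by blast
    then have "mf n x \<otimes>\<^bsub>UT n\<^esub> Y = mf n (br x y)" using mf_br[OF x y(1)] by simp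
    also have "\<dots> = mf n 0" using z y(1) by simp
    finally show ?thesis by (simp add: mf_0)
  qed
  then show "mf n x \<in> lie_center (UT n)" using mf_carrier[OF x] unfolding lie_center_def by blast
qed

lemma fm_finsum:
  fixes c :: "'g \<Rightarrow> 'f::field mat"
  assumes "finite S" "\<And>g. g \<in> S \<Longrightarrow> c g \<in> carrier (UT n)"
  shows "fm n (finsum (UT n) c S) = (\<Sum>g\<in>S. fm n (c g)) \<and> finsum (UT n) c S \<in> carrier (UT n)"
proof -
  interpret L: lie_algebra class_ring "UT n :: ('f, 'f mat) module" by (rule lie_algebra_UT_lie)
  show ?thesis using assms
  proof (induction S rule: finite_induct)
    case empty
    then show ?case using L.M.finsum_empty L.M.zero_closed by (auto simp: fm_def fun_eq_iff)
  next
    case (insert g S)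
    have cl: "c \<in> S \<rightarrow> carrier (UT n)" "c g \<in> carrier (UT n)" using insert.prems by auto
    have IH: "fm n (finsum (UT n) c S) = (\<Sum>g\<in>S. fm n (c g))" "finsum (UT n) c S \<in> carrier (UT n)"
      using insert by auto
    have e: "finsum (UT n) c (insert g S) = c g \<oplus>\<^bsub>UT n\<^esub> finsum (UT n) c S"
      by (rule L.M.finsum_insert[OF insert(1,2) cl])
    have "fm n (c g \<oplus>\<^bsub>UT n\<^esub> finsum (UT n) c S) = fm n (c g) + fm n (finsum (UT n) c S)"
      using cl(2) IH(2) by (intro tm_eqI) (auto simp: fm_def)
    then show ?case using e IH cl(2) L.M.a_closed insert(1,2) by (simp del: UT_lie_simps)
  qed
qed

lemma tri_grading_of_grading:
  fixes A :: "'g \<Rightarrow> 'f::field mat set"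
  assumes G: "group G" and gr: "grading G (UT n) A"
  shows "tri_grading G n (\<lambda>g. fm n ` A g)"
proof -
  interpret group G by (rule G)
  have sub: "A g \<subseteq> carrier (UT n)" "\<zero>\<^bsub>UT n\<^esub> \<in> A g"
    "X \<in> A g \<Longrightarrow> Y \<in> A g \<Longrightarrow> X \<oplus>\<^bsub>UT n\<^esub> Y \<in> A g" "X \<in> A g \<Longrightarrow> a \<odot>\<^bsub>UT n\<^esub> X \<in> A g"
    if "g \<in> carrier G" for g X Y a
  proof -
    have "VectorSpace.subspace class_ring (A g) (UT n)" using gr that unfolding grading_def by blast
    then have s: "submodule class_ring (A g) (UT n)" by (simp add: subspace_def)
    show "A g \<subseteq> carrier (UT n)" "\<zero>\<^bsub>UT n\<^esub> \<in> A g"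
      "X \<in> A g \<Longrightarrow> Y \<in> A g \<Longrightarrow> X \<oplus>\<^bsub>UT n\<^esub> Y \<in> A g" "X \<in> A g \<Longrightarrow> a \<odot>\<^bsub>UT n\<^esub> X \<in> A g"
      using submodule.subset[OF s] submodule.zero_closed[OF s] submodule.m_closed[OF s, of X Y]
        submodule.smult_closed[OF s, of a X] by simp_all
  qed
  have sum: "\<exists>!c. c \<in> (\<Pi>\<^sub>E g\<in>carrier G. A g) \<and> finite {g \<in> carrier G. c g \<noteq> \<zero>\<^bsub>UT n\<^esub>} \<and>
        X = (\<Oplus>\<^bsub>UT n\<^esub> g \<in> {g \<in> carrier G. c g \<noteq> \<zero>\<^bsub>UT n\<^esub>}. c g)" if "X \<in> carrier (UT n)" for X
    using gr that unfolding grading_def by blast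
  have fmadd: "fm n (X + Y) = fm n X + fm n Y" if "X \<in> carrier (UT n)" "Y \<in> carrier (UT n)" for X Y :: "'f mat"
    using that by (intro tm_eqI) (auto simp: fm_def)
  have fmsc: "fm n (a \<cdot>\<^sub>m X) = sc a (fm n X)" if "X \<in> carrier (UT n)" for X :: "'f mat" and a
    using that by (intro tm_eqI) (auto simp: fm_def)
  have fm0: "fm n (\<zero>\<^bsub>UT n\<^esub>) = (0 :: 'f tm)" by (intro tm_eqI) (simp add: fm_def)
  show ?thesis
  proof
    fix g assume g: "g \<in> carrier G"
    show "x \<in> UU n" if "x \<in> fm n ` A g" for x using that sub(1)[OF g] fm_UU by blast
    show "0 \<in> fm n ` A g" using sub(2)[OF g] fm0 by (metis image_eqI)
    show "x + y \<in> fm n ` A g" if xy: "x \<in> fm n ` A g" "y \<in> fm n ` A g" for x y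
    proof -
      obtain X Y where XY: "X \<in> A g" "Y \<in> A g" "x = fm n X" "y = fm n Y" using xy by blast
      then have "x + y = fm n (X \<oplus>\<^bsub>UT n\<^esub> Y)" using fmadd[of X Y] subsetD[OF sub(1)[OF g]] by simp
      then show ?thesis using sub(3)[OF g XY(1,2)] by blast
    qed
    show "sc a x \<in> fm n ` A g" if x: "x \<in> fm n ` A g" for a x
    proof -
      obtain X where X: "X \<in> A g" "x = fm n X" using x by blast
      then have "sc a x = fm n (a \<odot>\<^bsub>UT n\<^esub> X)" using fmsc[of X a] subsetD[OF sub(1)[OF g]] by simp
      then show ?thesis using sub(4)[OF g X(1)] by blast
    qed
    fix h assume h: "h \<in> carrier G"
    show "br x y \<in> fm n ` A (g \<otimes>\<^bsub>G\<^esub> h)" if xy: "x \<in> fm n ` A g" "y \<in> fm n ` A h" for x y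
    proof -
      obtain X Y where XY: "X \<in> A g" "Y \<in> A h" "x = fm n X" "y = fm n Y" using xy by blast
      have c: "X \<in> carrier (UT n)" "Y \<in> carrier (UT n)" using XY sub(1) g h by blast+
      have U: "x \<in> UU n" "y \<in> UU n" using c XY fm_UU by auto
      have "mf n (br x y) = X \<otimes>\<^bsub>UT n\<^esub> Y" unfolding mf_br[OF U] unfolding XY mf_fm[OF c(1)] mf_fm[OF c(2)] ..
      moreover have "X \<otimes>\<^bsub>UT n\<^esub> Y \<in> A (g \<otimes>\<^bsub>G\<^esub> h)" using gr g h XY unfolding grading_def by blast
      moreover have "fm n (mf n (br x y)) = br x y" using U by (intro fm_mf) simp
      ultimately show ?thesis by (metis image_eqI)
    qed
  next
    fix x :: "'f tm" assume x: "x \<in> UU n"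
    obtain c where c: "c \<in> (\<Pi>\<^sub>E g\<in>carrier G. A g)" "finite {g \<in> carrier G. c g \<noteq> \<zero>\<^bsub>UT n\<^esub>}"
        "mf n x = (\<Oplus>\<^bsub>UT n\<^esub> g \<in> {g \<in> carrier G. c g \<noteq> \<zero>\<^bsub>UT n\<^esub>}. c g)"
      using sum[OF mf_carrier[OF x]] by blast
    let ?S = "{g \<in> carrier G. c g \<noteq> \<zero>\<^bsub>UT n\<^esub>}"
    have cA: "c g \<in> A g" if "g \<in> ?S" for g using c(1) that by auto
    then have cc: "c g \<in> carrier (UT n)" if "g \<in> ?S" for g using that sub(1)[of g] by blast
    have "fm n (mf n x) = (\<Sum>g\<in>?S. fm n (c g))"
      unfolding c(3) by (rule conjunct1[OF fm_finsum[OF c(2) cc]])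
    then have "x = (\<Sum>g\<in>?S. fm n (c g))" unfolding fm_mf[OF x] .
    then show "\<exists>S c. finite S \<and> S \<subseteq> carrier G \<and> (\<forall>g\<in>S. c g \<in> fm n ` A g) \<and> x = (\<Sum>g\<in>S. c g)"
      using c(2) cA by (intro exI[of _ ?S] exI[of _ "\<lambda>g. fm n (c g)"]) blast
  next
    fix S c g
    assume S: "finite S" "S \<subseteq> carrier G" "\<And>g. g \<in> S \<Longrightarrow> c g \<in> fm n ` A g" "(\<Sum>g\<in>S. c g) = 0" "g \<in> S"
    have "\<forall>g\<in>S. \<exists>X\<in>A g. c g = fm n X" using S(3) by blast
    then obtain X where X: "\<And>g. g \<in> S \<Longrightarrow> X g \<in> A g" "\<And>g. g \<in> S \<Longrightarrow> c g = fm n (X g)" by metis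
    \<comment> \<open>Uniqueness of the decomposition of zero is applied to X, extended by zero, and
      to the zero family \<open>e\<close>; both are \<open>undefined\<close> outside
      \<open>carrier G\<close> in order to lie in the extensional product.\<close>
    define d where "d g = (if g \<in> carrier G then if g \<in> S then X g else \<zero>\<^bsub>UT n\<^esub> else undefined)" for g
    define e where "e g = (if g \<in> carrier G then \<zero>\<^bsub>UT n\<^esub> else undefined :: 'f mat)" for g
    have Xc: "X g \<in> carrier (UT n)" if "g \<in> S" for g using X(1)[OF that] sub(1)[of g] S(2) that by blast
    have dS: "{g \<in> carrier G. d g \<noteq> \<zero>\<^bsub>UT n\<^esub>} \<subseteq> S" by (auto simp: d_def)
    then have fin: "finite {g \<in> carrier G. d g \<noteq> \<zero>\<^bsub>UT n\<^esub>}" using S(1) finite_subset by blast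
    have "d g \<in> carrier (UT n)" if "g \<in> {g \<in> carrier G. d g \<noteq> \<zero>\<^bsub>UT n\<^esub>}" for g
      using that Xc dS by (auto simp: d_def split: if_splits)
    note fs = fm_finsum[OF fin, of d n, OF this]
    have "(\<Sum>g\<in>{g \<in> carrier G. d g \<noteq> \<zero>\<^bsub>UT n\<^esub>}. fm n (d g)) = (\<Sum>g\<in>S. fm n (d g))"
    proof (rule sum.mono_neutral_left[OF S(1) dS], rule ballI)
      fix g assume "g \<in> S - {g \<in> carrier G. d g \<noteq> \<zero>\<^bsub>UT n\<^esub>}"
      then have "d g = \<zero>\<^bsub>UT n\<^esub>" using S(2) by blast
      then show "fm n (d g) = 0" using fm0 by simp
    qed
    also have "\<dots> = (\<Sum>g\<in>S. c g)" using S(2) X(2) by (intro sum.cong) (auto simp: d_def)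
    finally have "fm n (finsum (UT n) d {g \<in> carrier G. d g \<noteq> \<zero>\<^bsub>UT n\<^esub>}) = 0" using fs S(4) by simp
    then have "mf n (fm n (finsum (UT n) d {g \<in> carrier G. d g \<noteq> \<zero>\<^bsub>UT n\<^esub>})) = \<zero>\<^bsub>UT n\<^esub>"
      by (simp add: mf_0)
    moreover have "mf n (fm n (finsum (UT n) d {g \<in> carrier G. d g \<noteq> \<zero>\<^bsub>UT n\<^esub>})) = finsum (UT n) d {g \<in> carrier G. d g \<noteq> \<zero>\<^bsub>UT n\<^esub>}"
      using fs by (intro mf_fm) blast
    ultimately have z: "\<zero>\<^bsub>UT n\<^esub> = finsum (UT n) d {g \<in> carrier G. d g \<noteq> \<zero>\<^bsub>UT n\<^esub>}"
      by (rule HOL.trans[OF HOL.sym])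
    interpret L: lie_algebra class_ring "UT n :: ('f, 'f mat) module" by (rule lie_algebra_UT_lie)
    have "{g \<in> carrier G. e g \<noteq> \<zero>\<^bsub>UT n\<^esub>} = {}" by (auto simp: e_def)
    then have z2: "finite {g \<in> carrier G. e g \<noteq> \<zero>\<^bsub>UT n\<^esub>}"
      "\<zero>\<^bsub>UT n\<^esub> = finsum (UT n) e {g \<in> carrier G. e g \<noteq> \<zero>\<^bsub>UT n\<^esub>}"
      by (simp_all only: finite.emptyI L.M.finsum_empty)
    have dP: "d \<in> (\<Pi>\<^sub>E g\<in>carrier G. A g)" "e \<in> (\<Pi>\<^sub>E g\<in>carrier G. A g)"
      using X(1) sub(2) by (auto simp: d_def e_def PiE_def extensional_def simp del: UT_lie_simps)
    have "d = e" using sum[OF L.M.zero_closed] dP fin z z2 by blast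
    then have "d g = e g" by simp
    then have "X g = \<zero>\<^bsub>UT n\<^esub>" using S(2,5) by (auto simp: d_def e_def)
    then show "c g = 0" using X(2)[OF S(5)] fm0 by simp
  qed
qed

subsection \<open>The quotient by the centre\<close>

abbreviation QQ :: "nat \<Rightarrow> ('f::field, 'f mat set) module" where
  "QQ n \<equiv> quot_alg (UT n) (lie_center (UT n))"

definition cs :: "nat \<Rightarrow> 'f::field tm \<Rightarrow> 'f mat set" where
  "cs n x = lie_center (UT n) +>\<^bsub>UT n\<^esub> mf n x"

lemma lie_algebra_QQ: "lie_algebra class_ring (QQ n :: ('f::field, 'f mat set) module)"
  by (rule lie_algebra_quot_center[OF lie_algebra_UT_lie])

lemma QQ_carrier: "carrier (QQ n) = cs n ` UU n"
proof -
  have "carrier (QQ n) = (\<lambda>X. lie_center (UT n) +>\<^bsub>UT n\<^esub> X) ` carrier (UT n)"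
    by (auto simp: quot_alg_def A_RCOSETS_def')
  also have "carrier (UT n) = mf n ` UU n" using mf_carrier mf_surj by blast
  finally show ?thesis by (simp add: image_image cs_def)
qed

lemma cs_closed: "x \<in> UU n \<Longrightarrow> cs n x \<in> carrier (QQ n)"
  by (simp add: QQ_carrier)

lemma cs_ops:
  assumes x: "x \<in> UU n" and y: "y \<in> UU n"
  shows "cs n x \<oplus>\<^bsub>QQ n\<^esub> cs n y = cs n (x + y)"
    and "cs n x \<otimes>\<^bsub>QQ n\<^esub> cs n y = cs n (br x y)"
    and "a \<odot>\<^bsub>QQ n\<^esub> cs n x = cs n (sc a x)"
proof -
  interpret lie_algebra class_ring "UT n :: ('a, 'a mat) module" by (rule lie_algebra_UT_lie)
  show "cs n x \<oplus>\<^bsub>QQ n\<^esub> cs n y = cs n (x + y)"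
    unfolding cs_def quot_ops(1)[OF mf_carrier[OF x] mf_carrier[OF y]] mf_add UT_lie_simps ..
  show "cs n x \<otimes>\<^bsub>QQ n\<^esub> cs n y = cs n (br x y)"
    unfolding cs_def quot_ops(2)[OF mf_carrier[OF x] mf_carrier[OF y]] mf_br[OF x y] ..
  have "a \<in> carrier (class_ring :: 'a ring)" by simp
  then show "a \<odot>\<^bsub>QQ n\<^esub> cs n x = cs n (sc a x)"
    unfolding cs_def using quot_ops(3)[OF mf_carrier[OF x] mf_carrier[OF y]] by (simp add: mf_sc)
qed

lemma cs_eq_iff:
  assumes x: "x \<in> UU n" and y: "y \<in> UU n" shows "cs n x = cs n y \<longleftrightarrow> x - y \<in> ZZ n"
proof -
  interpret lie_algebra class_ring "UT n :: ('a, 'a mat) module" by (rule lie_algebra_UT_lie)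
  have "cs n x = cs n y \<longleftrightarrow> (\<exists>z\<in>lie_center (UT n). mf n x = z \<oplus>\<^bsub>UT n\<^esub> mf n y)"
    unfolding cs_def by (rule coset_eq_iff[OF mf_carrier[OF x] mf_carrier[OF y]])
  also have "\<dots> \<longleftrightarrow> (\<exists>z\<in>ZZ n. x = z + y)"
  proof
    assume "\<exists>z\<in>lie_center (UT n). mf n x = z \<oplus>\<^bsub>UT n\<^esub> mf n y"
    then obtain Z where Z: "Z \<in> lie_center (UT n)" "mf n x = Z \<oplus>\<^bsub>UT n\<^esub> mf n y" by blast
    then obtain z where z: "z \<in> UU n" "Z = mf n z" using mf_surj[OF center_closed[OF Z(1)]] by blast
    then have "z \<in> ZZ n" using Z(1) mf_center by blast
    moreover have "mf n x = mf n (z + y)" using Z(2) z(2) by (simp add: mf_add)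
    then have "x = z + y" using x y z(1) by (intro mf_inj) auto
    ultimately show "\<exists>z\<in>ZZ n. x = z + y" by blast
  next
    assume "\<exists>z\<in>ZZ n. x = z + y"
    then obtain z where z: "z \<in> ZZ n" "x = z + y" by blast
    then have "mf n z \<in> lie_center (UT n)" using mf_center ZZ_UU by blast
    moreover have "mf n x = mf n z \<oplus>\<^bsub>UT n\<^esub> mf n y" unfolding z(2) by (simp add: mf_add)
    ultimately show "\<exists>z\<in>lie_center (UT n). mf n x = z \<oplus>\<^bsub>UT n\<^esub> mf n y" by blast
  qed
  also have "\<dots> \<longleftrightarrow> x - y \<in> ZZ n" by (metis add_diff_cancel_right' diff_add_cancel)
  finally show ?thesis .
qed

lemma QQ_zero: "\<zero>\<^bsub>QQ n\<^esub> = cs n (0 :: 'a::field tm)"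
proof -
  interpret lie_algebra class_ring "QQ n :: ('a, 'a mat set) module" by (rule lie_algebra_QQ)
  have "(0::'a) \<odot>\<^bsub>QQ n\<^esub> cs n (0 :: 'a tm) = \<zero>\<^bsub>QQ n\<^esub>"
    using smult_l_null[of "cs n (0 :: 'a tm)"] cs_closed[of "0 :: 'a tm" n] by simp
  then show ?thesis using cs_ops(3)[of "0 :: 'a tm" n "0 :: 'a tm" 0] by simp
qed

lemma cs_eq_zero: "x \<in> UU n \<Longrightarrow> cs n x = \<zero>\<^bsub>QQ n\<^esub> \<longleftrightarrow> x \<in> ZZ n"
  unfolding QQ_zero using cs_eq_iff[of x n 0] by simp

lemma quot_grading_cs:
  assumes "A g \<subseteq> carrier (UT n)"
  shows "quot_grading (UT n) (lie_center (UT n)) A g = cs n ` fm n ` A g"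
  unfolding quot_grading_def image_image cs_def
proof (intro image_cong HOL.refl)
  fix X assume "X \<in> A g"
  then show "lie_center (UT n) +>\<^bsub>UT n\<^esub> X = lie_center (UT n) +>\<^bsub>UT n\<^esub> mf n (fm n X)"
    using mf_fm[OF subsetD[OF assms]] by simp
qed

lemma grading_carrier: "grading G (UT n) A \<Longrightarrow> g \<in> carrier G \<Longrightarrow> A g \<subseteq> carrier (UT n :: ('f::field, 'f mat) module)"
  unfolding grading_def VectorSpace.subspace_def submodule_def by blast

subsection \<open>Automorphisms of the quotient\<close>

definition aut_mat :: "nat \<Rightarrow> ('f::field tm \<Rightarrow> 'f tm) \<Rightarrow> 'f mat \<Rightarrow> 'f mat" where
  "aut_mat n \<psi> X = mf n (\<psi> (fm n X))"

text \<open>The chosen representative does not matter, since automorphisms preserve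
  \<open>ZZ n\<close>.\<close>

definition aut_quot :: "nat \<Rightarrow> ('f::field tm \<Rightarrow> 'f tm) \<Rightarrow> 'f mat set \<Rightarrow> 'f mat set" where
  "aut_quot n \<psi> P = cs n (\<psi> (SOME x. x \<in> UU n \<and> P = cs n x))"

lemma alg_isoI:
  assumes "bij_betw f (carrier L) (carrier M)"
    and "\<And>x y. x \<in> carrier L \<Longrightarrow> y \<in> carrier L \<Longrightarrow> f (x \<oplus>\<^bsub>L\<^esub> y) = f x \<oplus>\<^bsub>M\<^esub> f y"
    and "\<And>x y. x \<in> carrier L \<Longrightarrow> y \<in> carrier L \<Longrightarrow> f (x \<otimes>\<^bsub>L\<^esub> y) = f x \<otimes>\<^bsub>M\<^esub> f y"
    and "\<And>a x. x \<in> carrier L \<Longrightarrow> f (a \<odot>\<^bsub>L\<^esub> x) = a \<odot>\<^bsub>M\<^esub> f x"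
  shows "f \<in> alg_iso L M"
  using assms unfolding alg_iso_def alg_hom_def LinearCombinations.module_hom_def
  by (auto dest: bij_betwE)

lemma aut_mat_iso: assumes a: "aut n \<psi>" shows "aut_mat n \<psi> \<in> alg_iso (UT n) (UT n)"
proof (rule alg_isoI)
  have c: "aut_mat n \<psi> (mf n x) = mf n (\<psi> x)" if "x \<in> UU n" for x
    using that by (simp add: aut_mat_def fm_mf)
  show "bij_betw (aut_mat n \<psi>) (carrier (UT n)) (carrier (UT n))"
    unfolding bij_betw_def
  proof
    show "inj_on (aut_mat n \<psi>) (carrier (UT n))"
    proof (rule inj_onI)
      fix X Y :: "'a mat" assume "X \<in> carrier (UT n)" "Y \<in> carrier (UT n)" and e: "aut_mat n \<psi> X = aut_mat n \<psi> Y"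
      then obtain x y where xy: "x \<in> UU n" "X = mf n x" "y \<in> UU n" "Y = mf n y" using mf_surj by metis
      then have "\<psi> x = \<psi> y" using e c aut_UU[OF a] by (intro mf_inj) auto
      then show "X = Y" using aut_inj[OF a xy(1,3)] xy by simp
    qed
    show "aut_mat n \<psi> ` carrier (UT n) = carrier (UT n)"
    proof (intro subset_antisym subsetI)
      fix Y :: "'a mat" assume "Y \<in> aut_mat n \<psi> ` carrier (UT n)"
      then show "Y \<in> carrier (UT n)"
        using mf_carrier[OF aut_UU[OF a fm_UU]] unfolding aut_mat_def by blast
    next
      fix Y :: "'a mat" assume "Y \<in> carrier (UT n)"
      then obtain y where y: "y \<in> UU n" "Y = mf n y" using mf_surj by blast
      then obtain x where x: "x \<in> UU n" "\<psi> x = y" using aut_surj[OF a] by blast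
      show "Y \<in> aut_mat n \<psi> ` carrier (UT n)"
        using c[OF x(1)] x y(2) mf_carrier[OF x(1)] by (intro image_eqI[of _ _ "mf n x"]) simp_all
    qed
  qed
  fix X :: "'a mat" assume "X \<in> carrier (UT n)"
  then obtain x where x: "x \<in> UU n" "X = mf n x" using mf_surj by blast
  have px: "\<psi> x \<in> UU n" by (rule aut_UU[OF a x(1)])
  show "aut_mat n \<psi> (b \<odot>\<^bsub>UT n\<^esub> X) = b \<odot>\<^bsub>UT n\<^esub> aut_mat n \<psi> X" for b
    unfolding x(2) UT_lie_simps mf_sc[symmetric] c[OF x(1)] c[OF NN_sc[OF x(1)]] aut_sc[OF a x(1)] ..
  fix Y :: "'a mat" assume "Y \<in> carrier (UT n)"
  then obtain y where y: "y \<in> UU n" "Y = mf n y" using mf_surj by blast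
  have py: "\<psi> y \<in> UU n" by (rule aut_UU[OF a y(1)])
  show "aut_mat n \<psi> (X \<oplus>\<^bsub>UT n\<^esub> Y) = aut_mat n \<psi> X \<oplus>\<^bsub>UT n\<^esub> aut_mat n \<psi> Y"
    unfolding x(2) y(2) UT_lie_simps mf_add[symmetric] c[OF x(1)] c[OF y(1)] c[OF NN_add[OF x(1) y(1)]]
      aut_add[OF a x(1) y(1)] ..
  have b: "br x y \<in> UU n" using x(1) y(1) by simp
  show "aut_mat n \<psi> (X \<otimes>\<^bsub>UT n\<^esub> Y) = aut_mat n \<psi> X \<otimes>\<^bsub>UT n\<^esub> aut_mat n \<psi> Y"
    unfolding x(2) y(2) mf_br[OF x(1) y(1), symmetric] c[OF x(1)] c[OF y(1)] c[OF b]
      aut_br[OF a x(1) y(1)] mf_br[OF px py] ..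
qed

lemma aut_quot_cs:
  assumes a: "aut n \<psi>" and x: "x \<in> UU n" shows "aut_quot n \<psi> (cs n x) = cs n (\<psi> x)"
proof -
  define y where "y = (SOME y. y \<in> UU n \<and> cs n x = cs n y)"
  have y: "y \<in> UU n \<and> cs n x = cs n y" unfolding y_def by (rule someI[of _ x]) (use x in simp)
  then have "x - y \<in> ZZ n" using cs_eq_iff[OF x] by blast
  from aut_ZZ[OF a this] have "\<psi> x - \<psi> y \<in> ZZ n" using aut_diff[OF a x] y by simp
  then have "cs n (\<psi> x) = cs n (\<psi> y)" using cs_eq_iff aut_UU[OF a] x y by blast
  then show ?thesis by (simp add: aut_quot_def y_def)
qed

lemma aut_quot_iso: assumes a: "aut n \<psi>" shows "aut_quot n \<psi> \<in> alg_iso (QQ n) (QQ n)"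
proof (rule alg_isoI)
  note c = aut_quot_cs[OF a]
  show "bij_betw (aut_quot n \<psi>) (carrier (QQ n)) (carrier (QQ n))"
    unfolding bij_betw_def
  proof
    show "inj_on (aut_quot n \<psi>) (carrier (QQ n))"
    proof (rule inj_onI)
      fix X Y :: "'a mat set" assume "X \<in> carrier (QQ n)" "Y \<in> carrier (QQ n)" and e: "aut_quot n \<psi> X = aut_quot n \<psi> Y"
      then obtain x y where xy: "x \<in> UU n" "X = cs n x" "y \<in> UU n" "Y = cs n y" unfolding QQ_carrier by blast
      then have "cs n (\<psi> x) = cs n (\<psi> y)" using e c by simp
      then have "\<psi> (x - y) \<in> ZZ n"
        using cs_eq_iff[OF aut_UU[OF a xy(1)] aut_UU[OF a xy(3)]] aut_diff[OF a xy(1,3)] by simp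
      then have "inv_into (UU n) \<psi> (\<psi> (x - y)) \<in> ZZ n" by (rule aut_ZZ[OF aut_inv[OF a]])
      moreover have "inv_into (UU n) \<psi> (\<psi> (x - y)) = x - y"
        using a xy by (simp add: aut_def bij_betw_def)
      ultimately show "X = Y" using cs_eq_iff xy by metis
    qed
    show "aut_quot n \<psi> ` carrier (QQ n) = carrier (QQ n)"
    proof (intro subset_antisym subsetI)
      fix Y :: "'a mat set" assume "Y \<in> aut_quot n \<psi> ` carrier (QQ n)"
      then obtain x where "x \<in> UU n" "Y = aut_quot n \<psi> (cs n x)" unfolding QQ_carrier by blast
      then show "Y \<in> carrier (QQ n)" using c cs_closed[OF aut_UU[OF a]] by simp
    next
      fix Y :: "'a mat set" assume "Y \<in> carrier (QQ n)"
      then obtain y where y: "y \<in> UU n" "Y = cs n y" unfolding QQ_carrier by blast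
      then obtain x where x: "x \<in> UU n" "\<psi> x = y" using aut_surj[OF a] by blast
      show "Y \<in> aut_quot n \<psi> ` carrier (QQ n)"
        using c[OF x(1)] x y(2) cs_closed[OF x(1)] by (intro image_eqI[of _ _ "cs n x"]) simp_all
    qed
  qed
  fix X :: "'a mat set" assume "X \<in> carrier (QQ n)"
  then obtain x where x: "x \<in> UU n" "X = cs n x" unfolding QQ_carrier by blast
  have px: "\<psi> x \<in> UU n" by (rule aut_UU[OF a x(1)])
  show "aut_quot n \<psi> (b \<odot>\<^bsub>QQ n\<^esub> X) = b \<odot>\<^bsub>QQ n\<^esub> aut_quot n \<psi> X" for b
    unfolding x(2) cs_ops(3)[OF x(1) x(1)] c[OF x(1)] c[OF NN_sc[OF x(1)]] aut_sc[OF a x(1)] cs_ops(3)[OF px px] ..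
  fix Y :: "'a mat set" assume "Y \<in> carrier (QQ n)"
  then obtain y where y: "y \<in> UU n" "Y = cs n y" unfolding QQ_carrier by blast
  have py: "\<psi> y \<in> UU n" by (rule aut_UU[OF a y(1)])
  show "aut_quot n \<psi> (X \<oplus>\<^bsub>QQ n\<^esub> Y) = aut_quot n \<psi> X \<oplus>\<^bsub>QQ n\<^esub> aut_quot n \<psi> Y"
    unfolding x(2) y(2) cs_ops(1)[OF x(1) y(1)] c[OF x(1)] c[OF y(1)] c[OF NN_add[OF x(1) y(1)]]
      aut_add[OF a x(1) y(1)] cs_ops(1)[OF px py] ..
  have b: "br x y \<in> UU n" using x(1) y(1) by simp
  show "aut_quot n \<psi> (X \<otimes>\<^bsub>QQ n\<^esub> Y) = aut_quot n \<psi> X \<otimes>\<^bsub>QQ n\<^esub> aut_quot n \<psi> Y"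
    unfolding x(2) y(2) cs_ops(2)[OF x(1) y(1)] c[OF x(1)] c[OF y(1)] c[OF b]
      aut_br[OF a x(1) y(1)] cs_ops(2)[OF px py] ..
qed

lemma practically_isomorphicI:
  fixes A B :: "'g \<Rightarrow> 'f::field mat set"
  assumes G: "group G" and A: "grading G (UT n) A" and B: "grading G (UT n) B" and a: "aut n \<psi>"
    and h: "\<And>g x. g \<in> carrier G \<Longrightarrow> x \<in> fm n ` A g \<Longrightarrow> tri_grading.hz n (\<lambda>g. fm n ` B g) g (\<psi> x)"
  shows "practically_graded_isomorphic G (UT n) A (UT n) B"
proof -
  interpret B: tri_grading G n "\<lambda>g. fm n ` B g" by (rule tri_grading_of_grading[OF G B])
  interpret A: tri_grading G n "\<lambda>g. fm n ` A g" by (rule tri_grading_of_grading[OF G A])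
  have "aut_quot n \<psi> ` (cs n ` fm n ` A g) \<subseteq> cs n ` fm n ` B g" if g: "g \<in> carrier G" for g
  proof
    fix Y assume "Y \<in> aut_quot n \<psi> ` (cs n ` fm n ` A g)"
    then obtain x where x: "x \<in> fm n ` A g" "Y = aut_quot n \<psi> (cs n x)" by blast
    have xU: "x \<in> UU n" by (rule A.A_UU[OF g x(1)])
    obtain z where z: "z \<in> ZZ n" "\<psi> x + z \<in> fm n ` B g" using h[OF g x(1)] unfolding B.hz_def by blast
    have "\<psi> x - (\<psi> x + z) \<in> ZZ n" using ZZ_uminus[OF z(1)] by simp
    then have "cs n (\<psi> x) = cs n (\<psi> x + z)"
      using cs_eq_iff[OF aut_UU[OF a xU] NN_add[OF aut_UU[OF a xU] ZZ_UU[OF z(1)]]] by simp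
    then show "Y \<in> cs n ` fm n ` B g" unfolding x(2) aut_quot_cs[OF a xU] using z(2) by simp
  qed
  then have "aut_quot n \<psi> \<in> graded_iso G (QQ n) (quot_grading (UT n) (lie_center (UT n)) A)
      (QQ n) (quot_grading (UT n) (lie_center (UT n)) B)"
    unfolding graded_iso_def using aut_quot_iso[OF a] quot_grading_cs[where A = A and n = n]
      quot_grading_cs[where A = B and n = n] grading_carrier[OF A] grading_carrier[OF B] by simp
  moreover have "aut_quot n \<psi> (lie_center (UT n) +>\<^bsub>UT n\<^esub> X) = lie_center (UT n) +>\<^bsub>UT n\<^esub> aut_mat n \<psi> X"
    if "X \<in> carrier (UT n)" for X
    using aut_quot_cs[OF a fm_UU[OF that]] unfolding cs_def aut_mat_def mf_fm[OF that] .
  ultimately show ?thesis unfolding practically_graded_isomorphic_def using aut_mat_iso[OF a] by blast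
qed

subsection \<open>Graded identities\<close>

text \<open>Leaves are numbered consecutively from k, so each variable occurs once and the monomial
  is multilinear.\<close>

fun bt_term :: "'g bt \<Rightarrow> nat \<Rightarrow> ('f, nat \<times> 'g) lie_term" where
  "bt_term (Leaf g) k = LVar (k, g)"
| "bt_term (Node l r) k = LBr (bt_term l k) (bt_term r (k + leaves l))"

fun bt_eval :: "(nat \<times> 'g \<Rightarrow> 'f::field tm) \<Rightarrow> 'g bt \<Rightarrow> nat \<Rightarrow> 'f tm" where
  "bt_eval \<sigma> (Leaf g) k = \<sigma> (k, g)"
| "bt_eval \<sigma> (Node l r) k = br (bt_eval \<sigma> l k) (bt_eval \<sigma> r (k + leaves l))"

lemma bt_term_lie_terms:
  "set_bt T \<subseteq> carrier G \<Longrightarrow> k \<ge> 1 \<Longrightarrow> bt_term T k \<in> lie_terms (graded_vars G)"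
  by (induction T arbitrary: k) (auto simp: graded_vars_def)

lemma bt_eval_cong:
  "(\<And>i g. k \<le> i \<Longrightarrow> i < k + leaves T \<Longrightarrow> \<sigma> (i, g) = \<tau> (i, g)) \<Longrightarrow> bt_eval \<sigma> T k = bt_eval \<tau> T k"
proof (induction T arbitrary: k)
  case (Node l r)
  have "bt_eval \<sigma> l k = bt_eval \<tau> l k" by (rule Node.IH(1)) (use Node.prems in auto)
  moreover have "bt_eval \<sigma> r (k + leaves l) = bt_eval \<tau> r (k + leaves l)"
    by (rule Node.IH(2)) (use Node.prems in auto)
  ultimately show ?case by simp
qed simp

text \<open>The two subtrees use disjoint ranges of variable numbers, so substitutions for them can
  be glued at the index \<open>k + leaves l\<close>.\<close>

lemma val_imp_bt_eval:
  assumes "v \<in> val B T" "\<And>g. g \<in> carrier G \<Longrightarrow> B g \<noteq> {}" "set_bt T \<subseteq> carrier G"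
  shows "\<exists>\<sigma>. (\<forall>i. \<forall>g\<in>carrier G. \<sigma> (i, g) \<in> B g) \<and> bt_eval \<sigma> T k = v"
  using assms(1,3)
proof (induction T arbitrary: v k)
  case (Leaf g)
  define \<sigma> where "\<sigma> = (\<lambda>(i::nat, h). if h = g then v else SOME x. x \<in> B h)"
  have "\<sigma> (i, h) \<in> B h" if "h \<in> carrier G" for i h
    using assms(2)[OF that] Leaf by (auto simp: \<sigma>_def some_in_eq)
  then show ?case by (intro exI[of _ \<sigma>]) (simp add: \<sigma>_def)
next
  case (Node l r)
  then obtain x y where xy: "x \<in> val B l" "y \<in> val B r" "v = br x y" by auto
  obtain \<sigma> where \<sigma>: "\<forall>i. \<forall>g\<in>carrier G. \<sigma> (i, g) \<in> B g" "bt_eval \<sigma> l k = x"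
    using Node.IH(1)[OF xy(1)] Node.prems by fastforce
  obtain \<tau> where \<tau>: "\<forall>i. \<forall>g\<in>carrier G. \<tau> (i, g) \<in> B g" "bt_eval \<tau> r (k + leaves l) = y"
    using Node.IH(2)[OF xy(2)] Node.prems by fastforce
  define \<upsilon> where "\<upsilon> = (\<lambda>(i, g). if i < k + leaves l then \<sigma> (i, g) else \<tau> (i, g))"
  have "bt_eval \<upsilon> l k = bt_eval \<sigma> l k" by (rule bt_eval_cong) (simp add: \<upsilon>_def)
  moreover have "bt_eval \<upsilon> r (k + leaves l) = bt_eval \<tau> r (k + leaves l)"
    by (rule bt_eval_cong) (simp add: \<upsilon>_def)
  ultimately have "bt_eval \<upsilon> (Node l r) k = v" using \<sigma>(2) \<tau>(2) xy(3) by simp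
  moreover have "\<forall>i. \<forall>g\<in>carrier G. \<upsilon> (i, g) \<in> B g" using \<sigma>(1) \<tau>(1) by (simp add: \<upsilon>_def)
  ultimately show ?case by blast
qed

lemma bt_eval_val:
  "(\<And>i g. i \<ge> k \<Longrightarrow> g \<in> carrier G \<Longrightarrow> \<sigma> (i, g) \<in> B g) \<Longrightarrow> set_bt T \<subseteq> carrier G \<Longrightarrow> bt_eval \<sigma> T k \<in> val B T"
proof (induction T arbitrary: k)
  case (Node l r)
  have "bt_eval \<sigma> l k \<in> val B l" by (rule Node.IH(1)) (use Node.prems in auto)
  moreover have "bt_eval \<sigma> r (k + leaves l) \<in> val B r" by (rule Node.IH(2)) (use Node.prems in auto)
  ultimately show ?case by auto
qed simp

lemma hom_bt_term:
  fixes \<phi> :: "('f::field, nat \<times> 'g) lie_term set \<Rightarrow> 'f mat set"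
  assumes \<phi>: "\<phi> \<in> alg_hom (free_lie (graded_vars G)) (QQ n)"
    and \<sigma>: "\<And>i g. i \<ge> 1 \<Longrightarrow> g \<in> carrier G \<Longrightarrow> \<phi> (free_lie_var (graded_vars G) (i, g)) = cs n (\<sigma> (i, g)) \<and> \<sigma> (i, g) \<in> UU n"
    and T: "set_bt T \<subseteq> carrier G" and k: "k \<ge> 1"
  shows "\<phi> (lie_class (graded_vars G) (bt_term T k)) = cs n (bt_eval \<sigma> T k) \<and> bt_eval \<sigma> T k \<in> UU n"
  using T k
proof (induction T arbitrary: k)
  case (Leaf g)
  then show ?case using \<sigma> by (simp add: free_lie_var_def)
next
  case (Node l r)
  have l: "\<phi> (lie_class (graded_vars G) (bt_term l k)) = cs n (bt_eval \<sigma> l k)" "bt_eval \<sigma> l k \<in> UU n"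
    using Node.IH(1)[of k] Node.prems by auto
  have r: "\<phi> (lie_class (graded_vars G) (bt_term r (k + leaves l))) = cs n (bt_eval \<sigma> r (k + leaves l))"
    "bt_eval \<sigma> r (k + leaves l) \<in> UU n"
    using Node.IH(2)[of "k + leaves l"] Node.prems by auto
  have t: "(bt_term l k :: ('f, nat \<times> 'g) lie_term) \<in> lie_terms (graded_vars G)"
    "(bt_term r (k + leaves l) :: ('f, nat \<times> 'g) lie_term) \<in> lie_terms (graded_vars G)"
    using Node.prems by (auto intro!: bt_term_lie_terms)
  have "\<phi> (lie_class (graded_vars G) (bt_term (Node l r) k))
      = \<phi> (lie_class (graded_vars G) (bt_term l k) \<otimes>\<^bsub>free_lie (graded_vars G)\<^esub> lie_class (graded_vars G) (bt_term r (k + leaves l)))"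
    by (simp add: free_lie_class_ops(2)[OF t])
  also have "\<dots> = \<phi> (lie_class (graded_vars G) (bt_term l k)) \<otimes>\<^bsub>QQ n\<^esub> \<phi> (lie_class (graded_vars G) (bt_term r (k + leaves l)))"
    using \<phi> free_lie_carrierI[OF t(1)] free_lie_carrierI[OF t(2)] unfolding alg_hom_def by blast
  also have "\<dots> = cs n (bt_eval \<sigma> (Node l r) k)" unfolding l(1) r(1) by (simp add: cs_ops(2)[OF l(2) r(2)])
  finally show ?case using l(2) r(2) by simp
qed

text \<open>Values of a tree with at least one bracket are strictly upper triangular, so they are
  central only if they are zero. Substitutions into the quotient lift to homogeneous matrices, and
  conversely.\<close>

lemma nonvanishing_iff_not_identity:
  fixes A :: "'g \<Rightarrow> 'f::field mat set"
  assumes G: "group G" and A: "grading G (UT n) A" and T: "set_bt (Node l r) \<subseteq> carrier G"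
  shows "nonvanishing (\<lambda>g. fm n ` A g) (Node l r) \<longleftrightarrow>
    lie_class (graded_vars G) (bt_term (Node l r) 1) \<notin> graded_identities G (QQ n) (quot_grading (UT n) (lie_center (UT n)) A)"
proof -
  interpret A: tri_grading G n "\<lambda>g. fm n ` A g" by (rule tri_grading_of_grading[OF G A])
  let ?X = "graded_vars G" and ?T = "Node l r" and ?q = "quot_grading (UT n) (lie_center (UT n)) A"
  let ?f = "lie_class ?X (bt_term ?T 1) :: ('f, nat \<times> 'g) lie_term set"
  have q: "?q g = cs n ` fm n ` A g" if "g \<in> carrier G" for g
    by (rule quot_grading_cs[where A = A and g = g]) (rule grading_carrier[OF A that])
  have f: "?f \<in> carrier (free_lie ?X)" by (rule free_lie_carrierI[OF bt_term_lie_terms[OF T]]) simp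
  have U: "val (\<lambda>g. fm n ` A g) S \<subseteq> UU n" if "set_bt S \<subseteq> carrier G" for S
  proof (rule conjunct2[OF val_image[OF aut_id]])
    fix g assume "g \<in> set_bt S"
    then show "fm n ` A g \<subseteq> UU n" using that A.A_UU by blast
  qed
  show ?thesis
  proof
    assume "nonvanishing (\<lambda>g. fm n ` A g) ?T"
    then obtain v where v: "v \<in> val (\<lambda>g. fm n ` A g) ?T" "v \<noteq> 0" by (auto simp: nonvanishing_def)
    have "\<And>g. g \<in> carrier G \<Longrightarrow> fm n ` A g \<noteq> {}" using A.A_0 by blast
    from val_imp_bt_eval[OF v(1) this T, of 1] obtain \<sigma> where
      \<sigma>: "\<forall>i. \<forall>g\<in>carrier G. \<sigma> (i, g) \<in> fm n ` A g" "bt_eval \<sigma> ?T 1 = v" by blast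
    have \<sigma>U: "\<sigma> (i, g) \<in> UU n" if "g \<in> carrier G" for i g using A.A_UU[OF that] \<sigma>(1) that by blast
    have "(\<lambda>x. cs n (\<sigma> x)) \<in> ?X \<rightarrow> carrier (QQ n)" using \<sigma>U cs_closed by (auto simp: graded_vars_def)
    from free_lie_universal[OF lie_algebra_QQ this] obtain \<phi> where
      \<phi>: "\<phi> \<in> alg_hom (free_lie ?X) (QQ n)" "\<forall>x\<in>?X. \<phi> (free_lie_var ?X x) = cs n (\<sigma> x)" by blast
    have "\<phi> ?f = cs n (bt_eval \<sigma> ?T 1)"
      using hom_bt_term[OF \<phi>(1) _ T, of \<sigma> 1] \<phi>(2) \<sigma>U by (simp add: graded_vars_def)
    then have e: "\<phi> ?f = cs n v" using \<sigma>(2) by simp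
    obtain x y where xy: "x \<in> UU n" "y \<in> UU n" "v = br x y" using v(1) U[of l] U[of r] T by auto
    have "v \<in> NN n 1" unfolding xy(3) by (rule br_UU_UU[OF xy(1,2)])
    then have "v \<notin> ZZ n"
    proof (intro notI)
      assume N: "v \<in> NN n 1" and "v \<in> ZZ n"
      then obtain c where c: "v = diag n (\<lambda>_. c)" by (auto simp: ZZ_iff)
      have "v i j = 0" for i j using NN_zero_entry[OF N, of i i] by (auto simp: c)
      then show False using v(2) tm_eqI[of v 0] by simp
    qed
    then have "\<phi> ?f \<noteq> \<zero>\<^bsub>QQ n\<^esub>" unfolding e using cs_eq_zero xy by (metis br_UU_NN)
    moreover have "\<forall>(i, g)\<in>?X. \<phi> (free_lie_var ?X (i, g)) \<in> ?q g"
      using \<phi>(2) \<sigma>(1) q by (auto simp: graded_vars_def)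
    ultimately show "?f \<notin> graded_identities G (QQ n) ?q" using \<phi>(1) unfolding graded_identities_def by blast
  next
    assume "?f \<notin> graded_identities G (QQ n) ?q"
    then obtain \<phi> where \<phi>: "\<phi> \<in> alg_hom (free_lie ?X) (QQ n)"
      "\<forall>(i, g)\<in>?X. \<phi> (free_lie_var ?X (i, g)) \<in> ?q g" "\<phi> ?f \<noteq> \<zero>\<^bsub>QQ n\<^esub>"
      using f unfolding graded_identities_def by blast
    have "\<exists>s. s \<in> fm n ` A g \<and> \<phi> (free_lie_var ?X (i, g)) = cs n s" if "i \<ge> 1" "g \<in> carrier G" for i g
    proof -
      have "(i, g) \<in> ?X" using that by (simp add: graded_vars_def)
      from bspec[OF \<phi>(2) this] have "\<phi> (free_lie_var ?X (i, g)) \<in> ?q g" by simp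
      then show ?thesis unfolding q[OF that(2)] by blast
    qed
    then obtain s where s: "\<And>i g. i \<ge> 1 \<Longrightarrow> g \<in> carrier G \<Longrightarrow> s i g \<in> fm n ` A g \<and> \<phi> (free_lie_var ?X (i, g)) = cs n (s i g)"
      by metis
    define \<sigma> where "\<sigma> = (\<lambda>(i, g). s i g)"
    have "\<phi> ?f = cs n (bt_eval \<sigma> ?T 1)"
      using hom_bt_term[OF \<phi>(1) _ T, of \<sigma> 1] s A.A_UU by (simp add: \<sigma>_def)
    then have "bt_eval \<sigma> ?T 1 \<noteq> 0" using \<phi>(3) unfolding QQ_zero by metis
    moreover have "bt_eval \<sigma> ?T 1 \<in> val (\<lambda>g. fm n ` A g) ?T"
      by (rule bt_eval_val[OF _ T]) (use s in \<open>simp add: \<sigma>_def\<close>)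
    ultimately show "nonvanishing (\<lambda>g. fm n ` A g) ?T" unfolding nonvanishing_def by blast
  qed
qed

subsection \<open>Graded isomorphisms preserve graded identities\<close>

lemma alg_iso_zero:
  assumes L: "lie_algebra class_ring (L :: ('f::field, 'v) module)" and M: "lie_algebra class_ring (M :: ('f, 'w) module)"
    and f: "f \<in> alg_iso L M"
  shows "f \<zero>\<^bsub>L\<^esub> = \<zero>\<^bsub>M\<^esub>"
proof -
  interpret L: lie_algebra class_ring L by (rule L)
  interpret M: lie_algebra class_ring M by (rule M)
  have sm: "\<forall>r\<in>carrier class_ring. \<forall>m\<in>carrier L. f (r \<odot>\<^bsub>L\<^esub> m) = r \<odot>\<^bsub>M\<^esub> f m" and fc: "f \<in> carrier L \<rightarrow> carrier M"
    using f unfolding alg_iso_def alg_hom_def LinearCombinations.module_hom_def by simp_all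
  have "f (0 \<odot>\<^bsub>L\<^esub> \<zero>\<^bsub>L\<^esub>) = 0 \<odot>\<^bsub>M\<^esub> f \<zero>\<^bsub>L\<^esub>"
    using sm[THEN bspec, of 0, THEN bspec, OF _ L.M.zero_closed] by simp
  moreover have "f \<zero>\<^bsub>L\<^esub> \<in> carrier M" using fc L.M.zero_closed by (rule funcset_mem)
  ultimately have "f (0 \<odot>\<^bsub>L\<^esub> \<zero>\<^bsub>L\<^esub>) = 0 \<odot>\<^bsub>M\<^esub> f \<zero>\<^bsub>L\<^esub>" "f \<zero>\<^bsub>L\<^esub> \<in> carrier M" .
  then show ?thesis using L.smult_l_null[OF L.M.zero_closed] M.smult_l_null[of "f \<zero>\<^bsub>L\<^esub>"] by simp
qed

lemma graded_identities_mono: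
  assumes L: "lie_algebra class_ring (L :: ('f::field, 'v) module)" and M: "lie_algebra class_ring (M :: ('f, 'w) module)"
    and f: "f \<in> graded_iso G L A M B"
  shows "graded_identities G M B \<subseteq> graded_identities G L A"
proof
  let ?X = "graded_vars G"
  have fi: "f \<in> alg_iso L M" using f by (simp add: graded_iso_def)
  then have fh: "f \<in> alg_hom L M" and inj: "inj_on f (carrier L)" by (auto simp: alg_iso_def bij_betw_def)
  interpret L: lie_algebra class_ring L by (rule L)
  fix P assume P: "P \<in> graded_identities G M B"
  then have Pc: "P \<in> carrier (free_lie ?X)" by (simp add: graded_identities_def)
  have "\<phi> P = \<zero>\<^bsub>L\<^esub>" if \<phi>: "\<phi> \<in> alg_hom (free_lie ?X) L" "\<forall>(i, g)\<in>?X. \<phi> (free_lie_var ?X (i, g)) \<in> A g" for \<phi>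
  proof -
    have h: "(\<lambda>x. f (\<phi> x)) \<in> alg_hom (free_lie ?X) M"
      using fh \<phi>(1) unfolding alg_hom_def LinearCombinations.module_hom_def by (auto simp: Pi_iff)
    have gr: "\<forall>(i, g)\<in>?X. f (\<phi> (free_lie_var ?X (i, g))) \<in> B g"
      using \<phi>(2) f unfolding graded_iso_def graded_vars_def by blast
    have "\<forall>\<phi>\<in>alg_hom (free_lie ?X) M.
        (\<forall>(i, g)\<in>?X. \<phi> (free_lie_var ?X (i, g)) \<in> B g) \<longrightarrow> \<phi> P = \<zero>\<^bsub>M\<^esub>"
      using P by (simp add: graded_identities_def)
    from bspec[OF this h] have "f (\<phi> P) = \<zero>\<^bsub>M\<^esub>" using gr by blast
    then have "f (\<phi> P) = f \<zero>\<^bsub>L\<^esub>" using alg_iso_zero[OF L M fi] by simp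
    moreover have "\<phi> P \<in> carrier L"
      using \<phi>(1) Pc unfolding alg_hom_def LinearCombinations.module_hom_def by auto
    ultimately show ?thesis using inj L.M.zero_closed by (auto dest: inj_onD)
  qed
  then show "P \<in> graded_identities G L A" using Pc unfolding graded_identities_def by blast
qed

lemma alg_iso_inv:
  assumes f: "f \<in> alg_iso L M"
    and L: "lie_algebra class_ring (L :: ('f::field, 'v) module)" and M: "lie_algebra class_ring (M :: ('f, 'w) module)"
  shows "inv_into (carrier L) f \<in> alg_iso M L"
proof (rule alg_isoI)
  let ?i = "inv_into (carrier L) f"
  interpret L: lie_algebra class_ring L by (rule L)
  have b: "bij_betw f (carrier L) (carrier M)" using f by (simp add: alg_iso_def)
  show "bij_betw ?i (carrier M) (carrier L)" by (rule bij_betw_inv_into[OF b])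
  have ic: "?i x \<in> carrier L" and fi: "f (?i x) = x" if "x \<in> carrier M" for x
    using that b by (auto simp: bij_betw_def inv_into_into f_inv_into_f)
  have ii: "?i (f x) = x" if "x \<in> carrier L" for x using that b by (simp add: bij_betw_def)
  have ops: "f (x \<oplus>\<^bsub>L\<^esub> y) = f x \<oplus>\<^bsub>M\<^esub> f y" "f (x \<otimes>\<^bsub>L\<^esub> y) = f x \<otimes>\<^bsub>M\<^esub> f y" "f (a \<odot>\<^bsub>L\<^esub> x) = a \<odot>\<^bsub>M\<^esub> f x"
    if "x \<in> carrier L" "y \<in> carrier L" for x y a
    using f that unfolding alg_iso_def alg_hom_def LinearCombinations.module_hom_def by auto
  fix x assume x: "x \<in> carrier M"
  have sm: "a \<odot>\<^bsub>L\<^esub> ?i x \<in> carrier L" for a using L.smult_closed[OF _ ic[OF x], of a] by simp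
  show "?i (a \<odot>\<^bsub>M\<^esub> x) = a \<odot>\<^bsub>L\<^esub> ?i x" for a
    using ii[OF sm, of a] ops(3)[OF ic[OF x] ic[OF x], of a] fi[OF x] by simp
  fix y assume y: "y \<in> carrier M"
  show "?i (x \<oplus>\<^bsub>M\<^esub> y) = ?i x \<oplus>\<^bsub>L\<^esub> ?i y"
    using ii[OF L.M.a_closed[OF ic[OF x] ic[OF y]]] ops(1)[OF ic[OF x] ic[OF y]] fi[OF x] fi[OF y] by simp
  show "?i (x \<otimes>\<^bsub>M\<^esub> y) = ?i x \<otimes>\<^bsub>L\<^esub> ?i y"
    using ii[OF L.br_closed[OF ic[OF x] ic[OF y]]] ops(2)[OF ic[OF x] ic[OF y]] fi[OF x] fi[OF y] by simp
qed

lemma ZZ_sum: "(\<And>s. s \<in> S \<Longrightarrow> f s \<in> ZZ n) \<Longrightarrow> sum f S \<in> ZZ n"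
  by (induction S rule: infinite_finite_induct) (auto intro: ZZ_add)

text \<open>A graded isomorphism is only required to map components into components. If the image of
  x has degree g, then the components of x of other degrees have zero image in the quotient, hence
  are central, and dropping them does not change the coset.\<close>

lemma graded_iso_surj:
  fixes A B :: "'g \<Rightarrow> 'f::field mat set"
  assumes G: "group G" and A: "grading G (UT n) A" and B: "grading G (UT n) B"
    and f: "f \<in> graded_iso G (QQ n) (quot_grading (UT n) (lie_center (UT n)) A) (QQ n) (quot_grading (UT n) (lie_center (UT n)) B)"
    and g: "g \<in> carrier G" and Q: "Q \<in> quot_grading (UT n) (lie_center (UT n)) B g"
  shows "inv_into (carrier (QQ n)) f Q \<in> quot_grading (UT n) (lie_center (UT n)) A g"
proof -
  interpret A: tri_grading G n "\<lambda>g. fm n ` A g" by (rule tri_grading_of_grading[OF G A])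
  interpret B: tri_grading G n "\<lambda>g. fm n ` B g" by (rule tri_grading_of_grading[OF G B])
  have qA: "quot_grading (UT n) (lie_center (UT n)) A h = cs n ` fm n ` A h" if "h \<in> carrier G" for h
    by (rule quot_grading_cs[where A = A and g = h]) (rule grading_carrier[OF A that])
  have qB: "quot_grading (UT n) (lie_center (UT n)) B h = cs n ` fm n ` B h" if "h \<in> carrier G" for h
    by (rule quot_grading_cs[where A = B and g = h]) (rule grading_carrier[OF B that])
  have fi: "f \<in> alg_iso (QQ n) (QQ n)" and fg: "\<And>h. h \<in> carrier G \<Longrightarrow> f ` (cs n ` fm n ` A h) \<subseteq> cs n ` fm n ` B h"
    using f qA qB unfolding graded_iso_def by auto
  have bij: "bij_betw f (carrier (QQ n)) (carrier (QQ n))" using fi by (simp add: alg_iso_def)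
  have f0: "f (cs n 0) = cs n 0" using alg_iso_zero[OF lie_algebra_QQ lie_algebra_QQ fi] by (simp add: QQ_zero)
  have fadd: "f (cs n (x + y)) = f (cs n x) \<oplus>\<^bsub>QQ n\<^esub> f (cs n y)" if "x \<in> UU n" "y \<in> UU n" for x y
  proof -
    have "f (cs n x \<oplus>\<^bsub>QQ n\<^esub> cs n y) = f (cs n x) \<oplus>\<^bsub>QQ n\<^esub> f (cs n y)"
      using fi cs_closed[OF that(1)] cs_closed[OF that(2)]
      unfolding alg_iso_def alg_hom_def LinearCombinations.module_hom_def by blast
    then show ?thesis unfolding cs_ops(1)[OF that] .
  qed
  have inj: "x - y \<in> ZZ n" if "x \<in> UU n" "y \<in> UU n" "f (cs n x) = f (cs n y)" for x y
    using inj_onD[OF bij_betw_imp_inj_on[OF bij] that(3) cs_closed[OF that(1)] cs_closed[OF that(2)]]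
    unfolding cs_eq_iff[OF that(1,2)] .
  obtain y where y: "y \<in> fm n ` B g" "Q = cs n y" using Q qB[OF g] by blast
  have yU: "y \<in> UU n" by (rule B.A_UU[OF g y(1)])
  have "Q \<in> f ` carrier (QQ n)" using bij cs_closed[OF yU] y(2) by (simp add: bij_betw_def)
  then obtain x where x: "x \<in> UU n" "f (cs n x) = Q" unfolding QQ_carrier by blast
  have "\<exists>w. w \<in> fm n ` B h \<and> f (cs n (A.pr h x)) = cs n w" if "h \<in> A.supp" for h
  proof -
    have h: "h \<in> carrier G" using that A.supp_carrier by blast
    show ?thesis using fg[OF h] A.pr_A[OF x(1) h] by blast
  qed
  then obtain w where w: "\<And>h. h \<in> A.supp \<Longrightarrow> w h \<in> fm n ` B h \<and> f (cs n (A.pr h x)) = cs n (w h)" by metis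
  have wU: "w h \<in> UU n" if "h \<in> A.supp" for h using w[OF that] B.A_UU A.supp_carrier that by blast
  have "f (cs n (\<Sum>h\<in>S. A.pr h x)) = cs n (\<Sum>h\<in>S. w h)" if "finite S" "S \<subseteq> A.supp" for S
    using that
  proof (induction S rule: finite_induct)
    case (insert h S)
    have U: "A.pr h x \<in> UU n" "(\<Sum>h\<in>S. A.pr h x) \<in> UU n" "w h \<in> UU n" "(\<Sum>h\<in>S. w h) \<in> UU n"
      using x(1) A.pr_UU wU insert.prems by (auto intro!: NN_sum)
    have "f (cs n (A.pr h x)) = cs n (w h)" "f (cs n (\<Sum>h\<in>S. A.pr h x)) = cs n (\<Sum>h\<in>S. w h)"
      using w insert by auto
    then show ?case unfolding sum.insert[OF insert(1,2)] fadd[OF U(1,2)] by (simp only: cs_ops(1)[OF U(3,4)])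
  qed (simp add: f0)
  from this[OF A.finite_supp subset_refl]
  have "cs n y = cs n (\<Sum>h\<in>A.supp. w h)" unfolding A.sum_pr[OF x(1), symmetric] x(2) y(2) .
  moreover have sU: "(\<Sum>h\<in>A.supp. w h) \<in> UU n" using wU by (rule NN_sum)
  ultimately have d: "y - (\<Sum>h\<in>A.supp. w h) \<in> ZZ n" using cs_eq_iff[OF yU] by blast
  \<comment> \<open>The image of the k-th component is represented by w k, which is the k-th
    component of the sum of the w h. That sum differs from y, of degree g, by a central element, and
    the centre is graded.\<close>
  have prz: "A.pr k x \<in> ZZ n" if k: "k \<in> A.supp" "k \<noteq> g" for k
  proof -
    have kG: "k \<in> carrier G" using k A.supp_carrier by blast
    have "B.pr k (\<Sum>h\<in>A.supp. w h) = (\<Sum>h\<in>A.supp. B.pr k (w h))" using wU by (rule B.pr_sum)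
    also have "\<dots> = (\<Sum>h\<in>A.supp. if h = k then w k else 0)"
    proof (rule sum.cong)
      fix h assume h: "h \<in> A.supp"
      then have "B.pr k (w h) = (if k = h then w h else 0)"
        using w[OF h] A.supp_carrier by (intro B.pr_hom) auto
      then show "B.pr k (w h) = (if h = k then w k else 0)" by auto
    qed simp
    also have "\<dots> = w k" using k(1) by (simp add: A.finite_supp)
    finally have "B.pr k (y - (\<Sum>h\<in>A.supp. w h)) = - w k"
      using B.pr_diff[OF yU sU, of k] B.pr_hom[OF y(1) g, of k] k(2) by simp
    then have "- w k \<in> ZZ n" using B.pr_ZZ[OF d kG] by simp
    then have "w k - 0 \<in> ZZ n" using ZZ_uminus[of "- w k" n] by simp
    then have "cs n (w k) = cs n 0" using cs_eq_iff[OF wU[OF k(1)], of 0] by simp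
    then have "f (cs n (A.pr k x)) = f (cs n 0)" using w[OF k(1)] f0 by simp
    then show ?thesis using inj[of "A.pr k x" 0] A.pr_UU[OF x(1)] by simp
  qed
  have xg: "x = A.pr g x + (\<Sum>h\<in>A.supp - {g}. A.pr h x)"
  proof (cases "g \<in> A.supp")
    case True
    then have "(\<Sum>h\<in>A.supp. A.pr h x) = A.pr g x + (\<Sum>h\<in>A.supp - {g}. A.pr h x)"
      by (rule sum.remove[OF A.finite_supp])
    then show ?thesis unfolding A.sum_pr[OF x(1), symmetric] .
  next
    case False
    then have "A.supp - {g} = A.supp" by blast
    then show ?thesis using A.sum_pr[OF x(1)] A.pr_not_supp[OF x(1) False] by (metis add_0)
  qed
  have "(\<Sum>h\<in>A.supp - {g}. A.pr h x) \<in> ZZ n" by (rule ZZ_sum) (use prz in blast)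
  then have "x - A.pr g x \<in> ZZ n" using xg by (metis add_diff_cancel_left')
  then have "cs n x = cs n (A.pr g x)" using cs_eq_iff[OF x(1) A.pr_UU[OF x(1)]] by blast
  moreover have "inv_into (carrier (QQ n)) f Q = cs n x"
    using bij cs_closed[OF x(1)] x(2) unfolding bij_betw_def by (metis inv_into_f_f)
  ultimately show ?thesis unfolding qA[OF g] using A.pr_A[OF x(1) g] by simp
qed

lemma graded_iso_same_identities:
  fixes A B :: "'g \<Rightarrow> 'f::field mat set"
  assumes "group G" "grading G (UT n) A" "grading G (UT n) B"
    and f: "f \<in> graded_iso G (QQ n) (quot_grading (UT n) (lie_center (UT n)) A) (QQ n) (quot_grading (UT n) (lie_center (UT n)) B)"
  shows "graded_identities G (QQ n) (quot_grading (UT n) (lie_center (UT n)) A) =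
    graded_identities G (QQ n) (quot_grading (UT n) (lie_center (UT n)) B)"
proof (rule subset_antisym)
  have "f \<in> alg_iso (QQ n) (QQ n)" using f by (simp add: graded_iso_def)
  then have "inv_into (carrier (QQ n)) f \<in> alg_iso (QQ n) (QQ n)"
    by (rule alg_iso_inv) (rule lie_algebra_QQ)+
  then have "inv_into (carrier (QQ n)) f \<in> graded_iso G (QQ n) (quot_grading (UT n) (lie_center (UT n)) B)
      (QQ n) (quot_grading (UT n) (lie_center (UT n)) A)"
    using graded_iso_surj[OF assms] unfolding graded_iso_def by blast
  then show "graded_identities G (QQ n) (quot_grading (UT n) (lie_center (UT n)) A) \<subseteq>
      graded_identities G (QQ n) (quot_grading (UT n) (lie_center (UT n)) B)"
    by (rule graded_identities_mono[OF lie_algebra_QQ lie_algebra_QQ])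
  show "graded_identities G (QQ n) (quot_grading (UT n) (lie_center (UT n)) B) \<subseteq>
      graded_identities G (QQ n) (quot_grading (UT n) (lie_center (UT n)) A)"
    using f by (rule graded_identities_mono[OF lie_algebra_QQ lie_algebra_QQ])
qed

lemma same_identities_imp_practically_isomorphic:
  fixes A B :: "'g \<Rightarrow> 'f::field mat set"
  assumes G: "group G" and A: "grading G (UT n) A" and B: "grading G (UT n) B"
    and eq: "graded_identities G (QQ n) (quot_grading (UT n) (lie_center (UT n)) A) =
      graded_identities G (QQ n) (quot_grading (UT n) (lie_center (UT n)) B)"
  shows "practically_graded_isomorphic G (UT n) A (UT n) B"
proof -
  have "same_monomials G (\<lambda>g. fm n ` A g) (\<lambda>g. fm n ` B g)"
    unfolding same_monomials_def
  proof (intro allI impI)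
    fix l r assume "set_bt l \<subseteq> carrier G" "set_bt r \<subseteq> carrier G"
    then have "set_bt (Node l r) \<subseteq> carrier G" by simp
    then show "nonvanishing (\<lambda>g. fm n ` A g) (Node l r) = nonvanishing (\<lambda>g. fm n ` B g) (Node l r)"
      using nonvanishing_iff_not_identity[OF G A] nonvanishing_iff_not_identity[OF G B] eq by metis
  qed
  from same_monomials_imp_isomorphic[OF tri_grading_of_grading[OF G A] tri_grading_of_grading[OF G B] this]
  show ?thesis using practically_isomorphicI[OF G A B] by blast
qed

theorem theorem13:
  fixes G :: "('g, 'm) monoid_scheme"
    and n :: nat
    and A\<^sub>1 A\<^sub>2 :: "'g \<Rightarrow> 'f::field mat set"
  defines "U \<equiv> UT_lie TYPE('f) n"
  defines "Z \<equiv> lie_center U"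
  assumes "group G"
    and "n > 0"
    and "grading G U A\<^sub>1"
    and "grading G U A\<^sub>2"
  shows "(practically_graded_isomorphic G U A\<^sub>1 U A\<^sub>2 \<longleftrightarrow>
      graded_isomorphic G (quot_alg U Z) (quot_grading U Z A\<^sub>1) (quot_alg U Z) (quot_grading U Z A\<^sub>2)) \<and>
    (graded_isomorphic G (quot_alg U Z) (quot_grading U Z A\<^sub>1) (quot_alg U Z) (quot_grading U Z A\<^sub>2) \<longleftrightarrow>
      graded_identities G (quot_alg U Z) (quot_grading U Z A\<^sub>1) =
      graded_identities G (quot_alg U Z) (quot_grading U Z A\<^sub>2))"
proof -
  note gr = assms(5)[unfolded U_def] assms(6)[unfolded U_def]
  have 12: "graded_isomorphic G (quot_alg U Z) (quot_grading U Z A\<^sub>1) (quot_alg U Z) (quot_grading U Z A\<^sub>2)"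
    if "practically_graded_isomorphic G U A\<^sub>1 U A\<^sub>2"
    using that unfolding practically_graded_isomorphic_def graded_isomorphic_def Z_def by blast
  have 23: "graded_identities G (quot_alg U Z) (quot_grading U Z A\<^sub>1) =
      graded_identities G (quot_alg U Z) (quot_grading U Z A\<^sub>2)"
    if "graded_isomorphic G (quot_alg U Z) (quot_grading U Z A\<^sub>1) (quot_alg U Z) (quot_grading U Z A\<^sub>2)"
    using that graded_iso_same_identities[OF assms(3) gr] unfolding graded_isomorphic_def Z_def U_def by blast
  have 31: "practically_graded_isomorphic G U A\<^sub>1 U A\<^sub>2"
    if "graded_identities G (quot_alg U Z) (quot_grading U Z A\<^sub>1) =
      graded_identities G (quot_alg U Z) (quot_grading U Z A\<^sub>2)"
    using same_identities_imp_practically_isomorphic[OF assms(3) gr] that unfolding Z_def U_def .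
  show ?thesis using 12 23 31 by blast
qed

end
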